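(* Let $k\ge1$ be a fixed integer. For every $\eta>0$ there is no constant $C_k$ such that the estimate $$0\le\mu_k(N)-\mu_k(\Omega)\le C_kW(\Omega)^{2+\eta}$$ holds for all bounded open convex planar domains $\Omega\subset\mathbb R^2$ of diameter one, with $N$ the weighted interval associated with a chosen diameter segment of $\Omega$ (any choice of diameter segment being allowed). Nor is there a function $\omega:(0,\infty)\to[0,\infty)$ with $\omega(W)=o(W^2)$ as $W\to0$ such that $\mu_k(N)-\mu_k(\Omega)\le\omega(W(\Omega))$ for all such $\Omega$ and $N$.
   Context: $W(\Omega)=\min_{e\in\mathbb S^{1}}\operatorname{diam}(\pi_{e^\perp}\Omega)$, where $\pi_{e^\perp}$ is orthogonal projection onto the line perpendicular to $e$ (the usual minimum width). Given $\Omega$ of diameter one and points $A,B\in\overline\Omega$ with $|A-B|=1$, choose Euclidean coordinates with $A=(0,0)$, $B=(1,0)$; $N$ is $[0,1]$ with measure $h(x)\,dx$, where $h(x)$ is the length of $\{y\in\mathbb R:(x,y)\in\Omega\}$. The eigenvalues $0=\mu_0(N)<\mu_1(N)\le\cdots$ are those (with multiplicity) of the self-adjoint operator on $L^2((0,1),h\,dx)$ associated with the quadratic form $v\mapsto\int_0^1h|v'|^2\,dx$ on $\{v\in W^{1,2}_{\mathrm{loc}}(0,1):\int_0^1h(|v|^2+|v'|^2)\,dx<\infty\}$. The eigenvalues $0=\mu_0(\Omega)<\mu_1(\Omega)\le\cdots$ are the Neumann eigenvalues of $-\Delta$ on $\Omega$, with multiplicity. *)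

theory Defs
  imports "HOL-Analysis.Analysis" "HOL-Library.Extended_Nat" "HOL-Library.Landau_Symbols"
begin

section \<open>Weak gradients and weighted Sobolev spaces\<close>

text \<open>All functions are real-valued. The operators below are real, so the eigenvalues and
  their multiplicities are those of the complexified operators. Elements of \<open>L\<^sup>2\<close> are represented
  by functions; equality almost everywhere enters only in \<open>independent_AE\<close>.\<close>

primrec C_k :: "nat \<Rightarrow> ('a::euclidean_space \<Rightarrow> real) \<Rightarrow> bool" where
  "C_k 0 \<phi> \<longleftrightarrow> continuous_on UNIV \<phi>"
| "C_k (Suc n) \<phi> \<longleftrightarrow>
     (\<forall>x. \<phi> differentiable (at x)) \<and>
     (\<forall>i\<in>Basis. C_k n (\<lambda>x. frechet_derivative \<phi> (at x) i))"

definition test_functions :: "'a::euclidean_space set \<Rightarrow> ('a \<Rightarrow> real) set" where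
  "test_functions U = {\<phi>. (\<forall>n. C_k n \<phi>) \<and>
     compact (closure {x. \<phi> x \<noteq> 0}) \<and> closure {x. \<phi> x \<noteq> 0} \<subseteq> U}"

definition L2 :: "'a measure \<Rightarrow> ('a \<Rightarrow> 'b::euclidean_space) set" where
  "L2 M = {f \<in> borel_measurable M. integrable M (\<lambda>x. (norm (f x))\<^sup>2)}"

definition L2_loc :: "'a::euclidean_space set \<Rightarrow> ('a \<Rightarrow> 'b::euclidean_space) set" where
  "L2_loc U = {f. \<forall>K. compact K \<and> K \<subseteq> U \<longrightarrow> f \<in> L2 (lebesgue_on K)}"

definition weak_gradient :: "'a::euclidean_space set \<Rightarrow> ('a \<Rightarrow> real) \<Rightarrow> ('a \<Rightarrow> 'a) \<Rightarrow> bool" where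
  "weak_gradient U u g \<longleftrightarrow>
     (\<forall>\<phi>\<in>test_functions U. \<forall>i\<in>Basis.
        (\<integral>x. u x * frechet_derivative \<phi> (at x) i \<partial>lebesgue_on U)
          = - (\<integral>x. (g x \<bullet> i) * \<phi> x \<partial>lebesgue_on U))"

definition weighted :: "'a::euclidean_space set \<Rightarrow> ('a \<Rightarrow> real) \<Rightarrow> 'a measure" where
  "weighted U w = density (lebesgue_on U) (\<lambda>x. ennreal (w x))"

text \<open>The form domain \<open>{u \<in> W\<^bsup>1,2\<^esup>\<^bsub>loc\<^esub>(U). \<integral>\<^sub>U w (|u|\<^sup>2 + |\<nabla>u|\<^sup>2) < \<infinity>}\<close>, each \<open>u\<close> being paired with its
  (a.e. unique) weak gradient. For \<open>w = 1\<close> this is \<open>W\<^bsup>1,2\<^esup>(U)\<close>.\<close>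

definition form_domain ::
    "'a::euclidean_space set \<Rightarrow> ('a \<Rightarrow> real) \<Rightarrow> (('a \<Rightarrow> real) \<times> ('a \<Rightarrow> 'a)) set" where
  "form_domain U w = {(u, g). u \<in> L2_loc U \<and> g \<in> L2_loc U \<and> weak_gradient U u g \<and>
     u \<in> L2 (weighted U w) \<and> g \<in> L2 (weighted U w)}"


section \<open>Eigenvalues of the operator associated with the form\<close>

text \<open>\<open>form_operator U w u f\<close>: \<open>u\<close> is in the domain of the self-adjoint operator on \<open>L\<^sup>2(U, w dx)\<close>
  associated with the quadratic form \<open>u \<mapsto> \<integral>\<^sub>U w |\<nabla>u|\<^sup>2\<close>, and the operator maps \<open>u\<close> to \<open>f\<close>.\<close>

definition form_operator ::
    "'a::euclidean_space set \<Rightarrow> ('a \<Rightarrow> real) \<Rightarrow> ('a \<Rightarrow> real) \<Rightarrow> ('a \<Rightarrow> real) \<Rightarrow> bool" where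
  "form_operator U w u f \<longleftrightarrow>
     f \<in> L2 (weighted U w) \<and>
     (\<exists>g. (u, g) \<in> form_domain U w \<and>
        (\<forall>(v, q)\<in>form_domain U w.
           (\<integral>x. g x \<bullet> q x \<partial>weighted U w) = (\<integral>x. f x * v x \<partial>weighted U w)))"

definition eigenspace :: "'a::euclidean_space set \<Rightarrow> ('a \<Rightarrow> real) \<Rightarrow> real \<Rightarrow> ('a \<Rightarrow> real) set" where
  "eigenspace U w \<mu> = {u. form_operator U w u (\<lambda>x. \<mu> * u x)}"

definition independent_AE :: "'a measure \<Rightarrow> nat \<Rightarrow> (nat \<Rightarrow> 'a \<Rightarrow> real) \<Rightarrow> bool" where
  "independent_AE M n u \<longleftrightarrow>
     (\<forall>c::nat \<Rightarrow> real. (AE x in M. (\<Sum>i<n. c i * u i x) = 0) \<longrightarrow> (\<forall>i<n. c i = 0))"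

text \<open>The dimension of the eigenspace as a subspace of \<open>L\<^sup>2\<close>; it is \<open>0\<close> if \<open>\<mu>\<close> is not an eigenvalue.\<close>

definition multiplicity :: "'a::euclidean_space set \<Rightarrow> ('a \<Rightarrow> real) \<Rightarrow> real \<Rightarrow> enat" where
  "multiplicity U w \<mu> =
     (SUP n \<in> {n. \<exists>u. (\<forall>i<n. u i \<in> eigenspace U w \<mu>) \<and> independent_AE (weighted U w) n u}. enat n)"

text \<open>The entry with index \<open>k\<close>, counted from \<open>0\<close>, of the nondecreasing list of eigenvalues in which
  each eigenvalue is repeated according to its multiplicity: the least \<open>t\<close> such that the eigenvalues
  in \<open>(-\<infinity>, t]\<close> have total multiplicity at least \<open>k + 1\<close>.\<close>

definition kth_eigenvalue :: "'a::euclidean_space set \<Rightarrow> ('a \<Rightarrow> real) \<Rightarrow> nat \<Rightarrow> real" where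
  "kth_eigenvalue U w k =
     Inf {t. \<exists>F. finite F \<and> F \<subseteq> {..t} \<and> enat k < (\<Sum>\<mu>\<in>F. multiplicity U w \<mu>)}"

definition neumann_eigenvalue :: "nat \<Rightarrow> (real^2) set \<Rightarrow> real" where
  "neumann_eigenvalue k \<Omega> = kth_eigenvalue \<Omega> (\<lambda>_. 1) k"


section \<open>Convex planar domains, width and the weighted interval\<close>

definition unit_diameter_domain :: "(real^2) set \<Rightarrow> bool" where
  "unit_diameter_domain \<Omega> \<longleftrightarrow> open \<Omega> \<and> convex \<Omega> \<and> bounded \<Omega> \<and> diameter \<Omega> = 1"

definition diameter_segment :: "(real^2) set \<Rightarrow> real^2 \<Rightarrow> real^2 \<Rightarrow> bool" where
  "diameter_segment \<Omega> A B \<longleftrightarrow> A \<in> closure \<Omega> \<and> B \<in> closure \<Omega> \<and> dist A B = 1"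

definition proj_perp :: "real^2 \<Rightarrow> real^2 \<Rightarrow> real^2" where
  "proj_perp e x = x - (x \<bullet> e) *\<^sub>R e"

definition min_width :: "(real^2) set \<Rightarrow> real" where
  "min_width \<Omega> = (INF e \<in> sphere 0 1. diameter (proj_perp e ` \<Omega>))"

definition rot90 :: "real^2 \<Rightarrow> real^2" where
  "rot90 v = vector [- (v $ 2), v $ 1]"

text \<open>The point with coordinates \<open>(x, y)\<close> in the Cartesian system with \<open>A = (0, 0)\<close> and \<open>B = (1, 0)\<close>,
  where \<open>dist A B = 1\<close>. The other such system replaces \<open>y\<close> by \<open>-y\<close> and gives the same \<open>section_length\<close>.\<close>

definition coord_point :: "real^2 \<Rightarrow> real^2 \<Rightarrow> real \<Rightarrow> real \<Rightarrow> real^2" where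
  "coord_point A B x y = A + x *\<^sub>R (B - A) + y *\<^sub>R rot90 (B - A)"

definition section_length :: "(real^2) set \<Rightarrow> real^2 \<Rightarrow> real^2 \<Rightarrow> real \<Rightarrow> real" where
  "section_length \<Omega> A B x = measure lebesgue {y. coord_point A B x y \<in> \<Omega>}"

definition interval_eigenvalue :: "nat \<Rightarrow> (real^2) set \<Rightarrow> real^2 \<Rightarrow> real^2 \<Rightarrow> real" where
  "interval_eigenvalue k \<Omega> A B = kth_eigenvalue {0<..<1} (section_length \<Omega> A B) k"

end

theory Submission
  imports Defs
begin

text \<open>
  The counterexamples are thin rectangles, and the chosen diameter segment is a diagonal. Let
  \<open>a\<^sup>2 + b\<^sup>2 = 1\<close> with \<open>b\<close> small, let \<open>\<Omega> = (0, a) \<times> (0, b)\<close>, \<open>A = (0, 0)\<close> and \<open>B = (a, b)\<close>. The width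
  of \<open>\<Omega>\<close> is positive and at most \<open>b\<close>, so it suffices that \<open>\<mu>\<^sub>k(N) - \<mu>\<^sub>k(\<Omega>) \<ge> b\<^sup>2\<close> for all small \<open>b\<close>
  (\<open>rectangle_gap\<close>).

  The functions \<open>cos (j \<pi> x\<^sub>1 / a)\<close> are Neumann eigenfunctions of \<open>\<Omega>\<close>, whence
  \<open>\<mu>\<^sub>k(\<Omega>) \<le> k\<^sup>2 \<pi>\<^sup>2 / (1 - b\<^sup>2)\<close> (\<open>rectangle_eigenvalue_upper_bound\<close>). The sections orthogonal to the
  diagonal have length \<open>h(x) = min x (min \<epsilon> (1 - x)) / (a b)\<close> with \<open>\<epsilon> = b\<^sup>2\<close>
  (\<open>section_length_rectangle\<close>): the weight is constant except on two end pieces of length \<open>\<epsilon>\<close>, where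
  it is linear. To leading order each end piece counts for half of its length only, so that
  \<open>\<mu>\<^sub>k(N)\<close> is about \<open>k\<^sup>2 \<pi>\<^sup>2 / (1 - b\<^sup>2)\<^sup>2\<close>, which exceeds \<open>\<mu>\<^sub>k(\<Omega>)\<close> by about \<open>k\<^sup>2 \<pi>\<^sup>2 b\<^sup>2\<close>.

  The lower bound for \<open>\<mu>\<^sub>k(N)\<close> (\<open>trapezoid_eigenvalue_lower_bound\<close>) comes from solving
  \<open>(h u')' + m\<^sup>2 h u = 0\<close> explicitly. On the first end piece the solutions whose flux \<open>h u'\<close> vanishes
  at \<open>0\<close> are the multiples of the Bessel function \<open>J\<^sub>0(m x)\<close>. In the middle such a solution is a
  multiple of \<open>cos (m (x - \<epsilon>) + \<delta>)\<close> with the phase shift \<open>\<delta> = arctan (J\<^sub>1 / J\<^sub>0) (m \<epsilon>)\<close>. Comparing it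
  with its mirror image at \<open>x = 1/2\<close> shows that \<open>m\<^sup>2\<close> is an eigenvalue exactly if
  \<open>m (1 - 2 \<epsilon>) + 2 \<delta>\<close> is an integral multiple of \<open>\<pi>\<close>, and that it is then simple, as long as
  \<open>m \<epsilon> \<le> 1/2\<close>. The left-hand side increases with \<open>m\<close>, and \<open>\<delta> \<le> 4/7 m \<epsilon>\<close>; hence the eigenvalue with
  index \<open>k\<close> is at least \<open>(k \<pi> / (1 - 6/7 \<epsilon>))\<^sup>2\<close>. Any factor below \<open>3/4\<close> in place of \<open>4/7\<close> would do.

  Eigenfunctions are given in the weak sense. The du Bois-Reymond lemma turns them into classical
  solutions with vanishing flux at both ends (\<open>eigenfunction_classical\<close>). Conversely, explicit
  solutions are tested against arbitrary elements of the form domain by means of cutoff functions: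
  the flux vanishes at the boundary fast enough to absorb the derivative of the cutoff
  (\<open>form_domain_by_parts\<close>, \<open>rectangle_eigenfunction\<close>).
\<close>

section \<open>Smooth functions\<close>

lemma C_k_imp_continuous: "C_k n f \<Longrightarrow> continuous_on UNIV f"
  by (cases n) (auto intro!: continuous_at_imp_continuous_on differentiable_imp_continuous_within)

lemma C_k_SucI:
  assumes "\<And>x. (f has_derivative f' x) (at x)"
    and "\<And>i. i \<in> Basis \<Longrightarrow> C_k n (\<lambda>x. f' x i)"
  shows "C_k (Suc n) f"
proof -
  have "frechet_derivative f (at x) = f' x" for x
    using assms(1) frechet_derivative_at by metis
  then show ?thesis using assms by (auto simp: differentiable_def)
qed

lemma C_k_has_derivative:
  assumes "C_k (Suc n) f"
  shows "(f has_derivative frechet_derivative f (at x)) (at x)"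
  using assms by (auto simp: frechet_derivative_works[symmetric])

lemma C_k_Suc_imp: "C_k (Suc n) f \<Longrightarrow> C_k n f"
proof (induction n arbitrary: f)
  case 0
  then show ?case using C_k_imp_continuous by fastforce
next
  case (Suc n)
  then show ?case by (metis C_k.simps(2))
qed

lemma C_k_const: "C_k n (\<lambda>x. c)"
proof (induction n arbitrary: c)
  case (Suc n)
  show ?case by (rule C_k_SucI[of _ "\<lambda>x i. 0"]) (use Suc in auto)
qed auto

lemma C_k_add: "C_k n f \<Longrightarrow> C_k n g \<Longrightarrow> C_k n (\<lambda>x. f x + g x)"
proof (induction n arbitrary: f g)
  case (Suc n)
  show ?case
    by (rule C_k_SucI[OF has_derivative_add[OF C_k_has_derivative[OF Suc.prems(1)]
            C_k_has_derivative[OF Suc.prems(2)]]])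
       (use Suc in auto)
qed (auto intro: continuous_intros)

lemma C_k_mult: "C_k n f \<Longrightarrow> C_k n g \<Longrightarrow> C_k n (\<lambda>x. f x * g x)"
proof (induction n arbitrary: f g)
  case (Suc n)
  show ?case
  proof (rule C_k_SucI[OF has_derivative_mult[OF C_k_has_derivative[OF Suc.prems(1)]
            C_k_has_derivative[OF Suc.prems(2)]]])
    fix i :: 'a assume i: "i \<in> Basis"
    show "C_k n (\<lambda>x. f x * frechet_derivative g (at x) i + frechet_derivative f (at x) i * g x)"
      using Suc i C_k_Suc_imp by (intro C_k_add Suc.IH) auto
  qed
qed (auto intro: continuous_intros)

lemma C_k_inverse: "C_k n f \<Longrightarrow> (\<And>x. f x \<noteq> 0) \<Longrightarrow> C_k n (\<lambda>x. inverse (f x))"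
proof (induction n arbitrary: f)
  case (Suc n)
  have d: "((\<lambda>x. inverse (f x)) has_derivative
      (\<lambda>h. - (inverse (f x) * frechet_derivative f (at x) h * inverse (f x)))) (at x)" for x
    by (rule Deriv.has_derivative_inverse[OF Suc.prems(2) C_k_has_derivative[OF Suc.prems(1)]])
  show ?case
  proof (rule C_k_SucI[OF d])
    fix i :: 'a assume i: "i \<in> Basis"
    have inv: "C_k n (\<lambda>x. inverse (f x))" using Suc C_k_Suc_imp by blast
    have "C_k n (\<lambda>x. - 1 * (inverse (f x) * frechet_derivative f (at x) i * inverse (f x)))"
      using Suc.prems i inv by (intro C_k_mult C_k_const) auto
    then show "C_k n (\<lambda>x. - (inverse (f x) * frechet_derivative f (at x) i * inverse (f x)))"
      by simp
  qed
qed (auto intro: continuous_intros)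

lemma C_k_SucI_real:
  fixes f :: "real \<Rightarrow> real"
  assumes "\<And>x. (f has_real_derivative f' x) (at x)" and "C_k n f'"
  shows "C_k (Suc n) f"
  by (rule C_k_SucI[of _ "\<lambda>x h. f' x * h"])
     (use assms in \<open>auto simp: has_field_derivative_def\<close>)

lemma frechet_derivative_real:
  assumes "(f has_real_derivative f') (at x)"
  shows "frechet_derivative f (at x) = (\<lambda>h. f' * h)"
  using assms by (metis frechet_derivative_at has_field_derivative_def)

lemma C_k_Suc_realD:
  fixes f :: "real \<Rightarrow> real"
  assumes "C_k (Suc n) f"
  shows "(f has_real_derivative deriv f x) (at x)" and "C_k n (deriv f)"
proof -
  show d: "(f has_real_derivative deriv f x) (at x)" for x
    using assms by (metis C_k.simps(2) DERIV_deriv_iff_real_differentiable)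
  have "C_k n (\<lambda>x. frechet_derivative f (at x) 1)" using assms by auto
  moreover have "(\<lambda>x. frechet_derivative f (at x) 1) = deriv f"
    using frechet_derivative_real[OF d] by auto
  ultimately show "C_k n (deriv f)" by simp
qed

lemma C_k_compose_inner:
  fixes \<psi> :: "real \<Rightarrow> real" and b :: "'a::euclidean_space"
  shows "C_k n \<psi> \<Longrightarrow> C_k n (\<lambda>x. \<psi> (c * (x \<bullet> b) + d))"
proof (induction n arbitrary: \<psi>)
  case 0
  then have "continuous_on UNIV \<psi>" by simp
  then show ?case
    by (auto intro!: continuous_on_compose2[of UNIV \<psi>] continuous_intros)
next
  case (Suc n)
  note p = C_k_Suc_realD[OF Suc.prems]
  have d: "((\<lambda>x. \<psi> (c * (x \<bullet> b) + d)) has_derivative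
      (\<lambda>h. (c * (h \<bullet> b)) * deriv \<psi> (c * (x \<bullet> b) + d))) (at x)" for x
    by (rule has_derivative_eq_rhs,
        rule DERIV_compose_FDERIV[OF p(1)], (rule derivative_intros)+) auto
  show ?case
  proof (rule C_k_SucI[OF d])
    fix i :: 'a
    show "C_k n (\<lambda>x. (c * (i \<bullet> b)) * deriv \<psi> (c * (x \<bullet> b) + d))"
      by (intro C_k_mult C_k_const Suc.IH p)
  qed
qed

lemma C_k_affine: "C_k n \<psi> \<Longrightarrow> C_k n (\<lambda>x::real. \<psi> (c * x + d))"
  using C_k_compose_inner[of n \<psi> c "1::real" d] by (simp add: inner_real_def)

lemma C_k_sin_cos: "C_k n (\<lambda>x::real. sin x) \<and> C_k n (\<lambda>x::real. cos x)"
proof (induction n)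
  case (Suc n)
  have "C_k (Suc n) (\<lambda>x::real. sin x)"
    by (rule C_k_SucI_real[of _ cos]) (use Suc in auto)
  moreover have "C_k (Suc n) (\<lambda>x::real. cos x)"
    using C_k_mult[OF C_k_const[of n "- 1"], of sin] Suc
    by (intro C_k_SucI_real[of _ "\<lambda>x. - sin x"]) (auto intro!: derivative_eq_intros)
  ultimately show ?case by blast
qed (auto intro: continuous_intros)

text \<open>The functions \<open>x\<^sup>-\<^sup>k exp (- 1/x)\<close>, extended by \<open>0\<close> to \<open>x \<le> 0\<close>. The derivative of each is a
  combination of two others, so all of them are smooth.\<close>

definition flat_exp :: "nat \<Rightarrow> real \<Rightarrow> real" where
  "flat_exp k x = (if x \<le> 0 then 0 else (1/x)^k * exp (- 1/x))"

lemma flat_exp_tendsto_0: "(flat_exp k \<longlongrightarrow> 0) (at 0)"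
proof -
  have "((\<lambda>t::real. t^k / exp t) \<longlongrightarrow> 0) at_top" by (rule tendsto_power_div_exp_0)
  then have "((\<lambda>x::real. (inverse x)^k / exp (inverse x)) \<longlongrightarrow> 0) (at_right 0)"
    by (rule filterlim_compose[OF _ filterlim_inverse_at_top_right])
  moreover have "\<forall>\<^sub>F x in at_right 0. (inverse x)^k / exp (inverse x) = flat_exp k x"
    unfolding eventually_at_right_field
    by (intro exI[of _ 1]) (auto simp: flat_exp_def inverse_eq_divide exp_minus field_simps)
  ultimately have r: "(flat_exp k \<longlongrightarrow> 0) (at_right 0)"
    by (rule Lim_transform_eventually)
  have "\<forall>\<^sub>F x in at_left 0. flat_exp k x = 0"
    unfolding eventually_at_left_field by (intro exI[of _ "-1"]) (auto simp: flat_exp_def)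
  then have "(flat_exp k \<longlongrightarrow> 0) (at_left 0)" by (rule tendsto_eventually)
  with r show ?thesis using filterlim_split_at by blast
qed

lemma flat_exp_DERIV:
  "(flat_exp k has_real_derivative flat_exp (k+2) x - k * flat_exp (k+1) x) (at x)"
proof (cases x "0::real" rule: linorder_cases)
  case less
  have "((\<lambda>x. 0) has_real_derivative 0) (at x)" by simp
  moreover have "\<forall>\<^sub>F y in nhds x. (0::real) = flat_exp k y"
    using less by (intro eventually_nhds_in_open[of "{..<0}" x, THEN eventually_mono])
      (auto simp: flat_exp_def)
  ultimately have "(flat_exp k has_real_derivative 0) (at x)"
    by (rule DERIV_cong_ev[OF refl _ refl, THEN iffD1, rotated])
  then show ?thesis using less by (simp add: flat_exp_def)
next
  case equal
  have "((\<lambda>h. (flat_exp k (0 + h) - flat_exp k 0) / h) \<longlongrightarrow> 0) (at 0)"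
    using flat_exp_tendsto_0[of "Suc k"]
    by (rule Lim_transform_eventually)
       (auto simp: eventually_at_topological flat_exp_def divide_simps intro!: exI[of _ UNIV])
  then show ?thesis using equal by (simp add: DERIV_def flat_exp_def)
next
  case greater
  have "((\<lambda>x. (1/x)^k * exp (- 1/x)) has_real_derivative
     (1/x)^(k+2) * exp (- 1/x) - k * ((1/x)^(k+1) * exp (- 1/x))) (at x)"
  proof (cases k)
    case 0
    then show ?thesis using greater
      by (auto intro!: derivative_eq_intros simp: field_simps power2_eq_square)
  next
    case (Suc j)
    have "((\<lambda>x. (1/x)^Suc j) has_real_derivative - real (Suc j) * (1/x)^(Suc j + 1)) (at x)"
      using greater
      by (auto intro!: derivative_eq_intros simp del: power_Suc) (simp add: field_simps)
    moreover have "((\<lambda>x. exp (- 1/x)) has_real_derivative (1/x)^2 * exp (- 1/x)) (at x)"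
      using greater by (auto intro!: derivative_eq_intros simp: field_simps power2_eq_square)
    ultimately have "((\<lambda>x. (1/x)^Suc j * exp (- 1/x)) has_real_derivative
       - real (Suc j) * (1/x)^(Suc j + 1) * exp (- 1/x) + (1/x)^2 * exp (- 1/x) * (1/x)^Suc j) (at x)"
      by (rule DERIV_mult)
    then show ?thesis unfolding Suc
      by (rule DERIV_cong) (simp only: of_nat_Suc power_add power_Suc power_0 power2_eq_square, algebra)
  qed
  moreover have "\<forall>\<^sub>F y in nhds x. (1/y)^k * exp (- 1/y) = flat_exp k y"
    using greater by (intro eventually_nhds_in_open[of "{0<..}" x, THEN eventually_mono])
      (auto simp: flat_exp_def)
  ultimately have "(flat_exp k has_real_derivative
     (1/x)^(k+2) * exp (- 1/x) - k * ((1/x)^(k+1) * exp (- 1/x))) (at x)"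
    by (rule DERIV_cong_ev[OF refl _ refl, THEN iffD1, rotated])
  then show ?thesis using greater by (simp add: flat_exp_def)
qed

lemma C_k_flat_exp: "C_k n (flat_exp k)"
proof (induction n arbitrary: k)
  case 0
  show ?case using flat_exp_DERIV[of k]
    by (auto intro!: continuous_at_imp_continuous_on DERIV_isCont)
next
  case (Suc n)
  have "C_k n (\<lambda>x. flat_exp (k+2) x + (- real k) * flat_exp (k+1) x)"
    by (intro C_k_add C_k_mult C_k_const Suc)
  then have "C_k n (\<lambda>x. flat_exp (k+2) x - k * flat_exp (k+1) x)" by simp
  then show ?case by (rule C_k_SucI_real[OF flat_exp_DERIV])
qed

text \<open>A smooth transition from \<open>0\<close> for \<open>x \<le> 0\<close> to \<open>1\<close> for \<open>x \<ge> 1\<close>.\<close>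

definition smooth_step :: "real \<Rightarrow> real" where
  "smooth_step x = flat_exp 0 x / (flat_exp 0 x + flat_exp 0 (1 - x))"

lemma flat_exp_0_nonneg: "flat_exp 0 x \<ge> 0" and flat_exp_0_pos: "x > 0 \<Longrightarrow> flat_exp 0 x > 0"
  and flat_exp_0_neg: "x \<le> 0 \<Longrightarrow> flat_exp 0 x = 0"
  by (auto simp: flat_exp_def)

lemma smooth_step_denominator: "flat_exp 0 x + flat_exp 0 (1 - x) > 0"
  using flat_exp_0_nonneg[of x] flat_exp_0_nonneg[of "1-x"] flat_exp_0_pos[of x] flat_exp_0_pos[of "1-x"]
  by (cases "x > 0") (auto simp: add_pos_nonneg add_nonneg_pos)

lemma C_k_smooth_step: "C_k n smooth_step"
proof -
  have "C_k n (\<lambda>x. flat_exp 0 x * inverse (flat_exp 0 x + flat_exp 0 ((-1) * x + 1)))"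
    using smooth_step_denominator
    by (intro C_k_mult C_k_inverse C_k_add C_k_flat_exp C_k_affine) (auto simp: less_imp_neq[THEN not_sym])
  then show ?thesis by (simp add: smooth_step_def[abs_def] divide_inverse)
qed

lemma smooth_step_0: "x \<le> 0 \<Longrightarrow> smooth_step x = 0"
  and smooth_step_1: "x \<ge> 1 \<Longrightarrow> smooth_step x = 1"
  and smooth_step_nonneg: "smooth_step x \<ge> 0"
  and smooth_step_le_1: "smooth_step x \<le> 1"
  using smooth_step_denominator[of x] flat_exp_0_nonneg[of x] flat_exp_0_nonneg[of "1-x"]
    flat_exp_0_pos[of x]
  by (auto simp: smooth_step_def flat_exp_0_neg)

lemma smooth_step_DERIV: "(smooth_step has_real_derivative deriv smooth_step x) (at x)"
  and C_k_deriv_smooth_step: "C_k n (deriv smooth_step)"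
  using C_k_Suc_realD[OF C_k_smooth_step] by auto

lemma deriv_smooth_step_0: "x < 0 \<or> x > 1 \<Longrightarrow> deriv smooth_step x = 0"
proof -
  assume "x < 0 \<or> x > 1"
  then have "\<exists>c. \<forall>\<^sub>F y in nhds x. smooth_step y = c"
  proof
    assume "x < 0"
    then show ?thesis
      by (intro exI[of _ 0] eventually_nhds_in_open[of "{..<0}" x, THEN eventually_mono])
         (auto simp: smooth_step_0)
  next
    assume "x > 1"
    then show ?thesis
      by (intro exI[of _ 1] eventually_nhds_in_open[of "{1<..}" x, THEN eventually_mono])
         (auto simp: smooth_step_1)
  qed
  then obtain c where "\<forall>\<^sub>F y in nhds x. smooth_step y = c" ..
  then have "deriv smooth_step x = deriv (\<lambda>_. c) x" by (intro deriv_cong_ev) auto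
  then show ?thesis by simp
qed

lemma deriv_smooth_step_bounded: "\<exists>K>0. \<forall>x. \<bar>deriv smooth_step x\<bar> \<le> K"
proof -
  have "continuous_on {0..1} (deriv smooth_step)"
    using C_k_imp_continuous[OF C_k_deriv_smooth_step[of 0]] continuous_on_subset by blast
  then have "compact (deriv smooth_step ` {0..1})" by (rule compact_continuous_image) auto
  then obtain K where K: "K > 0" "\<And>x. x \<in> {0..1} \<Longrightarrow> \<bar>deriv smooth_step x\<bar> \<le> K"
    using compact_imp_bounded[of "deriv smooth_step ` {0..1}"] unfolding bounded_pos by auto
  have "\<bar>deriv smooth_step x\<bar> \<le> K" for x
  proof (cases "x \<in> {0..1}")
    case True
    then show ?thesis by (rule K(2))
  next
    case False
    then show ?thesis using deriv_smooth_step_0[of x] K(1) by auto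
  qed
  with K(1) show ?thesis by auto
qed

section \<open>Primitives of integrable functions\<close>

text \<open>The positive and the negative part of \<open>G\<close>, replaced by a Borel function, are densities of finite
  measures that agree on all half-lines.\<close>

lemma interval_integrals_zero_imp_AE_zero:
  fixes G :: "real \<Rightarrow> real"
  assumes G: "integrable (lebesgue_on {a..b}) G"
    and z: "\<And>\<alpha> \<beta>. a \<le> \<alpha> \<Longrightarrow> \<alpha> < \<beta> \<Longrightarrow> \<beta> \<le> b \<Longrightarrow>
      (\<integral>x. indicator {\<alpha><..<\<beta>} x * G x \<partial>lebesgue_on {a..b}) = 0"
  shows "AE x in lebesgue_on {a..b}. G x = 0"
proof -
  define G1 where "G1 = (\<lambda>x. indicator {a..b} x * G x)"
  have G1: "integrable lebesgue G1"
    using G by (simp add: G1_def integrable_restrict_space)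
  have "\<exists>g\<in>borel_measurable lborel. AE x in lborel. G1 x = g x"
    using completion_ex_borel_measurable_real[OF borel_measurable_integrable[OF G1]] .
  then obtain g where g[measurable]: "g \<in> borel_measurable borel" and ae: "AE x in lborel. G1 x = g x"
    by auto
  have ae': "AE x in lebesgue. G1 x = g x"
    using ae AE_completion_iff by auto
  have intg: "integrable lborel g"
  proof -
    have "g \<in> borel_measurable lebesgue" by (rule measurable_completion) simp
    then have "integrable lebesgue g"
      using G1 ae' by (subst integrable_cong_AE[of g _ G1]) (auto elim: AE_mp)
    then show ?thesis by (simp add: integrable_completion)
  qed
  have gm: "g \<in> borel_measurable lebesgue" by (rule measurable_completion) simp
  have im: "(\<lambda>y. indicator S y * k y) \<in> borel_measurable lebesgue"
    if "k \<in> borel_measurable lebesgue" "S \<in> sets borel" for S and k :: "real \<Rightarrow> real"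
    using that by (intro borel_measurable_times borel_measurable_indicator) auto
  note G1m = borel_measurable_integrable[OF G1]
  have tail: "(\<integral>y. indicator {x<..} y * g y \<partial>lborel) = 0" for x
  proof -
    have "(\<integral>y. indicator {x<..} y * g y \<partial>lborel) = (\<integral>y. indicator {x<..} y * g y \<partial>lebesgue)"
      by (rule integral_completion[symmetric]) simp
    also have "\<dots> = (\<integral>y. indicator {x<..} y * G1 y \<partial>lebesgue)"
    proof (rule integral_cong_AE)
      show "AE y in lebesgue. indicator {x<..} y * g y = indicator {x<..} y * G1 y"
        using ae' by eventually_elim simp
    qed (use im gm G1m in simp_all)
    also have "\<dots> = (\<integral>y. indicator {max a x<..<b} y * G1 y \<partial>lebesgue)"
    proof (rule integral_cong_AE)
      have "AE y in lebesgue. y \<noteq> a \<and> y \<noteq> b"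
        by (simp add: AE_conj_iff AE_completion AE_lborel_singleton)
      then show "AE y in lebesgue. indicator {x<..} y * G1 y = indicator {max a x<..<b} y * G1 y"
        by eventually_elim (auto simp: G1_def indicator_def)
    qed (use im G1m in simp_all)
    also have "\<dots> = (\<integral>y. indicator {max a x<..<b} y * G y \<partial>lebesgue_on {a..b})"
      by (simp add: integral_restrict_space G1_def mult.left_commute)
    also have "\<dots> = 0"
      using z[of "max a x" b] by (cases "max a x < b") auto
    finally show ?thesis .
  qed
  have fin: "(\<integral>\<^sup>+ y. ennreal (g y) \<partial>lborel) < \<infinity>" "(\<integral>\<^sup>+ y. ennreal (- g y) \<partial>lborel) < \<infinity>"
    using intg by (auto simp: real_integrable_def less_top)
  have "density lborel (\<lambda>x. ennreal (g x)) = density lborel (\<lambda>x. ennreal (- g x))"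
  proof (rule measure_eqI_lessThan)
    fix x :: real
    have pos: "emeasure (density lborel (\<lambda>x. ennreal (g x))) {x<..}
        = (\<integral>\<^sup>+ y. ennreal (indicator {x<..} y * g y) \<partial>lborel)"
      by (subst emeasure_density) (auto intro!: nn_integral_cong simp: indicator_def)
    have neg: "emeasure (density lborel (\<lambda>x. ennreal (- g x))) {x<..}
        = (\<integral>\<^sup>+ y. ennreal (- (indicator {x<..} y * g y)) \<partial>lborel)"
      by (subst emeasure_density) (auto intro!: nn_integral_cong simp: indicator_def)
    have ig: "integrable lborel (\<lambda>y. indicator {x<..} y * g y)"
      using integrable_real_mult_indicator[OF _ intg, of "{x<..}"] by (simp add: mult.commute)
    then have f1: "(\<integral>\<^sup>+ y. ennreal (indicator {x<..} y * g y) \<partial>lborel) < top"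
      and f2: "(\<integral>\<^sup>+ y. ennreal (- (indicator {x<..} y * g y)) \<partial>lborel) < top"
      by (auto simp: real_integrable_def less_top)
    show "emeasure (density lborel (\<lambda>x. ennreal (g x))) {x<..} < \<infinity>"
      unfolding pos using f1 by simp
    have "enn2real (\<integral>\<^sup>+ y. ennreal (indicator {x<..} y * g y) \<partial>lborel)
        = enn2real (\<integral>\<^sup>+ y. ennreal (- (indicator {x<..} y * g y)) \<partial>lborel)"
      using tail[of x] real_lebesgue_integral_def[OF ig] by simp
    then show "emeasure (density lborel (\<lambda>x. ennreal (g x))) {x<..}
      = emeasure (density lborel (\<lambda>x. ennreal (- g x))) {x<..}"
      unfolding pos neg using f1 f2 by (metis ennreal_enn2real)
  qed auto
  then have "AE x in lborel. ennreal (g x) = ennreal (- g x)"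
    by (subst (asm) sigma_finite_measure.density_unique_iff[OF sigma_finite_lborel]) auto
  then have "AE x in lborel. G1 x = 0"
    using ae
  proof eventually_elim
    case (elim x)
    then show ?case by (cases "g x \<ge> 0") (auto simp: ennreal_neg)
  qed
  then have "AE x in lebesgue. G1 x = 0" using AE_completion_iff by auto
  then have "AE x in lebesgue. x \<in> {a..b} \<longrightarrow> G x = 0"
    by eventually_elim (auto simp: G1_def)
  then show ?thesis by (subst AE_restrict_space_iff) auto
qed

lemma has_integral_real_derivative:
  fixes F f :: "real \<Rightarrow> real"
  assumes "a \<le> b" and "\<And>x. x \<in> {a..b} \<Longrightarrow> (F has_real_derivative f x) (at x)"
  shows "(f has_integral (F b - F a)) {a..b}"
  by (rule fundamental_theorem_of_calculus[OF assms(1) has_vector_derivative_at_within[OF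
        assms(2)[unfolded has_real_derivative_iff_has_vector_derivative]]])

text \<open>Integration by parts for the primitive of a merely integrable function, which need not be
  differentiable at every point.\<close>

lemma integral_by_parts_primitive:
  fixes f \<phi> :: "real \<Rightarrow> real"
  assumes "a \<le> b" and f: "integrable (lebesgue_on {a..b}) f"
    and d: "\<And>x. x \<in> {a..b} \<Longrightarrow> (\<phi> has_real_derivative \<phi>' x) (at x)"
    and c: "continuous_on {a..b} \<phi>'"
  shows "integral {a..b} (\<lambda>x. integral {a..x} f * \<phi>' x) + integral {a..b} (\<lambda>x. f x * \<phi> x)
     = integral {a..b} f * \<phi> b"
proof -
  have fa: "f absolutely_integrable_on {a..b}"
    using f by (simp add: absolutely_integrable_on_def integrable_on_lebesgue_on)
  define V where "V = (\<lambda>x. integral {a..x} f)"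
  define A where "A = (\<lambda>x. integral {a..x} (\<lambda>x. \<bar>f x\<bar>))"
  have fi: "f integrable_on {a..b}" and afi: "(\<lambda>x. \<bar>f x\<bar>) integrable_on {a..b}"
    using fa by (auto simp: absolutely_integrable_on_def)
  have Vc: "continuous_on {a..b} V" unfolding V_def by (rule indefinite_integral_continuous_1[OF fi])
  have Ac: "continuous_on {a..b} A" unfolding A_def by (rule indefinite_integral_continuous_1[OF afi])
  have \<phi>c: "continuous_on {a..b} \<phi>"
    by (rule DERIV_continuous_on[OF has_field_derivative_at_within[OF d]])
  have "bounded (\<phi>' ` {a..b})"
    by (rule compact_imp_bounded[OF compact_continuous_image[OF c compact_Icc]])
  then obtain K where K: "K > 0" "\<And>x. x \<in> {a..b} \<Longrightarrow> \<bar>\<phi>' x\<bar> \<le> K"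
    unfolding bounded_pos by auto
  have i1: "(\<lambda>x. V x * \<phi>' x) integrable_on {a..b}"
    by (intro integrable_continuous_interval continuous_on_mult Vc c)
  have i2: "(\<lambda>x. f x * \<phi> x) integrable_on {a..b}"
    using absolutely_integrable_bounded_measurable_product_real[of "\<phi>" "{a..b}" f]
      fa compact_imp_bounded[OF compact_continuous_image[OF \<phi>c]]
      continuous_imp_measurable_on_sets_lebesgue[OF \<phi>c]
    by (simp add: absolutely_integrable_on_def mult.commute)
  define H where "H = (\<lambda>t. integral {a..t} (\<lambda>x. V x * \<phi>' x) + integral {a..t} (\<lambda>x. f x * \<phi> x) - V t * \<phi> t)"
  \<comment> \<open>\<open>H t\<close> is the defect of the formula on \<open>{a..t}\<close>; its increments are \<open>o(t - s)\<close>, so it is constant.\<close>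
  have est: "\<bar>H t - H s\<bar> \<le> 2 * K * (t - s) * (A t - A s)" if st: "a \<le> s" "s \<le> t" "t \<le> b" for s t
  proof -
    have sub: "{s..t} \<subseteq> {a..b}" using st by auto
    have comb: "integral {a..t} g - integral {a..s} g = integral {s..t} g"
      if "g integrable_on {a..b}" for g :: "real \<Rightarrow> real"
    proof -
      have "integral {a..s} g + integral {s..t} g = integral {a..t} g"
        using st by (intro Henstock_Kurzweil_Integration.integral_combine
            integrable_subinterval_real[OF that]) auto
      then show ?thesis by simp
    qed
    have sint: "g integrable_on {s..t}" if "g integrable_on {a..b}" for g :: "real \<Rightarrow> real"
      using integrable_subinterval_real[OF that sub] .
    have Vd: "\<bar>V x - V s\<bar> \<le> A t - A s" if x: "x \<in> {s..t}" for x
    proof -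
      have "V x - V s = integral {s..x} f"
        unfolding V_def using x st
        by (subst Henstock_Kurzweil_Integration.integral_combine[symmetric, of a s x])
           (auto intro!: integrable_subinterval_real[OF fi])
      also have "\<bar>\<dots>\<bar> \<le> integral {s..x} (\<lambda>x. \<bar>f x\<bar>)"
        using x st integral_norm_bound_integral[of f "{s..x}" "\<lambda>x. \<bar>f x\<bar>"]
          integrable_subinterval_real[OF fi, of s x] integrable_subinterval_real[OF afi, of s x]
        by auto
      also have "\<dots> \<le> integral {s..t} (\<lambda>x. \<bar>f x\<bar>)"
        using x st by (intro integral_subset_le integrable_subinterval_real[OF afi]) auto
      also have "\<dots> = A t - A s" unfolding A_def using comb[OF afi] by simp
      finally show ?thesis .
    qed
    have FT: "integral {s..t} (\<lambda>x. V s * \<phi>' x) = V s * (\<phi> t - \<phi> s)"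
    proof -
      have "(\<phi>' has_integral (\<phi> t - \<phi> s)) {s..t}"
        using st d by (intro has_integral_real_derivative) auto
      from integral_unique[OF has_integral_mult_right[OF this]] show ?thesis .
    qed
    have p1: "(\<lambda>x. (V x - V s) * \<phi>' x) integrable_on {s..t}"
      by (intro integrable_continuous_interval continuous_intros continuous_on_subset[OF Vc sub]
          continuous_on_subset[OF c sub])
    have p2: "(\<lambda>x. f x * (\<phi> x - \<phi> t)) integrable_on {s..t}"
      using integrable_diff[OF sint[OF i2] integrable_on_mult_left[OF sint[OF fi], of "\<phi> t"]]
      by (simp add: algebra_simps)
    have e1: "integral {s..t} (\<lambda>x. (V x - V s) * \<phi>' x)
       = integral {s..t} (\<lambda>x. V x * \<phi>' x) - V s * (\<phi> t - \<phi> s)"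
    proof -
      have "integral {s..t} (\<lambda>x. V x * \<phi>' x - V s * \<phi>' x) =
        integral {s..t} (\<lambda>x. V x * \<phi>' x) - integral {s..t} (\<lambda>x. V s * \<phi>' x)"
        by (intro integral_diff sint[OF i1] integrable_continuous_interval continuous_intros
            continuous_on_subset[OF c sub])
      then show ?thesis using FT by (simp add: algebra_simps)
    qed
    have e2: "integral {s..t} (\<lambda>x. f x * (\<phi> x - \<phi> t))
       = integral {s..t} (\<lambda>x. f x * \<phi> x) - (V t - V s) * \<phi> t"
    proof -
      have "integral {s..t} (\<lambda>x. f x * \<phi> x - f x * \<phi> t) =
        integral {s..t} (\<lambda>x. f x * \<phi> x) - integral {s..t} (\<lambda>x. f x * \<phi> t)"
        by (intro integral_diff sint[OF i2] integrable_on_mult_left sint[OF fi])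
      moreover have "integral {s..t} (\<lambda>x. f x * \<phi> t) = (V t - V s) * \<phi> t"
        using comb[OF fi] by (simp add: V_def)
      ultimately show ?thesis by (simp add: algebra_simps)
    qed
    have Heq: "H t - H s = integral {s..t} (\<lambda>x. (V x - V s) * \<phi>' x) + integral {s..t} (\<lambda>x. f x * (\<phi> x - \<phi> t))"
      using comb[OF i1] comb[OF i2] unfolding e1 e2 H_def by (simp add: algebra_simps)
    have b1: "\<bar>integral {s..t} (\<lambda>x. (V x - V s) * \<phi>' x)\<bar> \<le> (A t - A s) * K * (t - s)"
    proof -
      have "norm ((V x - V s) * \<phi>' x) \<le> (A t - A s) * K" if x: "x \<in> {s..t}" for x
        unfolding real_norm_def abs_mult
        using Vd[OF x] K(2)[of x] x sub by (intro mult_mono) auto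
      then have "norm (integral {s..t} (\<lambda>x. (V x - V s) * \<phi>' x)) \<le> integral {s..t} (\<lambda>x. (A t - A s) * K)"
        by (intro integral_norm_bound_integral[OF p1]) auto
      then show ?thesis using st by (simp add: mult_ac)
    qed
    have b2: "\<bar>integral {s..t} (\<lambda>x. f x * (\<phi> x - \<phi> t))\<bar> \<le> (A t - A s) * (K * (t - s))"
    proof -
      have "\<bar>\<phi> x - \<phi> t\<bar> \<le> K * (t - s)" if x: "x \<in> {s..t}" for x
      proof -
        have "norm (\<phi> x - \<phi> t) \<le> K * norm (x - t)"
        proof (rule field_differentiable_bound[of "{s..t}" \<phi> \<phi>'])
          fix y assume "y \<in> {s..t}"
          then have y: "y \<in> {a..b}" using sub by auto
          show "(\<phi> has_field_derivative \<phi>' y) (at y within {s..t})"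
            by (rule has_field_derivative_at_within[OF d[OF y]])
          show "norm (\<phi>' y) \<le> K" using K(2)[OF y] by simp
        qed (use x in auto)
        also have "\<dots> \<le> K * (t - s)" using x K(1) by auto
        finally show ?thesis by simp
      qed
      then have "norm (f x * (\<phi> x - \<phi> t)) \<le> \<bar>f x\<bar> * (K * (t - s))" if "x \<in> {s..t}" for x
        unfolding real_norm_def abs_mult using that by (intro mult_left_mono) auto
      from integral_norm_bound_integral[OF p2 integrable_on_mult_left[OF sint[OF afi], of "K * (t-s)"] this]
      have "\<bar>integral {s..t} (\<lambda>x. f x * (\<phi> x - \<phi> t))\<bar> \<le> integral {s..t} (\<lambda>x. \<bar>f x\<bar> * (K * (t - s)))"
        unfolding real_norm_def .
      also have "\<dots> = (A t - A s) * (K * (t - s))"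
        using comb[OF afi] by (simp add: A_def)
      finally show ?thesis .
    qed
    have "\<bar>H t - H s\<bar> \<le> (A t - A s) * K * (t - s) + (A t - A s) * (K * (t - s))"
      unfolding Heq by (rule order_trans[OF abs_triangle_ineq add_mono[OF b1 b2]])
    also have "\<dots> = 2 * K * (t - s) * (A t - A s)" by algebra
    finally show ?thesis .
  qed
  have "\<exists>c. \<forall>x\<in>{a..b}. H x = c"
  proof (rule has_field_derivative_zero_constant)
    fix x assume x: "x \<in> {a..b}"
    have "((\<lambda>y. 2 * K * \<bar>A y - A x\<bar>) \<longlongrightarrow> 2 * K * \<bar>A x - A x\<bar>) (at x within {a..b})"
      by (rule tendsto_mult_left[OF tendsto_rabs[OF tendsto_diff[OF
              Ac[unfolded continuous_on_def, rule_format, OF x] tendsto_const]]])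
    then have l: "((\<lambda>y. 2 * K * \<bar>A y - A x\<bar>) \<longlongrightarrow> 0) (at x within {a..b})" by simp
    have "\<bar>(H y - H x) / (y - x)\<bar> \<le> 2 * K * \<bar>A y - A x\<bar>" if y: "y \<in> {a..b}" "y \<noteq> x" for y
    proof -
      have "\<bar>H y - H x\<bar> \<le> 2 * K * \<bar>A y - A x\<bar> * \<bar>y - x\<bar>"
      proof (cases "x < y")
        case True
        then have "\<bar>H y - H x\<bar> \<le> 2 * K * (y - x) * (A y - A x)" using est[of x y] x y by auto
        also have "\<dots> \<le> 2 * K * \<bar>y - x\<bar> * \<bar>A y - A x\<bar>"
          using True K(1) mult_left_mono[of "A y - A x" "\<bar>A y - A x\<bar>" "2 * K * (y - x)"] by simp
        finally show ?thesis by (simp add: mult_ac)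
      next
        case False
        then have "\<bar>H x - H y\<bar> \<le> 2 * K * (x - y) * (A x - A y)" using est[of y x] x y by auto
        also have "\<dots> \<le> 2 * K * \<bar>y - x\<bar> * \<bar>A y - A x\<bar>"
          using False K(1) mult_left_mono[of "A x - A y" "\<bar>A y - A x\<bar>" "2 * K * (x - y)"] by simp
        finally show ?thesis by (simp add: mult_ac abs_minus_commute)
      qed
      moreover have "\<bar>y - x\<bar> > 0" using y by simp
      ultimately show ?thesis unfolding abs_divide by (simp add: pos_divide_le_eq)
    qed
    moreover have "\<bar>2 * K * \<bar>A y - A x\<bar>\<bar> = 2 * K * \<bar>A y - A x\<bar>" for y using K(1) by simp
    ultimately have "((\<lambda>y. (H y - H x) / (y - x)) \<longlongrightarrow> 0) (at x within {a..b})"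
      by (intro tendsto_0_le[OF l, of _ 1]) (simp add: eventually_at_filter)
    then show "(H has_real_derivative 0) (at x within {a..b})"
      by (simp add: has_field_derivative_iff)
  qed auto
  then have "H b = H a" using \<open>a \<le> b\<close> by auto
  then show ?thesis by (simp add: H_def V_def)
qed

section \<open>The du Bois-Reymond lemma\<close>

lemma test_functionsI:
  fixes \<phi> :: "'a::euclidean_space \<Rightarrow> real"
  assumes "\<And>n. C_k n \<phi>" and "compact K" "K \<subseteq> U" and "\<And>x. x \<notin> K \<Longrightarrow> \<phi> x = 0"
  shows "\<phi> \<in> test_functions U"
proof -
  have c: "closure {x. \<phi> x \<noteq> 0} \<subseteq> K"
    using assms by (intro closure_minimal) (auto intro: compact_imp_closed)
  then have "compact (closure {x. \<phi> x \<noteq> 0})"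
    using assms(2) by (metis closed_Int_compact closed_closure inf.absorb1)
  then show ?thesis using assms c unfolding test_functions_def by blast
qed

lemma test_function_realD:
  fixes \<phi> :: "real \<Rightarrow> real"
  assumes "\<phi> \<in> test_functions U"
  shows "(\<phi> has_real_derivative deriv \<phi> x) (at x)"
    and "continuous_on UNIV (deriv \<phi>)"
    and "frechet_derivative \<phi> (at x) 1 = deriv \<phi> x"
proof -
  have C: "C_k (Suc 0) \<phi>" using assms unfolding test_functions_def by blast
  show d: "(\<phi> has_real_derivative deriv \<phi> x) (at x)" by (rule C_k_Suc_realD[OF C])
  show "continuous_on UNIV (deriv \<phi>)" using C_k_Suc_realD(2)[OF C] by simp
  show "frechet_derivative \<phi> (at x) 1 = deriv \<phi> x" unfolding frechet_derivative_real[OF d] by simp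
qed

lemma test_function_support_interval:
  fixes \<phi> :: "real \<Rightarrow> real"
  assumes "\<phi> \<in> test_functions {0<..<1}"
  obtains a b where "0 < a" "a \<le> 1/4" "3/4 \<le> b" "b < 1" "\<And>x. x \<notin> {a<..<b} \<Longrightarrow> \<phi> x = 0"
proof -
  define K where "K = insert (1/4) (insert (3/4) (closure {x. \<phi> x \<noteq> 0}))"
  have K: "compact K" "K \<noteq> {}" "K \<subseteq> {0<..<1}"
    using assms by (auto simp: K_def test_functions_def compact_insert)
  obtain a where a: "a \<in> K" "\<And>x. x \<in> K \<Longrightarrow> a \<le> x" using compact_attains_inf[OF K(1,2)] by blast
  obtain b where b: "b \<in> K" "\<And>x. x \<in> K \<Longrightarrow> x \<le> b" using compact_attains_sup[OF K(1,2)] by blast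
  have ab: "0 < a" "b < 1" using a(1) b(1) K(3) by auto
  have "a \<le> 1/4" "3/4 \<le> b" using a(2)[of "1/4"] b(2)[of "3/4"] by (simp_all add: K_def)
  moreover have "\<phi> x = 0" if x: "x \<notin> {a/2<..<(b+1)/2}" for x
  proof (rule ccontr)
    assume "\<phi> x \<noteq> 0"
    then have "x \<in> K" unfolding K_def using closure_subset[of "{x. \<phi> x \<noteq> 0}"] by auto
    with a(2)[of x] b(2)[of x] x ab show False by auto
  qed
  ultimately show ?thesis using ab by (intro that[of "a/2" "(b+1)/2"]) auto
qed

lemma deriv_eq_0_outside:
  fixes \<phi> :: "real \<Rightarrow> real"
  assumes "\<And>x. x \<notin> {a..b} \<Longrightarrow> \<phi> x = 0" "x \<notin> {a..b}"
  shows "deriv \<phi> x = 0"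
proof -
  have "\<forall>\<^sub>F y in nhds x. \<phi> y = 0"
    using assms by (intro eventually_nhds_in_open[of "- {a..b}" x, THEN eventually_mono]) auto
  then have "deriv \<phi> x = deriv (\<lambda>_. 0) x" by (intro deriv_cong_ev) auto
  then show ?thesis by simp
qed

lemma integral_lebesgue_on_support:
  fixes f :: "'a::euclidean_space \<Rightarrow> real"
  assumes "K \<in> sets lebesgue" "U \<in> sets lebesgue" "K \<subseteq> U" "\<And>x. x \<in> U \<Longrightarrow> x \<notin> K \<Longrightarrow> f x = 0"
  shows "(\<integral>x. f x \<partial>lebesgue_on U) = (\<integral>x. f x \<partial>lebesgue_on K)"
proof -
  have "(\<lambda>x. indicator U x *\<^sub>R f x) = (\<lambda>x. indicator K x *\<^sub>R f x)"
    using assms(3,4) by (fastforce simp: indicator_def)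
  then show ?thesis using assms(1,2) by (simp add: integral_restrict_space)
qed

lemma integrable_lebesgue_on_support:
  fixes f :: "'a::euclidean_space \<Rightarrow> real"
  assumes "K \<in> sets lebesgue" "U \<in> sets lebesgue" "K \<subseteq> U" "\<And>x. x \<in> U \<Longrightarrow> x \<notin> K \<Longrightarrow> f x = 0"
  shows "integrable (lebesgue_on U) f = integrable (lebesgue_on K) f"
proof -
  have "(\<lambda>x. indicator U x *\<^sub>R f x) = (\<lambda>x. indicator K x *\<^sub>R f x)"
    using assms(3,4) by (fastforce simp: indicator_def)
  then show ?thesis using assms(1,2) by (simp add: integrable_restrict_space)
qed

lemma integrable_times_bounded:
  fixes f g :: "'a \<Rightarrow> real"
  assumes "integrable M f" "g \<in> borel_measurable M" "\<And>x. x \<in> space M \<Longrightarrow> \<bar>g x\<bar> \<le> B"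
  shows "integrable M (\<lambda>x. f x * g x)"
proof (rule Bochner_Integration.integrable_bound[of M "\<lambda>x. B * f x"])
  show "AE x in M. norm (f x * g x) \<le> norm (B * f x)"
  proof (rule AE_I2)
    fix x assume "x \<in> space M"
    then have g: "\<bar>g x\<bar> \<le> \<bar>B\<bar>" using assms(3)[of x] by simp
    then show "norm (f x * g x) \<le> norm (B * f x)"
      using mult_right_mono[OF g abs_ge_zero[of "f x"]] by (simp add: abs_mult mult.commute)
  qed
qed (use assms in auto)

lemma integrable_times_continuous:
  fixes f g :: "'a::euclidean_space \<Rightarrow> real"
  assumes f: "integrable (lebesgue_on K) f" and "compact K" and g: "continuous_on K g"
  shows "integrable (lebesgue_on K) (\<lambda>x. f x * g x)"
proof -
  have "bounded (g ` K)" by (rule compact_imp_bounded[OF compact_continuous_image[OF g assms(2)]])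
  then obtain B where "\<And>x. x \<in> K \<Longrightarrow> \<bar>g x\<bar> \<le> B" unfolding bounded_iff by auto
  moreover have "K \<in> sets lebesgue" using assms(2) by (simp add: compact_imp_closed borel_closed)
  ultimately show ?thesis
    by (intro integrable_times_bounded[OF f, of _ B] continuous_imp_measurable_on_sets_lebesgue g) auto
qed

text \<open>A smooth function with compact support and mean \<open>0\<close> is the derivative of a test function.\<close>

lemma test_function_primitive:
  fixes w :: "real \<Rightarrow> real"
  assumes C: "\<And>n. C_k n w" and "a \<le> b" and z: "\<And>x. x \<notin> {a..b} \<Longrightarrow> w x = 0"
    and i0: "integral {a..b} w = 0" and U: "{a..b} \<subseteq> U"
  obtains \<phi> where "\<phi> \<in> test_functions U" "\<And>x. x \<notin> {a..b} \<Longrightarrow> \<phi> x = 0"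
    "\<And>x. (\<phi> has_real_derivative w x) (at x)"
proof -
  \<comment> \<open>The lower limit lies strictly to the left of the support, so that \<open>\<phi>\<close> vanishes around \<open>a - 1\<close>.\<close>
  define \<phi> where "\<phi> = (\<lambda>x. integral {a-1..x} w)"
  have cont: "continuous_on S w" for S using C[of 0] continuous_on_subset by auto
  have left: "\<phi> x = 0" if "x \<le> a" for x
  proof -
    have "w a = 0"
    proof -
      have "(w \<longlongrightarrow> w a) (at_left a)"
        using cont[of UNIV] by (auto simp: continuous_on_eq_continuous_at continuous_within
            intro: filterlim_at_within_not_equal tendsto_within_subset)
      moreover have "(w \<longlongrightarrow> 0) (at_left a)"
        by (rule tendsto_eventually) (auto simp: eventually_at_left_field intro!: exI[of _ "a-1"] z)
      ultimately show ?thesis using tendsto_unique trivial_limit_at_left_real by blast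
    qed
    then have "integral {a-1..x} w = integral {a-1..x} (\<lambda>_. 0)"
      using that z by (intro integral_cong) (metis atLeastAtMost_iff order_antisym order_trans)
    then show ?thesis by (simp add: \<phi>_def)
  qed
  have right: "\<phi> x = 0" if "b \<le> x" for x
  proof -
    have "(w has_integral 0) {a..b}"
      using i0 integrable_integral[OF integrable_continuous_interval[OF cont]] by metis
    then have "(w has_integral 0) {a-1..x}"
      by (rule has_integral_on_superset) (use z that in auto)
    then show ?thesis unfolding \<phi>_def by (rule integral_unique)
  qed
  have d: "(\<phi> has_real_derivative w x) (at x)" for x
  proof (cases "x > a - 1")
    case True
    have "(\<phi> has_real_derivative w x) (at x within {a-1..x+1})"
      unfolding \<phi>_def using True by (intro integral_has_real_derivative cont) auto
    moreover have "at x within {a-1..x+1} = at x"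
      using True by (intro at_within_interior) (simp add: interior_atLeastAtMost_real)
    ultimately show ?thesis by (simp only:)
  next
    case False
    have "((\<lambda>_. 0) has_real_derivative w x) (at x)" using False z by simp
    then show ?thesis
      by (rule has_field_derivative_transform_within_open[of _ _ _ "{..<a}"]) (use False left in auto)
  qed
  have Cp: "C_k n \<phi>" for n using C_k_Suc_imp[OF C_k_SucI_real[OF d C]] .
  have out: "\<phi> x = 0" if "x \<notin> {a..b}" for x using that left right by force
  have "\<phi> \<in> test_functions U" by (rule test_functionsI[OF Cp compact_Icc U out])
  then show ?thesis using that out d by blast
qed

text \<open>Smooth functions supported in \<open>{\<alpha>..\<beta>}\<close> that tend pointwise to the indicator of \<open>{\<alpha><..<\<beta>}\<close>.\<close>

definition plateau :: "real \<Rightarrow> real \<Rightarrow> nat \<Rightarrow> real \<Rightarrow> real" where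
  "plateau \<alpha> \<beta> n x = smooth_step (n * (x - \<alpha>)) * smooth_step (n * (\<beta> - x))"

lemma C_k_plateau: "C_k m (plateau \<alpha> \<beta> n)"
proof -
  have "C_k m (\<lambda>x::real. smooth_step (n * x + - (n * \<alpha>)) * smooth_step (- n * x + n * \<beta>))"
    by (intro C_k_mult C_k_affine C_k_smooth_step)
  moreover have "(\<lambda>x::real. smooth_step (n * x + - (n * \<alpha>)) * smooth_step (- n * x + n * \<beta>)) = plateau \<alpha> \<beta> n"
    unfolding plateau_def by (intro ext arg_cong2[of _ _ _ _ "(*)"] arg_cong[of _ _ smooth_step])
      (simp_all add: algebra_simps)
  ultimately show ?thesis by simp
qed

lemma plateau_bounds: "0 \<le> plateau \<alpha> \<beta> n x" "plateau \<alpha> \<beta> n x \<le> 1" "\<bar>plateau \<alpha> \<beta> n x\<bar> \<le> 1"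
proof -
  show 1: "0 \<le> plateau \<alpha> \<beta> n x" by (simp add: plateau_def smooth_step_nonneg)
  show "plateau \<alpha> \<beta> n x \<le> 1"
    unfolding plateau_def by (rule mult_le_one) (auto simp: smooth_step_nonneg smooth_step_le_1)
  with 1 show "\<bar>plateau \<alpha> \<beta> n x\<bar> \<le> 1" by simp
qed

lemma plateau_outside: "x \<notin> {\<alpha><..<\<beta>} \<Longrightarrow> plateau \<alpha> \<beta> n x = 0"
proof -
  assume "x \<notin> {\<alpha><..<\<beta>}"
  then consider "x \<le> \<alpha>" | "x \<ge> \<beta>" by force
  then show ?thesis
    by cases (auto simp: plateau_def smooth_step_0 mult_nonneg_nonpos)
qed

lemma plateau_tendsto: "(\<lambda>n. plateau \<alpha> \<beta> n x) \<longlonglongrightarrow> indicator {\<alpha><..<\<beta>} x"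
proof (cases "x \<in> {\<alpha><..<\<beta>}")
  case True
  have ev: "\<forall>\<^sub>F n in sequentially. real n * t \<ge> 1" if "t > 0" for t :: real
  proof -
    obtain N :: nat where "1 / t < N" using reals_Archimedean2 by blast
    then have "real n * t \<ge> 1" if "n \<ge> N" for n
    proof -
      have "1 / t \<le> n" using that \<open>1 / t < N\<close> by (metis less_eq_real_def of_nat_mono order_trans)
      then show ?thesis using \<open>t > 0\<close> by (simp add: pos_divide_le_eq)
    qed
    then show ?thesis by (rule eventually_sequentiallyI)
  qed
  have "\<forall>\<^sub>F n in sequentially. plateau \<alpha> \<beta> n x = 1"
  proof -
    have "\<forall>\<^sub>F n in sequentially. real n * (x - \<alpha>) \<ge> 1 \<and> real n * (\<beta> - x) \<ge> 1"
      using True by (intro eventually_conj ev) auto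
    then show ?thesis by (rule eventually_mono) (simp add: plateau_def smooth_step_1)
  qed
  then have "(\<lambda>n. plateau \<alpha> \<beta> n x) \<longlonglongrightarrow> 1" by (rule tendsto_eventually)
  then show ?thesis using True by simp
qed (simp add: plateau_outside)

lemma plateau_integral_tendsto:
  fixes F :: "real \<Rightarrow> real"
  assumes "integrable (lebesgue_on {a..b}) F"
  shows "(\<lambda>n. \<integral>x. F x * plateau \<alpha> \<beta> n x \<partial>lebesgue_on {a..b})
     \<longlonglongrightarrow> (\<integral>x. indicator {\<alpha><..<\<beta>} x * F x \<partial>lebesgue_on {a..b})"
proof (rule integral_dominated_convergence[where w="\<lambda>x. \<bar>F x\<bar>"])
  have m: "plateau \<alpha> \<beta> n \<in> borel_measurable (lebesgue_on {a..b})" for n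
    by (intro continuous_imp_measurable_on_sets_lebesgue
        continuous_on_subset[OF C_k_imp_continuous[OF C_k_plateau[of 0]] subset_UNIV]) auto
  have mF: "F \<in> borel_measurable (lebesgue_on {a..b})" using assms by auto
  show "(\<lambda>x. F x * plateau \<alpha> \<beta> n x) \<in> borel_measurable (lebesgue_on {a..b})" for n
    by (intro borel_measurable_times mF m)
  show "(\<lambda>x. indicator {\<alpha><..<\<beta>} x * F x) \<in> borel_measurable (lebesgue_on {a..b})"
    by (intro borel_measurable_times mF measurable_restrict_space1
        borel_measurable_indicator) auto
  show "integrable (lebesgue_on {a..b}) (\<lambda>x. \<bar>F x\<bar>)" using assms by auto
  show "AE x in lebesgue_on {a..b}. (\<lambda>n. F x * plateau \<alpha> \<beta> n x) \<longlonglongrightarrow> indicator {\<alpha><..<\<beta>} x * F x"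
    using tendsto_mult_left[OF plateau_tendsto] by (intro AE_I2) (simp add: mult.commute)
  show "AE x in lebesgue_on {a..b}. norm (F x * plateau \<alpha> \<beta> n x) \<le> \<bar>F x\<bar>" for n
    using plateau_bounds(3)
    by (intro AE_I2) (auto simp: abs_mult intro: mult_left_le)
qed


text \<open>A locally integrable function that is orthogonal to the derivatives of all test functions is
  constant.\<close>

theorem du_bois_reymond:
  fixes F :: "real \<Rightarrow> real"
  assumes F: "\<And>a b. 0 < a \<Longrightarrow> b < 1 \<Longrightarrow> integrable (lebesgue_on {a..b}) F"
    and orth: "\<And>\<phi>. \<phi> \<in> test_functions {0<..<1} \<Longrightarrow>
      (\<integral>x. F x * deriv \<phi> x \<partial>lebesgue_on {0<..<1}) = 0"
  shows "\<exists>c. AE x in lebesgue_on {0<..<1}. F x = c"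
proof -
  define c where "c = 2 * (\<integral>x. indicator {1/4<..<3/4} x * F x \<partial>lebesgue_on {1/4..3/4})"
  have ind: "(\<integral>x. indicator {\<alpha><..<\<beta>} x * (1::real) \<partial>lebesgue_on {a..b}) = \<beta> - \<alpha>"
    if "a \<le> \<alpha>" "\<alpha> < \<beta>" "\<beta> \<le> b" for a b \<alpha> \<beta> :: real
  proof -
    have "(\<lambda>x::real. indicator {a..b} x *\<^sub>R (indicator {\<alpha><..<\<beta>} x * 1)) = (indicator {\<alpha><..<\<beta>} :: real \<Rightarrow> real)"
      using that by (auto simp: indicator_def)
    moreover have "(\<integral>x. indicator {\<alpha><..<\<beta>} x * (1::real) \<partial>lebesgue_on {a..b})
        = (\<integral>x. indicator {a..b} x *\<^sub>R (indicator {\<alpha><..<\<beta>} x * (1::real)) \<partial>(lebesgue :: real measure))"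
      by (rule integral_restrict_space) simp
    ultimately show ?thesis using that by simp
  qed
  have key: "(\<integral>x. indicator {\<alpha><..<\<beta>} x * F x \<partial>lebesgue_on {a..b}) = c * (\<beta> - \<alpha>)"
    if ab: "0 < a" "a \<le> 1/4" "3/4 \<le> b" "b < 1" and al: "a \<le> \<alpha>" "\<alpha> < \<beta>" "\<beta> \<le> b" for a b \<alpha> \<beta>
  proof -
    let ?M = "lebesgue_on {a..b}"
    define I where "I = (\<lambda>n. \<integral>x. plateau \<alpha> \<beta> n x \<partial>?M)"
    define J where "J = (\<lambda>n. \<integral>x. plateau (1/4) (3/4) n x \<partial>?M)"
    have one: "integrable ?M (\<lambda>x. 1 :: real)" by (intro continuous_imp_integrable_real continuous_intros)
    have Il: "I \<longlonglongrightarrow> \<beta> - \<alpha>"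
      using plateau_integral_tendsto[OF one, of \<alpha> \<beta>] ind[OF al] by (simp only: I_def mult_1_left)
    have "(\<integral>x. indicator {1/4<..<3/4} x * (1::real) \<partial>?M) = 3/4 - 1/4"
      by (rule ind) (use ab in auto)
    then have "J \<longlonglongrightarrow> 3/4 - 1/4"
      using plateau_integral_tendsto[OF one, of "1/4" "3/4"] by (simp only: J_def mult_1_left)
    then have Jl: "J \<longlonglongrightarrow> 1/2" by simp
    have Fi: "integrable ?M F" by (rule F) (use ab in auto)
    have pc: "continuous_on S (plateau s t n)" for S s t n
      by (rule continuous_on_subset[OF C_k_imp_continuous[OF C_k_plateau[of 0]] subset_UNIV])
    have pint: "integrable ?M (plateau s t n)" for s t n
      by (rule continuous_imp_integrable_real[OF pc])
    have Fp: "integrable ?M (\<lambda>x. F x * plateau s t n x)" for s t n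
      by (rule integrable_times_continuous[OF Fi compact_Icc pc])
    have eq: "J n * (\<integral>x. F x * plateau \<alpha> \<beta> n x \<partial>?M) = I n * (\<integral>x. F x * plateau (1/4) (3/4) n x \<partial>?M)" for n
    proof -
      \<comment> \<open>The coefficients make the mean of \<open>w\<close> vanish; the interval \<open>(1/4, 3/4)\<close> fixes the constant.\<close>
      define w where "w = (\<lambda>x. J n * plateau \<alpha> \<beta> n x + (- I n) * plateau (1/4) (3/4) n x)"
      have Cw: "C_k m w" for m unfolding w_def by (intro C_k_add C_k_mult C_k_const C_k_plateau)
      have w0: "w x = 0" if "x \<notin> {a..b}" for x
      proof -
        have "x \<notin> {\<alpha><..<\<beta>}" "x \<notin> {1/4<..<3/4}" using that al ab by auto
        then show ?thesis by (simp add: w_def plateau_outside)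
      qed
      have "(\<integral>x. w x \<partial>?M) = J n * I n + (- I n) * J n"
        unfolding w_def I_def J_def
        by (subst Bochner_Integration.integral_add) (simp_all add: pint)
      then have "(\<integral>x. w x \<partial>?M) = 0" by simp
      moreover have "(\<integral>x. w x \<partial>?M) = integral {a..b} w"
        unfolding w_def by (intro lebesgue_integral_eq_integral) (simp_all add: pint)
      ultimately have i0: "integral {a..b} w = 0" by simp
      have "a \<le> b" "{a..b} \<subseteq> {0<..<1}" using ab by auto
      from test_function_primitive[OF Cw this(1) w0 i0 this(2)]
      obtain \<phi> where \<phi>: "\<phi> \<in> test_functions {0<..<1}" "\<And>x. (\<phi> has_real_derivative w x) (at x)"
        by metis
      have "deriv \<phi> = w" using \<phi>(2) DERIV_imp_deriv by blast
      then have "0 = (\<integral>x. F x * w x \<partial>lebesgue_on {0<..<1})" using orth[OF \<phi>(1)] by simp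
      also have "\<dots> = (\<integral>x. F x * w x \<partial>?M)"
        by (rule integral_lebesgue_on_support) (use ab w0 in auto)
      also have "\<dots> = (\<integral>x. J n * (F x * plateau \<alpha> \<beta> n x) + (- I n) * (F x * plateau (1/4) (3/4) n x) \<partial>?M)"
        by (simp add: w_def algebra_simps)
      also have "\<dots> = J n * (\<integral>x. F x * plateau \<alpha> \<beta> n x \<partial>?M) + (- I n) * (\<integral>x. F x * plateau (1/4) (3/4) n x \<partial>?M)"
        by (subst Bochner_Integration.integral_add) (simp_all add: Fp)
      finally show ?thesis by simp
    qed
    have "(\<lambda>n. J n * (\<integral>x. F x * plateau \<alpha> \<beta> n x \<partial>?M)) \<longlonglongrightarrow> 1/2 * (\<integral>x. indicator {\<alpha><..<\<beta>} x * F x \<partial>?M)"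
      by (intro tendsto_mult Jl plateau_integral_tendsto Fi)
    moreover have "(\<lambda>n. I n * (\<integral>x. F x * plateau (1/4) (3/4) n x \<partial>?M))
        \<longlonglongrightarrow> (\<beta> - \<alpha>) * (\<integral>x. indicator {1/4<..<3/4} x * F x \<partial>?M)"
      by (intro tendsto_mult Il plateau_integral_tendsto Fi)
    ultimately have "1/2 * (\<integral>x. indicator {\<alpha><..<\<beta>} x * F x \<partial>?M)
        = (\<beta> - \<alpha>) * (\<integral>x. indicator {1/4<..<3/4} x * F x \<partial>?M)"
      unfolding eq by (rule LIMSEQ_unique)
    moreover have "(\<integral>x. indicator {1/4<..<3/4} x * F x \<partial>?M)
        = (\<integral>x. indicator {1/4<..<3/4} x * F x \<partial>lebesgue_on {1/4..3/4})"
      by (rule integral_lebesgue_on_support) (use ab in auto)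
    ultimately show ?thesis by (simp add: c_def)
  qed
  have loc: "AE x in lebesgue. x \<in> {a..b} \<longrightarrow> F x = c"
    if ab: "0 < a" "a \<le> 1/4" "3/4 \<le> b" "b < 1" for a b
  proof -
    have Fi: "integrable (lebesgue_on {a..b}) F" by (rule F) (use ab in auto)
    have ci: "integrable (lebesgue_on {a..b}) (\<lambda>x. c)" by (intro continuous_imp_integrable_real continuous_intros)
    have "AE x in lebesgue_on {a..b}. F x - c = 0"
    proof (rule interval_integrals_zero_imp_AE_zero)
      show "integrable (lebesgue_on {a..b}) (\<lambda>x. F x - c)" using Fi ci by simp
      fix \<alpha> \<beta> assume al: "a \<le> \<alpha>" "\<alpha> < \<beta>" "\<beta> \<le> b"
      have im: "(indicator {\<alpha><..<\<beta>} :: real \<Rightarrow> real) \<in> borel_measurable (lebesgue_on {a..b})"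
        by (intro measurable_restrict_space1 borel_measurable_indicator) auto
      have i1: "integrable (lebesgue_on {a..b}) (\<lambda>x. F x * indicator {\<alpha><..<\<beta>} x)"
        by (rule integrable_times_bounded[OF Fi im, of 1]) (auto simp: indicator_def)
      have i2: "integrable (lebesgue_on {a..b}) (\<lambda>x. c * indicator {\<alpha><..<\<beta>} x)"
        by (rule integrable_times_bounded[OF ci im, of 1]) (auto simp: indicator_def)
      have "(\<integral>x. indicator {\<alpha><..<\<beta>} x * (F x - c) \<partial>lebesgue_on {a..b})
        = (\<integral>x. F x * indicator {\<alpha><..<\<beta>} x - c * indicator {\<alpha><..<\<beta>} x \<partial>lebesgue_on {a..b})"
        by (simp add: algebra_simps)
      also have "\<dots> = (\<integral>x. F x * indicator {\<alpha><..<\<beta>} x \<partial>lebesgue_on {a..b})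
          - (\<integral>x. c * indicator {\<alpha><..<\<beta>} x \<partial>lebesgue_on {a..b})"
        by (rule Bochner_Integration.integral_diff[OF i1 i2])
      also have "\<dots> = 0" using key[OF ab al] ind[OF al] by (simp add: mult.commute)
      finally show "(\<integral>x. indicator {\<alpha><..<\<beta>} x * (F x - c) \<partial>lebesgue_on {a..b}) = 0" .
    qed
    then have "AE x in lebesgue. x \<in> {a..b} \<longrightarrow> F x - c = 0"
      by (subst (asm) AE_restrict_space_iff) auto
    then show ?thesis by simp
  qed
  have "AE x in lebesgue. \<forall>n::nat. x \<in> {1 / (real n + 4)..1 - 1 / (real n + 4)} \<longrightarrow> F x = c"
    unfolding AE_all_countable
  proof
    fix n :: nat
    have "1 / (real n + 4) \<le> 1/4" by (simp add: field_simps)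
    then show "AE x in lebesgue. x \<in> {1 / (real n + 4)..1 - 1 / (real n + 4)} \<longrightarrow> F x = c"
      by (intro loc) auto
  qed
  then have "AE x in lebesgue. x \<in> {0<..<1} \<longrightarrow> F x = c"
  proof eventually_elim
    case (elim x)
    show ?case
    proof
      assume x: "x \<in> {0<..<1}"
      define e where "e = min x (1 - x)"
      have e: "e > 0" using x by (simp add: e_def)
      obtain n :: nat where n: "1 / e < n" using reals_Archimedean2 by blast
      have "1 / (real n + 4) \<le> e"
        using n e by (simp add: field_simps)
      then have "x \<in> {1 / (real n + 4)..1 - 1 / (real n + 4)}" by (auto simp: e_def)
      then show "F x = c" using elim by blast
    qed
  qed
  then have "AE x in lebesgue_on {0<..<1}. F x = c" by (subst AE_restrict_space_iff) auto
  then show ?thesis by blast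
qed

text \<open>The primitive based at \<open>1/2\<close>. Integrals over \<open>{s..t}\<close> with \<open>t < s\<close> are \<open>0\<close>, so one of the two terms
  vanishes.\<close>

definition prim :: "(real \<Rightarrow> real) \<Rightarrow> real \<Rightarrow> real" where
  "prim f x = integral {1/2..x} f - integral {x..1/2} f"

lemma prim_eq:
  assumes f: "f integrable_on {a..b}" and "a \<le> 1/2" "1/2 \<le> b" and x: "x \<in> {a..b}"
  shows "prim f x = integral {a..x} f - integral {a..1/2} f"
proof (cases "x \<le> 1/2")
  case True
  have "integral {a..x} f + integral {x..1/2} f = integral {a..1/2} f"
    using True assms by (intro Henstock_Kurzweil_Integration.integral_combine
        integrable_subinterval_real[OF f]) auto
  moreover have "integral {1/2..x} f = 0"
  proof (cases "x = 1/2")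
    case True
    show ?thesis unfolding True by (simp only: box_real(2)[symmetric] integral_refl)
  qed (use True in auto)
  ultimately show ?thesis by (simp add: prim_def)
next
  case False
  have "integral {a..1/2} f + integral {1/2..x} f = integral {a..x} f"
    using False assms by (intro Henstock_Kurzweil_Integration.integral_combine
        integrable_subinterval_real[OF f]) auto
  then show ?thesis using False by (simp add: prim_def)
qed

lemma prim_by_parts:
  assumes f: "integrable (lebesgue_on {a..b}) f" and ab: "a \<le> 1/2" "1/2 \<le> b"
    and d: "\<And>x. x \<in> {a..b} \<Longrightarrow> (\<phi> has_real_derivative \<phi>' x) (at x)"
    and c: "continuous_on {a..b} \<phi>'" and z: "\<phi> a = 0" "\<phi> b = 0"
  shows "integrable (lebesgue_on {a..b}) (\<lambda>x. prim f x * \<phi>' x)"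
    and "(\<integral>x. prim f x * \<phi>' x \<partial>lebesgue_on {a..b}) = - (\<integral>x. f x * \<phi> x \<partial>lebesgue_on {a..b})"
proof -
  let ?M = "lebesgue_on {a..b}"
  have fi: "f integrable_on {a..b}" using f by (rule integrable_on_lebesgue_on) simp
  define V where "V = (\<lambda>x. integral {a..x} f)"
  have Vc: "continuous_on {a..b} V" unfolding V_def by (rule indefinite_integral_continuous_1[OF fi])
  have pV: "prim f x = V x - V (1/2)" if "x \<in> {a..b}" for x
    using prim_eq[OF fi ab that] by (simp add: V_def)
  have "continuous_on {a..b} (\<lambda>x. (V x - V (1/2)) * \<phi>' x)"
    by (intro continuous_intros Vc c)
  then have "continuous_on {a..b} (\<lambda>x. prim f x * \<phi>' x)"
    by (rule continuous_on_eq) (simp add: pV)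
  then show i1: "integrable ?M (\<lambda>x. prim f x * \<phi>' x)" by (rule continuous_imp_integrable_real)
  have "continuous_on {a..b} \<phi>"
    by (rule DERIV_continuous_on[OF has_field_derivative_at_within[OF d]])
  then have i3: "integrable ?M (\<lambda>x. f x * \<phi> x)"
    by (rule integrable_times_continuous[OF f compact_Icc])
  have parts: "integral {a..b} (\<lambda>x. V x * \<phi>' x) + integral {a..b} (\<lambda>x. f x * \<phi> x) = 0"
    using integral_by_parts_primitive[OF _ f d c] ab z by (simp add: V_def)
  have "(\<phi>' has_integral (\<phi> b - \<phi> a)) {a..b}"
    by (rule has_integral_real_derivative) (use ab d in auto)
  then have zz: "integral {a..b} \<phi>' = 0" using z by (simp add: integral_unique)
  have "(\<integral>x. prim f x * \<phi>' x \<partial>?M) = integral {a..b} (\<lambda>x. prim f x * \<phi>' x)"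
    by (rule lebesgue_integral_eq_integral[OF i1]) simp
  also have "\<dots> = integral {a..b} (\<lambda>x. V x * \<phi>' x - V (1/2) * \<phi>' x)"
    by (rule integral_cong) (simp add: pV left_diff_distrib)
  also have "\<dots> = integral {a..b} (\<lambda>x. V x * \<phi>' x) - integral {a..b} (\<lambda>x. V (1/2) * \<phi>' x)"
    by (intro integral_diff integrable_continuous_interval continuous_intros Vc c)
  also have "\<dots> = - integral {a..b} (\<lambda>x. f x * \<phi> x)" using parts zz by simp
  also have "\<dots> = - (\<integral>x. f x * \<phi> x \<partial>?M)"
    by (subst lebesgue_integral_eq_integral[OF i3]) auto
  finally show "(\<integral>x. prim f x * \<phi>' x \<partial>?M) = - (\<integral>x. f x * \<phi> x \<partial>?M)" .
qed

text \<open>A function on \<open>(0, 1)\<close> with locally integrable weak derivative \<open>f\<close> is a primitive of \<open>f\<close>.\<close>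

theorem weak_primitive:
  fixes u f :: "real \<Rightarrow> real"
  assumes u: "\<And>a b. 0 < a \<Longrightarrow> b < 1 \<Longrightarrow> integrable (lebesgue_on {a..b}) u"
    and f: "\<And>a b. 0 < a \<Longrightarrow> b < 1 \<Longrightarrow> integrable (lebesgue_on {a..b}) f"
    and w: "\<And>\<phi>. \<phi> \<in> test_functions {0<..<1} \<Longrightarrow>
      (\<integral>x. u x * deriv \<phi> x \<partial>lebesgue_on {0<..<1}) = - (\<integral>x. f x * \<phi> x \<partial>lebesgue_on {0<..<1})"
  shows "\<exists>c. AE x in lebesgue_on {0<..<1}. u x = c + prim f x"
proof -
  have fi: "f integrable_on {a..b}" if "0 < a" "b < 1" for a b
    using f[OF that] by (rule integrable_on_lebesgue_on) simp
  have pc: "continuous_on {a..b} (prim f)" if "0 < a" "a \<le> 1/2" "1/2 \<le> b" "b < 1" for a b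
  proof -
    have "continuous_on {a..b} (\<lambda>x. integral {a..x} f - integral {a..1/2} f)"
      by (intro continuous_intros indefinite_integral_continuous_1 fi that)
    then show ?thesis
      by (rule continuous_on_eq) (use prim_eq[OF fi] that in auto)
  qed
  have "\<exists>c. AE x in lebesgue_on {0<..<1}. u x - prim f x = c"
  proof (rule du_bois_reymond)
    fix a b :: real assume ab: "0 < a" "b < 1"
    have "integrable (lebesgue_on {min a (1/2)..max b (1/2)}) (prim f)"
      by (rule continuous_imp_integrable_real[OF pc]) (use ab in auto)
    moreover have "integrable (lebesgue_on {min a (1/2)..max b (1/2)}) u"
      by (rule u) (use ab in auto)
    ultimately have "integrable (lebesgue_on {min a (1/2)..max b (1/2)}) (\<lambda>x. u x - prim f x)"
      by simp
    then show "integrable (lebesgue_on {a..b}) (\<lambda>x. u x - prim f x)"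
      by (rule integrable_subinterval) auto
  next
    fix \<phi> :: "real \<Rightarrow> real" assume \<phi>: "\<phi> \<in> test_functions {0<..<1}"
    obtain a b where ab: "0 < a" "a \<le> 1/4" "3/4 \<le> b" "b < 1" and \<phi>0: "\<And>x. x \<notin> {a<..<b} \<Longrightarrow> \<phi> x = 0"
      using test_function_support_interval[OF \<phi>] by blast
    let ?M = "lebesgue_on {a..b}"
    have d0: "deriv \<phi> x = 0" if "x \<notin> {a..b}" for x
      by (rule deriv_eq_0_outside[OF _ that]) (use \<phi>0 in auto)
    note \<phi>d = test_function_realD[OF \<phi>]
    have dc: "continuous_on S (deriv \<phi>)" for S using \<phi>d(2) continuous_on_subset by blast
    have fab: "integrable ?M f" by (rule f) (use ab in auto)
    have i2: "integrable ?M (\<lambda>x. u x * deriv \<phi> x)"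
      by (rule integrable_times_continuous[OF u compact_Icc dc]) (use ab in auto)
    have half: "a \<le> 1/2" "1/2 \<le> b" and z: "\<phi> a = 0" "\<phi> b = 0" using ab \<phi>0 by auto
    note i1 = prim_by_parts(1)[OF fab half \<phi>d(1) dc z]
    have "(\<integral>x. prim f x * deriv \<phi> x \<partial>?M) = - (\<integral>x. f x * \<phi> x \<partial>?M)"
      by (rule prim_by_parts(2)[OF fab half \<phi>d(1) dc z])
    also have "\<dots> = - (\<integral>x. f x * \<phi> x \<partial>lebesgue_on {0<..<1})"
      by (subst integral_lebesgue_on_support[of "{a..b}" "{0<..<1}"]) (use ab \<phi>0 in auto)
    also have "\<dots> = (\<integral>x. u x * deriv \<phi> x \<partial>lebesgue_on {0<..<1})"
      using w[OF \<phi>] by simp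
    also have "\<dots> = (\<integral>x. u x * deriv \<phi> x \<partial>?M)"
      by (rule integral_lebesgue_on_support) (use ab d0 in auto)
    finally have e: "(\<integral>x. prim f x * deriv \<phi> x \<partial>?M) = (\<integral>x. u x * deriv \<phi> x \<partial>?M)" .
    have "(\<integral>x. (u x - prim f x) * deriv \<phi> x \<partial>lebesgue_on {0<..<1})
       = (\<integral>x. (u x - prim f x) * deriv \<phi> x \<partial>?M)"
      by (rule integral_lebesgue_on_support) (use ab d0 in auto)
    also have "\<dots> = (\<integral>x. u x * deriv \<phi> x - prim f x * deriv \<phi> x \<partial>?M)"
      by (simp add: left_diff_distrib)
    also have "\<dots> = 0" by (subst Bochner_Integration.integral_diff[OF i2 i1]) (simp add: e)
    finally show "(\<integral>x. (u x - prim f x) * deriv \<phi> x \<partial>lebesgue_on {0<..<1}) = 0" .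
  qed
  then obtain c where "AE x in lebesgue_on {0<..<1}. u x - prim f x = c" ..
  then have "AE x in lebesgue_on {0<..<1}. u x = c + prim f x" by eventually_elim simp
  then show ?thesis ..
qed

section \<open>The Bessel functions of orders 0 and 1 near the origin\<close>

text \<open>\<open>J\<^sub>0(z) = B(z\<^sup>2)\<close> with \<open>B(s) = \<Sum>\<^sub>n (- s / 4)\<^sup>n / (n!)\<^sup>2\<close>. The series \<open>B\<close> and its derivative are
  \<open>bessel_series\<close> and \<open>bessel_series'\<close>; the equation \<open>s B'' + B' + B / 4 = 0\<close> is
  \<open>bessel_series'_DERIV\<close>.\<close>

definition bessel_coeff :: "nat \<Rightarrow> real" where
  "bessel_coeff n = (- 1/4)^n / (fact n)^2"

definition bessel_series :: "real \<Rightarrow> real" where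
  "bessel_series s = (\<Sum>n. bessel_coeff n * s^n)"

definition bessel_series' :: "real \<Rightarrow> real" where
  "bessel_series' s = (\<Sum>n. diffs bessel_coeff n * s^n)"

lemma fact_square_ge: "(fact n :: real)^2 \<ge> fact n"
  by (simp add: power2_eq_square fact_ge_1)

lemma bessel_coeff_bound: "\<bar>bessel_coeff n\<bar> \<le> (1/4)^n"
proof -
  have "(1/4)^n / (fact n)^2 \<le> (1/4)^n / (1::real)"
    using fact_square_ge[of n] fact_ge_1[of n] by (intro divide_left_mono) (auto intro: order_trans)
  then show ?thesis by (simp add: bessel_coeff_def abs_divide power_abs)
qed

lemma diffs_bessel_coeff: "diffs bessel_coeff n = - bessel_coeff n / (4 * (1 + real n))"
proof -
  have n: "1 + real n \<noteq> 0" by linarith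
  have "bessel_coeff (Suc n) = - bessel_coeff n / (4 * (1 + real n)^2)"
    unfolding bessel_coeff_def fact_Suc power_Suc power_mult_distrib by (simp add: mult_ac)
  then have "diffs bessel_coeff n = (1 + real n) * (- bessel_coeff n / (4 * (1 + real n)^2))"
    by (simp add: diffs_def)
  also have "\<dots> = - bessel_coeff n / (4 * (1 + real n))"
    using n by (simp add: power2_eq_square)
  finally show ?thesis .
qed

lemma summable_bessel: "summable (\<lambda>n. bessel_coeff n * s^n)"
proof (rule summable_comparison_test')
  show "summable (\<lambda>n. inverse (fact n) * \<bar>s\<bar>^n)" by (rule summable_exp)
  show "norm (bessel_coeff n * s^n) \<le> inverse (fact n) * \<bar>s\<bar>^n" for n
  proof -
    have "\<bar>bessel_coeff n\<bar> \<le> inverse (fact n)"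
    proof -
      have "(1/4)^n / (fact n)^2 \<le> (1::real) / fact n"
        by (rule frac_le) (auto simp: fact_square_ge power_le_one)
      then show ?thesis by (simp add: bessel_coeff_def abs_divide power_abs inverse_eq_divide)
    qed
    then show ?thesis by (simp add: abs_mult power_abs mult_right_mono)
  qed
qed

lemma summable_diffs_bessel: "summable (\<lambda>n. diffs bessel_coeff n * s^n)"
  by (rule termdiff_converges_all[OF summable_bessel])

lemma bessel_series_DERIV: "(bessel_series has_real_derivative bessel_series' s) (at s)"
  unfolding bessel_series_def[abs_def] bessel_series'_def
  by (rule termdiffs_strong_converges_everywhere[OF summable_bessel])

lemma bessel_series'_DERIV:
  "\<exists>D. (bessel_series' has_real_derivative D) (at s) \<and> s * D = - bessel_series' s - bessel_series s / 4"
proof (intro exI conjI)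
  let ?d = "diffs bessel_coeff"
  show "(bessel_series' has_real_derivative (\<Sum>n. diffs ?d n * s^n)) (at s)"
    unfolding bessel_series'_def[abs_def]
    by (rule termdiffs_strong_converges_everywhere[OF summable_diffs_bessel])
  have sm: "summable (\<lambda>n. diffs ?d n * s^n)" by (rule termdiff_converges_all[OF summable_diffs_bessel])
  have sm2: "summable (\<lambda>n. of_nat n * ?d n * s^n)"
  proof -
    have "summable (\<lambda>n. s * (diffs ?d n * s^n))" by (rule summable_mult[OF sm])
    then have "summable (\<lambda>n. of_nat (Suc n) * ?d (Suc n) * s^(Suc n))"
      by (simp add: diffs_def mult_ac)
    then show ?thesis by (subst (asm) summable_Suc_iff[of "\<lambda>n. of_nat n * ?d n * s^n"])
  qed
  have "s * (\<Sum>n. diffs ?d n * s^n) = (\<Sum>n. of_nat (Suc n) * ?d (Suc n) * s^(Suc n))"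
    by (subst suminf_mult[OF sm, symmetric]) (simp add: diffs_def mult_ac)
  also have "\<dots> = (\<Sum>n. of_nat n * ?d n * s^n)"
    using suminf_split_head[OF sm2] by simp
  also have "\<dots> = (\<Sum>n. - (?d n * s^n) - bessel_coeff n * s^n / 4)"
  proof (rule suminf_cong)
    fix n
    have "1 + real n \<noteq> 0" by linarith
    then have "(1 + real n) * ?d n = - bessel_coeff n / 4" by (simp add: diffs_bessel_coeff field_simps)
    then have "real n * ?d n = - ?d n - bessel_coeff n / 4" by (simp add: algebra_simps)
    then have "real n * ?d n * s^n = (- ?d n - bessel_coeff n / 4) * s^n" by (simp only:)
    then show "of_nat n * ?d n * s^n = - (?d n * s^n) - bessel_coeff n * s^n / 4"
      by (simp only: left_diff_distrib mult_minus_left times_divide_eq_left)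
  qed
  also have "\<dots> = - bessel_series' s - bessel_series s / 4"
    unfolding bessel_series'_def bessel_series_def
    by (subst suminf_diff[symmetric])
       (simp_all add: suminf_minus[OF summable_diffs_bessel] suminf_divide[OF summable_bessel]
          summable_minus summable_diffs_bessel summable_divide summable_bessel)
  finally show "s * (\<Sum>n. diffs ?d n * s^n) = - bessel_series' s - bessel_series s / 4" .
qed

text \<open>For \<open>s \<le> 1/4\<close> the terms after the first are dominated by the geometric series with ratio \<open>1/16\<close>,
  whose tail is \<open>1/15\<close>.\<close>

lemma power_series_near_constant:
  fixes d :: "nat \<Rightarrow> real"
  assumes b: "\<And>n. \<bar>d n\<bar> \<le> K * (1/4)^n" and s: "0 \<le> s" "s \<le> 1/4"
    and sm: "summable (\<lambda>n. d n * s^n)"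
  shows "\<bar>(\<Sum>n. d n * s^n) - d 0\<bar> \<le> K / 15"
proof -
  have K: "K \<ge> 0" using b[of 0] by simp
  have g: "(\<lambda>n. (K/16) * (1/16)^n) sums ((K/16) * (1 / (1 - 1/16)))"
    by (intro sums_mult geometric_sums) simp
  have "(\<Sum>n. d n * s^n) - d 0 = (\<Sum>n. d (Suc n) * s^(Suc n))"
    using suminf_split_head[OF sm] by simp
  also have "\<bar>\<dots>\<bar> \<le> (\<Sum>n. (K/16) * (1/16)^n)"
  proof (rule norm_suminf_le[where 'a=real, unfolded real_norm_def])
    fix n
    have "s^(Suc n) \<le> (1/4)^(Suc n)" using s by (intro power_mono) auto
    then have "\<bar>d (Suc n)\<bar> * s^(Suc n) \<le> (K * (1/4)^(Suc n)) * (1/4)^(Suc n)"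
      using s K by (intro mult_mono b) auto
    also have "\<dots> = (K/16) * (1/16)^n" by (simp add: power_mult_distrib[symmetric])
    finally show "\<bar>d (Suc n) * s^(Suc n)\<bar> \<le> (K/16) * (1/16)^n"
      using s by (simp add: abs_mult)
  qed (use g sums_summable in blast)
  also have "\<dots> = K / 15" using sums_unique[OF g] by simp
  finally show ?thesis .
qed

lemma bessel_series_bounds:
  assumes "0 \<le> s" "s \<le> 1/4"
  shows "14/15 \<le> bessel_series s" and "bessel_series s \<le> 16/15"
    and "- 4/15 \<le> bessel_series' s" and "bessel_series' s \<le> - 7/30"
proof -
  have "\<bar>bessel_series s - 1\<bar> \<le> 1 / 15"
    using power_series_near_constant[of bessel_coeff 1 s] bessel_coeff_bound assms summable_bessel
    by (simp add: bessel_series_def bessel_coeff_def)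
  then show "14/15 \<le> bessel_series s" "bessel_series s \<le> 16/15" by (simp_all only: abs_le_iff) (linarith+)
  have b: "\<bar>diffs bessel_coeff n\<bar> \<le> 1/4 * (1/4)^n" for n
  proof -
    have "\<bar>diffs bessel_coeff n\<bar> = \<bar>bessel_coeff n\<bar> / (4 * (1 + real n))"
      by (simp add: diffs_bessel_coeff abs_divide)
    also have "\<dots> \<le> (1/4)^n / 4"
      by (rule frac_le) (use bessel_coeff_bound in auto)
    finally show ?thesis by simp
  qed
  have "\<bar>bessel_series' s - diffs bessel_coeff 0\<bar> \<le> (1/4) / 15"
    unfolding bessel_series'_def by (rule power_series_near_constant[OF b assms summable_diffs_bessel])
  moreover have "diffs bessel_coeff 0 = - 1/4" by (simp add: diffs_def bessel_coeff_def)
  ultimately show "- 4/15 \<le> bessel_series' s" "bessel_series' s \<le> - 7/30"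
    by (simp_all only: abs_le_iff) (linarith+)
qed

text \<open>The Bessel functions of the first kind of orders \<open>0\<close> and \<open>1\<close>, with \<open>J\<^sub>0' = - J\<^sub>1\<close> and
  \<open>(z J\<^sub>1)' = z J\<^sub>0\<close>.\<close>

definition J0 :: "real \<Rightarrow> real" where "J0 z = bessel_series (z^2)"
definition J1 :: "real \<Rightarrow> real" where "J1 z = - 2 * z * bessel_series' (z^2)"

lemma J0_0 [simp]: "J0 0 = 1"
proof -
  have "J0 0 = (\<Sum>n. bessel_coeff n * 0^n)"
    by (simp only: J0_def bessel_series_def zero_power2)
  also have "\<dots> = bessel_coeff 0" by (rule powser_zero)
  also have "\<dots> = 1" by (simp add: bessel_coeff_def)
  finally show ?thesis .
qed

lemma J1_0 [simp]: "J1 0 = 0"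
  by (simp add: J1_def)

lemma J0_DERIV: "(J0 has_real_derivative - J1 z) (at z)"
  unfolding J0_def[abs_def] J1_def
  by (rule DERIV_cong, rule DERIV_chain2[where f=bessel_series and g="\<lambda>z. z^2", OF bessel_series_DERIV]) (auto intro!: derivative_eq_intros)

lemma J1_DERIV: "(J1 has_real_derivative J0 z + 2 * bessel_series' (z^2)) (at z)"
proof -
  obtain D where D: "(bessel_series' has_real_derivative D) (at (z^2))"
    and e: "z^2 * D = - bessel_series' (z^2) - bessel_series (z^2) / 4"
    using bessel_series'_DERIV by blast
  have "((\<lambda>z. bessel_series' (z^2)) has_real_derivative D * (2 * z)) (at z)"
    by (rule DERIV_chain2[where f=bessel_series' and g="\<lambda>z. z^2", OF D]) (auto intro!: derivative_eq_intros)
  then have "((\<lambda>z. (- 2 * z) * bessel_series' (z^2)) has_real_derivative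
      (- 2) * bessel_series' (z^2) + (D * (2 * z)) * (- 2 * z)) (at z)"
    by (rule DERIV_mult[rotated]) (auto intro!: derivative_eq_intros)
  then have "(J1 has_real_derivative (- 2) * bessel_series' (z^2) + (D * (2 * z)) * (- 2 * z)) (at z)"
    unfolding J1_def[abs_def] .
  moreover have t: "(D * (2 * z)) * (- 2 * z) = - 4 * (z^2 * D)"
    by (simp add: power2_eq_square)
  have "(- 2) * bessel_series' (z^2) + (D * (2 * z)) * (- 2 * z) = J0 z + 2 * bessel_series' (z^2)"
    unfolding t e J0_def by simp
  ultimately show ?thesis by (simp only:)
qed

lemma zJ1_DERIV: "((\<lambda>z. z * J1 z) has_real_derivative z * J0 z) (at z)"
proof -
  have "((\<lambda>z. z * J1 z) has_real_derivative 1 * J1 z + (J0 z + 2 * bessel_series' (z^2)) * z) (at z)"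
    by (rule DERIV_mult[OF DERIV_ident J1_DERIV])
  then show ?thesis by (rule DERIV_cong) (simp add: J1_def algebra_simps)
qed

lemma J_bounds:
  assumes "0 \<le> z" "z \<le> 1/2"
  shows "14/15 \<le> J0 z" "J0 z \<le> 16/15" "0 \<le> J1 z" "J1 z \<le> 8/15 * z"
    and "J0 z + 2 * bessel_series' (z^2) > 0"
proof -
  have "z^2 \<le> (1/2)^2" using assms by (intro power_mono) auto
  then have s: "0 \<le> z^2" "z^2 \<le> 1/4" by (simp_all add: power2_eq_square)
  note b = bessel_series_bounds[OF s]
  show "14/15 \<le> J0 z" "J0 z \<le> 16/15" using b by (simp_all add: J0_def)
  have "J1 z = 2 * z * (- bessel_series' (z^2))" by (simp add: J1_def)
  moreover have "0 \<le> 2 * z * (- bessel_series' (z^2))" using assms b by (intro mult_nonneg_nonneg) auto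
  moreover have "2 * z * (- bessel_series' (z^2)) \<le> 2 * z * (4/15)"
    using assms b by (intro mult_left_mono) auto
  ultimately show "0 \<le> J1 z" "J1 z \<le> 8/15 * z" by simp_all
  show "J0 z + 2 * bessel_series' (z^2) > 0" using b by (simp add: J0_def)
qed

text \<open>The phase shift \<open>\<delta>\<close>: for \<open>0 \<le> z \<le> 1/2\<close> the vector \<open>(J\<^sub>0(z), J\<^sub>1(z))\<close> has the polar angle \<open>phase z\<close>.\<close>

definition phase :: "real \<Rightarrow> real" where "phase z = arctan (J1 z / J0 z)"

lemma phase_0 [simp]: "phase 0 = 0" by (simp add: phase_def)

text \<open>To leading order the phase is \<open>z / 2\<close>.\<close>

lemma phase_bounds:
  assumes "0 \<le> z" "z \<le> 1/2"
  shows "0 \<le> phase z" "phase z \<le> 4/7 * z"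
proof -
  note b = J_bounds[OF assms]
  show "0 \<le> phase z" unfolding phase_def using b by simp
  have "arctan (J1 z / J0 z) \<le> J1 z / J0 z"
    using b by (intro arctan_le_self) auto
  also have "\<dots> \<le> (8/15 * z) / (14/15)"
    using b assms by (intro frac_le) auto
  finally show "phase z \<le> 4/7 * z" by (simp add: phase_def)
qed

lemma phase_mono:
  assumes "0 \<le> z" "z \<le> z'" "z' \<le> 1/2"
  shows "phase z \<le> phase z'"
proof -
  have q: "J1 z \<le> J1 z'"
  proof (rule DERIV_nonneg_imp_nondecreasing[OF assms(2)])
    fix x assume "z \<le> x" "x \<le> z'"
    then show "\<exists>y. (J1 has_real_derivative y) (at x) \<and> 0 \<le> y"
      using J1_DERIV[of x] J_bounds(5)[of x] assms by (meson less_imp_le order_trans)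
  qed
  have j: "J0 z' \<le> J0 z"
  proof (rule DERIV_nonpos_imp_nonincreasing[OF assms(2)])
    fix x assume "z \<le> x" "x \<le> z'"
    then show "\<exists>y. (J0 has_real_derivative y) (at x) \<and> y \<le> 0"
      using J0_DERIV[of x] J_bounds(3)[of x] assms by (intro exI[of _ "- J1 x"]) auto
  qed
  have "J1 z / J0 z \<le> J1 z' / J0 z'"
    using q j J_bounds[of z] J_bounds[of z'] assms by (intro frac_le) auto
  then show ?thesis by (simp add: phase_def arctan_le_iff)
qed

lemma continuous_on_J: "continuous_on S J0" "continuous_on S J1"
  by (rule DERIV_continuous_on[OF has_field_derivative_at_within[OF J0_DERIV]],
      rule DERIV_continuous_on[OF has_field_derivative_at_within[OF J1_DERIV]])

lemma continuous_on_phase: "continuous_on {0..1/2} phase"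
  unfolding phase_def
proof (intro continuous_intros continuous_on_J ballI)
  fix z :: real assume "z \<in> {0..1/2}"
  then show "J0 z \<noteq> 0" using J_bounds(1)[of z] by auto
qed

lemma phase_polar:
  assumes "0 \<le> z" "z \<le> 1/2"
  obtains R where "R > 0" "J0 z = R * cos (phase z)" "J1 z = R * sin (phase z)"
proof -
  have J: "J0 z > 0" using J_bounds(1)[OF assms] by simp
  have "sqrt (1 + (J1 z / J0 z)^2) > 0" by (simp add: add_pos_nonneg)
  then show ?thesis using J
    by (intro that[of "J0 z * sqrt (1 + (J1 z / J0 z)^2)"])
       (auto simp: phase_def cos_arctan sin_arctan)
qed

section \<open>The Sturm-Liouville equation with a trapezoidal weight\<close>

lemma DERIV_glue:
  fixes f g :: "real \<Rightarrow> real"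
  assumes f: "(f has_real_derivative D) (at a)" and g: "(g has_real_derivative D) (at a)"
    and e: "f a = g a"
  shows "((\<lambda>x. if x \<le> a then f x else g x) has_real_derivative D) (at a)"
proof -
  let ?F = "\<lambda>x. if x \<le> a then f x else g x"
  have "((\<lambda>x. (f x - f a) / (x - a)) \<longlongrightarrow> D) (at_left a)"
    using f by (simp add: has_field_derivative_iff filterlim_at_split)
  then have l: "((\<lambda>x. (?F x - ?F a) / (x - a)) \<longlongrightarrow> D) (at_left a)"
    by (rule Lim_transform_eventually) (auto simp: eventually_at_left_field intro!: exI[of _ "a - 1"])
  have "((\<lambda>x. (g x - g a) / (x - a)) \<longlongrightarrow> D) (at_right a)"
    using g by (simp add: has_field_derivative_iff filterlim_at_split)
  then have r: "((\<lambda>x. (?F x - ?F a) / (x - a)) \<longlongrightarrow> D) (at_right a)"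
    by (rule Lim_transform_eventually) (auto simp: eventually_at_right_field e intro!: exI[of _ "a + 1"])
  show ?thesis using l r by (simp add: has_field_derivative_iff filterlim_at_split)
qed

lemma DERIV_piecewise:
  fixes f g :: "real \<Rightarrow> real"
  assumes f: "x \<le> a \<Longrightarrow> (f has_real_derivative D) (at x)"
    and g: "a \<le> x \<Longrightarrow> (g has_real_derivative E) (at x)"
    and e: "f a = g a" and DE: "x = a \<Longrightarrow> D = E"
  shows "((\<lambda>y. if y \<le> a then f y else g y) has_real_derivative (if x \<le> a then D else E)) (at x)"
proof (cases x a rule: linorder_cases)
  case less
  then have "((\<lambda>y. if y \<le> a then f y else g y) has_real_derivative D) (at x)"
    by (intro has_field_derivative_transform_within_open[OF f, of "{..<a}"]) auto
  then show ?thesis using less by simp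
next
  case equal
  then have "((\<lambda>y. if y \<le> a then f y else g y) has_real_derivative D) (at a)"
    using f g DE by (intro DERIV_glue e) auto
  then show ?thesis using equal by simp
next
  case greater
  then have "((\<lambda>y. if y \<le> a then f y else g y) has_real_derivative E) (at x)"
    by (intro has_field_derivative_transform_within_open[OF g, of "{a<..}"]) auto
  then show ?thesis using greater by simp
qed

lemma DERIV_reflect:
  fixes f :: "real \<Rightarrow> real"
  assumes "(f has_real_derivative D) (at (1 - x))"
  shows "((\<lambda>x. f (1 - x)) has_real_derivative - D) (at x)"
proof -
  have "((\<lambda>x. f (1 - x)) has_real_derivative D * (- 1)) (at x)"
    by (rule DERIV_chain2[where f=f and g="\<lambda>x. 1 - x", OF assms]) (auto intro!: derivative_eq_intros)
  then show ?thesis by simp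
qed

text \<open>The weight has height \<open>\<kappa> \<epsilon>\<close> in the middle and slope \<open>\<plusminus>\<kappa>\<close> on the two end pieces of length \<open>\<epsilon>\<close>.\<close>

locale trapezoid =
  fixes \<kappa> \<epsilon> :: real
  assumes \<kappa>: "\<kappa> > 0" and \<epsilon>: "0 < \<epsilon>" "\<epsilon> < 1/2"
begin

definition h :: "real \<Rightarrow> real" where "h x = \<kappa> * min x (min \<epsilon> (1 - x))"

lemma h_left: "x \<le> \<epsilon> \<Longrightarrow> h x = \<kappa> * x" 
  and h_mid: "\<epsilon> \<le> x \<Longrightarrow> x \<le> 1 - \<epsilon> \<Longrightarrow> h x = \<kappa> * \<epsilon>"
  and h_reflect: "h (1 - x) = h x"
  and h_pos: "x \<in> {0<..<1} \<Longrightarrow> h x > 0"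
  and h_le: "h x \<le> \<kappa> * x" "h x \<le> \<kappa> * (1 - x)" "h x \<le> \<kappa> * \<epsilon>"
  using \<kappa> \<epsilon> by (auto simp: h_def)

lemma h_cont: "continuous_on S h"
  unfolding h_def[abs_def] by (intro continuous_intros)

text \<open>\<open>sol \<mu> U P\<close>: on \<open>(0, 1)\<close>, \<open>U\<close> is a classical solution of \<open>(h U')' + \<mu> h U = 0\<close> and \<open>P = h U'\<close> is its
  flux.\<close>

definition sol :: "real \<Rightarrow> (real \<Rightarrow> real) \<Rightarrow> (real \<Rightarrow> real) \<Rightarrow> bool" where
  "sol \<mu> U P \<longleftrightarrow> (\<forall>x\<in>{0<..<1}. (U has_real_derivative P x / h x) (at x) \<and>
     (P has_real_derivative - \<mu> * h x * U x) (at x))"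

text \<open>The solution for \<open>\<mu> = m\<^sup>2\<close> that is regular at the left end, and its flux. The formulas describe a
  solution up to \<open>1 - \<epsilon>\<close>, where the right end piece begins.\<close>

definition lsol :: "real \<Rightarrow> real \<Rightarrow> real" where
  "lsol m x = (if x \<le> \<epsilon> then J0 (m * x)
     else J0 (m * \<epsilon>) * cos (m * (x - \<epsilon>)) - J1 (m * \<epsilon>) * sin (m * (x - \<epsilon>)))"

definition lflux :: "real \<Rightarrow> real \<Rightarrow> real" where
  "lflux m x = (if x \<le> \<epsilon> then - \<kappa> * x * m * J1 (m * x)
     else - \<kappa> * \<epsilon> * m * (J0 (m * \<epsilon>) * sin (m * (x - \<epsilon>)) + J1 (m * \<epsilon>) * cos (m * (x - \<epsilon>))))"

lemma lsol_left_DERIV: "((\<lambda>x. J0 (m * x)) has_real_derivative - m * J1 (m * x)) (at x)"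
proof -
  have "((\<lambda>x. J0 (m * x)) has_real_derivative - J1 (m * x) * m) (at x)"
    by (rule DERIV_chain2[where f=J0 and g="\<lambda>x. m * x", OF J0_DERIV]) (auto intro!: derivative_eq_intros)
  then show ?thesis by (simp add: mult.commute)
qed

lemma lflux_left_DERIV:
  "((\<lambda>x. - \<kappa> * x * m * J1 (m * x)) has_real_derivative - \<kappa> * x * m^2 * J0 (m * x)) (at x)"
proof -
  have "((\<lambda>x. (m * x) * J1 (m * x)) has_real_derivative (m * x * J0 (m * x)) * m) (at x)"
    by (rule DERIV_chain2[where f="\<lambda>z. z * J1 z" and g="\<lambda>x. m * x", OF zJ1_DERIV])
       (auto intro!: derivative_eq_intros)
  then have "((\<lambda>x. (- \<kappa>) * ((m * x) * J1 (m * x))) has_real_derivative (- \<kappa>) * ((m * x * J0 (m * x)) * m)) (at x)"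
    by (rule DERIV_cmult)
  then show ?thesis by (simp add: mult_ac power2_eq_square)
qed

lemma lsol_mid_DERIV:
  "((\<lambda>x. A * cos (m * (x - \<epsilon>)) - B * sin (m * (x - \<epsilon>))) has_real_derivative
    - m * (A * sin (m * (x - \<epsilon>)) + B * cos (m * (x - \<epsilon>)))) (at x)"
  by (auto intro!: derivative_eq_intros simp: algebra_simps)

lemma lflux_mid_DERIV:
  "((\<lambda>x. - k * m * (A * sin (m * (x - \<epsilon>)) + B * cos (m * (x - \<epsilon>)))) has_real_derivative
    - (m^2) * k * (A * cos (m * (x - \<epsilon>)) - B * sin (m * (x - \<epsilon>)))) (at x)"
  by (auto intro!: derivative_eq_intros simp: algebra_simps power2_eq_square)

lemma lsol_sol:
  assumes "0 < x" "x < 1 - \<epsilon>"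
  shows "(lsol m has_real_derivative lflux m x / h x) (at x)"
    and "(lflux m has_real_derivative - (m^2) * h x * lsol m x) (at x)"
proof -
  let ?A = "J0 (m * \<epsilon>)" and ?B = "J1 (m * \<epsilon>)"
  let ?k = "\<kappa> * \<epsilon>"
  note L1 = lsol_left_DERIV[of m x] and L2 = lflux_left_DERIV[of m x]
  note M1 = lsol_mid_DERIV[of ?A m ?B x] and M2 = lflux_mid_DERIV[of ?k m ?A ?B x]
  have "(lsol m has_real_derivative (if x \<le> \<epsilon> then - m * J1 (m * x)
      else - m * (?A * sin (m * (x - \<epsilon>)) + ?B * cos (m * (x - \<epsilon>))))) (at x)"
    unfolding lsol_def[abs_def] by (rule DERIV_piecewise[OF L1 M1]) auto
  moreover have "lflux m x / h x = (if x \<le> \<epsilon> then - m * J1 (m * x)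
      else - m * (?A * sin (m * (x - \<epsilon>)) + ?B * cos (m * (x - \<epsilon>))))"
    using assms \<kappa> \<epsilon> by (simp add: lflux_def h_left h_mid)
  ultimately show "(lsol m has_real_derivative lflux m x / h x) (at x)" by (simp only:)
  have neg: "- \<kappa> * \<epsilon> = - ?k" by simp
  have "(lflux m has_real_derivative (if x \<le> \<epsilon> then - \<kappa> * x * m^2 * J0 (m * x)
      else - (m^2) * ?k * (?A * cos (m * (x - \<epsilon>)) - ?B * sin (m * (x - \<epsilon>))))) (at x)"
    unfolding lflux_def[abs_def] neg by (rule DERIV_piecewise[OF L2 M2]) auto
  moreover have "- (m^2) * h x * lsol m x = (if x \<le> \<epsilon> then - \<kappa> * x * m^2 * J0 (m * x)
      else - (m^2) * ?k * (?A * cos (m * (x - \<epsilon>)) - ?B * sin (m * (x - \<epsilon>))))"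
    using assms by (simp add: lsol_def h_left h_mid)
  ultimately show "(lflux m has_real_derivative - (m^2) * h x * lsol m x) (at x)" by (simp only:)
qed

lemma sol_reflect:
  assumes "sol \<mu> U P"
  shows "sol \<mu> (\<lambda>x. U (1 - x)) (\<lambda>x. - P (1 - x))"
  unfolding sol_def
proof (intro ballI conjI)
  fix x :: real assume x: "x \<in> {0<..<1}"
  have U: "(U has_real_derivative P (1 - x) / h (1 - x)) (at (1 - x))"
    and P: "(P has_real_derivative - \<mu> * h (1 - x) * U (1 - x)) (at (1 - x))"
    using assms x unfolding sol_def by auto
  show "((\<lambda>x. U (1 - x)) has_real_derivative - P (1 - x) / h x) (at x)"
    using DERIV_reflect[OF U] by (simp add: h_reflect)
  show "((\<lambda>x. - P (1 - x)) has_real_derivative - \<mu> * h x * U (1 - x)) (at x)"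
    using DERIV_minus[OF DERIV_reflect[OF P]] by (simp add: h_reflect)
qed

lemma sol_lincomb:
  assumes "sol \<mu> U P" "sol \<mu> V Q"
  shows "sol \<mu> (\<lambda>x. a * U x + b * V x) (\<lambda>x. a * P x + b * Q x)"
  unfolding sol_def
proof (intro ballI conjI)
  fix x :: real assume x: "x \<in> {0<..<1}"
  have d: "(U has_real_derivative P x / h x) (at x)" "(P has_real_derivative - \<mu> * h x * U x) (at x)"
    "(V has_real_derivative Q x / h x) (at x)" "(Q has_real_derivative - \<mu> * h x * V x) (at x)"
    using assms x unfolding sol_def by auto
  show "((\<lambda>x. a * U x + b * V x) has_real_derivative (a * P x + b * Q x) / h x) (at x)"
    using DERIV_add[OF DERIV_cmult[OF d(1), of a] DERIV_cmult[OF d(3), of b]]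
    by (simp add: add_divide_distrib)
  show "((\<lambda>x. a * P x + b * Q x) has_real_derivative - \<mu> * h x * (a * U x + b * V x)) (at x)"
    using DERIV_add[OF DERIV_cmult[OF d(2), of a] DERIV_cmult[OF d(4), of b]]
    by (simp add: algebra_simps)
qed

text \<open>Bounded flux gives \<open>\<bar>U'\<bar> \<le> C / x\<close> near \<open>0\<close>. A crude bound on \<open>U\<close> suffices, because the flux of \<open>lsol\<close>
  is of order \<open>x\<^sup>2\<close> there.\<close>

lemma sol_bounded_growth:
  assumes s: "sol \<mu> U P" and P0: "(P \<longlongrightarrow> 0) (at_right 0)"
  shows "((\<lambda>x. U x * x^2) \<longlongrightarrow> 0) (at_right 0)"
proof -
  have "\<forall>\<^sub>F x in at_right 0. \<bar>P x\<bar> < 1"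
    using tendstoD[OF P0, of 1] by (simp add: dist_real_def)
  then obtain b where b: "b > 0" "\<And>x. 0 < x \<Longrightarrow> x < b \<Longrightarrow> \<bar>P x\<bar> < 1"
    unfolding eventually_at_right_field by auto
  define r where "r = min (b/2) \<epsilon>"
  have r: "0 < r" "r < b" "r \<le> \<epsilon>" using b \<epsilon> by (auto simp: r_def)
  have bd: "\<bar>U x * x^2\<bar> \<le> (\<bar>U r\<bar> + r / \<kappa>) * x" if x: "0 < x" "x \<le> r" for x
  proof -
    have "norm (U x - U r) \<le> (1 / (\<kappa> * x)) * norm (x - r)"
    proof (rule field_differentiable_bound[of "{x..r}" U "\<lambda>t. P t / h t"])
      fix t assume t: "t \<in> {x..r}"
      then have t1: "t \<in> {0<..<1}" using x r \<epsilon> by auto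
      show "(U has_field_derivative P t / h t) (at t within {x..r})"
        using s t1 unfolding sol_def by (blast intro: has_field_derivative_at_within)
      have ht: "h t = \<kappa> * t" using t r by (intro h_left) auto
      have "\<bar>P t\<bar> / (\<kappa> * t) \<le> 1 / (\<kappa> * x)"
      proof (rule frac_le)
        show "\<bar>P t\<bar> \<le> 1" using b(2)[of t] t x r by auto
      qed (use \<kappa> t x in auto)
      then show "norm (P t / h t) \<le> 1 / (\<kappa> * x)"
        using \<kappa> t x by (simp add: ht abs_divide)
    qed (use x in auto)
    also have "\<dots> \<le> (1 / (\<kappa> * x)) * r" using x \<kappa> by (intro mult_left_mono) auto
    finally have "\<bar>U x - U r\<bar> \<le> r / (\<kappa> * x)" by simp
    then have "\<bar>U x\<bar> \<le> \<bar>U r\<bar> + r / (\<kappa> * x)"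
      using abs_triangle_ineq2[of "U x" "U r"] by linarith
    then have "\<bar>U x\<bar> * x^2 \<le> (\<bar>U r\<bar> + r / (\<kappa> * x)) * x^2" by (rule mult_right_mono) simp
    also have "\<dots> = \<bar>U r\<bar> * x * x + r / \<kappa> * x" using x \<kappa> by (simp add: field_simps power2_eq_square)
    also have "\<dots> \<le> \<bar>U r\<bar> * x * 1 + r / \<kappa> * x"
      using x r \<epsilon> by (intro add_right_mono mult_left_mono) auto
    finally show ?thesis using x by (simp add: abs_mult algebra_simps)
  qed
  have "((\<lambda>x::real. (\<bar>U r\<bar> + r / \<kappa>) * x) \<longlongrightarrow> (\<bar>U r\<bar> + r / \<kappa>) * 0) (at_right 0)"
    by (intro tendsto_intros)
  then have l: "((\<lambda>x::real. (\<bar>U r\<bar> + r / \<kappa>) * x) \<longlongrightarrow> 0) (at_right 0)" by simp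
  show ?thesis
  proof (rule tendsto_0_le[OF l, of _ 1])
    show "\<forall>\<^sub>F x in at_right 0. norm (U x * x^2) \<le> norm ((\<bar>U r\<bar> + r / \<kappa>) * x) * 1"
      unfolding eventually_at_right_field
    proof (intro exI[of _ r] conjI allI impI)
      fix x assume x: "0 < x" "x < r"
      have "\<bar>U x * x^2\<bar> \<le> \<bar>(\<bar>U r\<bar> + r / \<kappa>) * x\<bar>" using bd[of x] x by (meson abs_ge_self less_imp_le order_trans)
      then show "norm (U x * x^2) \<le> norm ((\<bar>U r\<bar> + r / \<kappa>) * x) * 1" by simp
    qed (use r in auto)
  qed
qed

text \<open>Up to the factor, \<open>lsol\<close> is the only solution whose flux vanishes at \<open>0\<close>.\<close>

lemma sol_left_unique:
  assumes s: "sol (m^2) U P" and P0: "(P \<longlongrightarrow> 0) (at_right 0)" and m: "0 \<le> m" "m * \<epsilon> \<le> 1/2"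
  obtains c where "\<And>x. x \<in> {0<..1/2} \<Longrightarrow> U x = c * lsol m x \<and> P x = c * lflux m x"
proof -
  let ?I = "{0<..<1 - \<epsilon>}"
  have Ud: "(U has_real_derivative P x / h x) (at x)" and Pd: "(P has_real_derivative - (m^2) * h x * U x) (at x)"
    if "x \<in> ?I" for x using s that \<epsilon> unfolding sol_def by auto
  have yd: "(lsol m has_real_derivative lflux m x / h x) (at x)" and pd: "(lflux m has_real_derivative - (m^2) * h x * lsol m x) (at x)"
    if "x \<in> ?I" for x using lsol_sol that by auto
  \<comment> \<open>The Wronskian is constant and tends to \<open>0\<close> at the left end.\<close>
  define W where "W = (\<lambda>x. U x * lflux m x - P x * lsol m x)"
  have "\<exists>c. \<forall>x\<in>?I. W x = c"
  proof (rule has_field_derivative_zero_constant)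
    fix x assume x: "x \<in> ?I"
    have hx: "h x \<noteq> 0" using h_pos[of x] x \<epsilon> by auto
    have "(W has_real_derivative (P x / h x * lflux m x + (- (m^2) * h x * lsol m x) * U x)
        - ((- (m^2) * h x * U x) * lsol m x + lflux m x / h x * P x)) (at x)"
      unfolding W_def by (intro DERIV_diff DERIV_mult Ud Pd yd pd x)
    moreover have "(P x / h x * lflux m x + (- (m^2) * h x * lsol m x) * U x)
        - ((- (m^2) * h x * U x) * lsol m x + lflux m x / h x * P x) = 0" by simp
    ultimately have "(W has_real_derivative 0) (at x)" by (simp only:)
    then show "(W has_real_derivative 0) (at x within ?I)" by (rule has_field_derivative_at_within)
  qed simp
  then obtain w where w: "\<And>x. x \<in> ?I \<Longrightarrow> W x = w" by blast
  have "(W \<longlongrightarrow> 0) (at_right 0)"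
  proof -
    have ev: "\<forall>\<^sub>F x in at_right 0. - \<kappa> * m * (U x * x^2) * (J1 (m * x) / x) - P x * J0 (m * x) = W x"
      unfolding eventually_at_right_field
      by (intro exI[of _ \<epsilon>]) (auto simp: \<epsilon> W_def lsol_def lflux_def power2_eq_square)
    have j1: "((\<lambda>x. J1 (m * x) / x) \<longlongrightarrow> m * (J0 0 + 2 * bessel_series' 0)) (at_right 0)"
    proof -
      have "((\<lambda>x. J1 (m * x)) has_real_derivative (J0 (m * 0) + 2 * bessel_series' ((m * 0)^2)) * m) (at 0)"
        by (rule DERIV_chain2[where f=J1 and g="\<lambda>x. m * x", OF J1_DERIV]) (auto intro!: derivative_eq_intros)
      then have "((\<lambda>x. J1 (m * x)) has_real_derivative m * (J0 0 + 2 * bessel_series' 0)) (at 0)"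
        by (simp add: mult.commute)
      then have "((\<lambda>x. J1 (m * x)) has_real_derivative m * (J0 0 + 2 * bessel_series' 0)) (at 0 within {0<..})"
        by (rule has_field_derivative_at_within)
      then show ?thesis by (simp add: has_field_derivative_iff)
    qed
    have j0: "((\<lambda>x. J0 (m * x)) \<longlongrightarrow> J0 (m * 0)) (at_right 0)"
    proof -
      have "isCont (\<lambda>x. J0 (m * x)) 0" by (rule DERIV_isCont[OF lsol_left_DERIV])
      then show ?thesis by (simp add: isCont_def filterlim_at_split)
    qed
    have "((\<lambda>x. - \<kappa> * m * (U x * x^2) * (J1 (m * x) / x) - P x * J0 (m * x)) \<longlongrightarrow>
        - \<kappa> * m * 0 * (m * (J0 0 + 2 * bessel_series' 0)) - 0 * J0 (m * 0)) (at_right 0)"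
      by (intro tendsto_diff tendsto_mult tendsto_const sol_bounded_growth[OF s P0] j1 j0 P0)
    then show ?thesis using Lim_transform_eventually[OF _ ev] by simp
  qed
  moreover have "(W \<longlongrightarrow> w) (at_right 0)"
  proof (rule tendsto_eventually)
    show "\<forall>\<^sub>F x in at_right 0. W x = w"
      unfolding eventually_at_right_field using w \<epsilon> by (intro exI[of _ "1 - \<epsilon>"]) auto
  qed
  ultimately have "w = 0" using tendsto_unique trivial_limit_at_right_real by blast
  then have W0: "U x * lflux m x = P x * lsol m x" if "x \<in> ?I" for x
    using w[OF that] by (simp add: W_def)
  have ypos: "lsol m x > 0" if "0 < x" "x \<le> \<epsilon>" for x
  proof -
    have "m * x \<le> m * \<epsilon>" using that m by (intro mult_left_mono) auto
    then have "14/15 \<le> J0 (m * x)" using m that by (intro J_bounds) auto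
    then show ?thesis using that by (simp add: lsol_def)
  qed
  \<comment> \<open>\<open>lsol\<close> has no zero on the end piece, so the quotient may be differentiated there.\<close>
  have "\<exists>c. \<forall>x\<in>{0<..\<epsilon>}. U x / lsol m x = c"
  proof (rule has_field_derivative_zero_constant)
    fix x assume x: "x \<in> {0<..\<epsilon>}"
    then have xI: "x \<in> ?I" and y: "lsol m x \<noteq> 0" using \<epsilon> ypos[of x] by auto
    have "((\<lambda>x. U x / lsol m x) has_real_derivative
        (P x / h x * lsol m x - U x * (lflux m x / h x)) / (lsol m x * lsol m x)) (at x)"
      by (rule DERIV_divide[OF Ud[OF xI] yd[OF xI] y])
    moreover have "P x / h x * lsol m x - U x * (lflux m x / h x) = (P x * lsol m x - U x * lflux m x) / h x"
      by (simp add: diff_divide_distrib)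
    ultimately have "((\<lambda>x. U x / lsol m x) has_real_derivative 0) (at x)"
      using W0[OF xI] by simp
    then show "((\<lambda>x. U x / lsol m x) has_real_derivative 0) (at x within {0<..\<epsilon>})"
      by (rule has_field_derivative_at_within)
  qed simp
  then obtain c where "\<And>x. x \<in> {0<..\<epsilon>} \<Longrightarrow> U x / lsol m x = c" by blast
  then have cU: "U x = c * lsol m x" if "x \<in> {0<..\<epsilon>}" for x
    using ypos[of x] that by (metis greaterThanAtMost_iff less_irrefl nonzero_eq_divide_eq)
  have cP: "P x = c * lflux m x" if x: "x \<in> {0<..\<epsilon>}" for x
  proof -
    have "x \<in> ?I" using x \<epsilon> by auto
    from W0[OF this, symmetric, unfolded cU[OF x]]
    have "P x * lsol m x = (c * lflux m x) * lsol m x" by (simp only: mult_ac)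
    moreover have "lsol m x \<noteq> 0" using ypos[of x] x by auto
    ultimately show ?thesis using mult_right_cancel by blast
  qed
  define D where "D = (\<lambda>x. U x - c * lsol m x)"
  define E where "E = (\<lambda>x. P x - c * lflux m x)"
  have Dd: "(D has_real_derivative E x / h x) (at x)" and Ed: "(E has_real_derivative - (m^2) * h x * D x) (at x)"
    if x: "x \<in> ?I" for x
  proof -
    have "(D has_real_derivative P x / h x - c * (lflux m x / h x)) (at x)"
      unfolding D_def by (intro DERIV_diff DERIV_cmult Ud yd x)
    then show "(D has_real_derivative E x / h x) (at x)" by (simp add: E_def diff_divide_distrib)
    have "(E has_real_derivative - (m^2) * h x * U x - c * (- (m^2) * h x * lsol m x)) (at x)"
      unfolding E_def by (intro DERIV_diff DERIV_cmult Pd pd x)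
    then show "(E has_real_derivative - (m^2) * h x * D x) (at x)" by (simp add: D_def algebra_simps)
  qed
  have z: "D \<epsilon> = 0" "E \<epsilon> = 0" using cU[of \<epsilon>] cP[of \<epsilon>] \<epsilon> by (auto simp: D_def E_def)
  let ?k = "\<kappa> * \<epsilon>"
  have k: "?k > 0" using \<kappa> \<epsilon> by simp
  \<comment> \<open>In the middle, where \<open>lsol\<close> may vanish, the energy of the difference is conserved. It
  controls the flux even for \<open>m = 0\<close>.\<close>
  have "\<exists>g. \<forall>x\<in>{\<epsilon>..1/2}. (E x)^2 + (m * ?k)^2 * (D x)^2 = g"
  proof (rule has_field_derivative_zero_constant)
    fix x assume x: "x \<in> {\<epsilon>..1/2}"
    then have xI: "x \<in> ?I" and hx: "h x = ?k" using \<epsilon> by (auto intro: h_mid)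
    have "((\<lambda>x. (E x)^2 + (m * ?k)^2 * (D x)^2) has_real_derivative
        (of_nat 2 * (- (m^2) * h x * D x * E x ^ (2 - Suc 0))
         + (m * ?k)^2 * (of_nat 2 * (E x / h x * D x ^ (2 - Suc 0))))) (at x)"
      by (intro DERIV_add DERIV_cmult DERIV_power Ed Dd xI)
    moreover have "(of_nat 2 * (- (m^2) * h x * D x * E x ^ (2 - Suc 0))
         + (m * ?k)^2 * (of_nat 2 * (E x / h x * D x ^ (2 - Suc 0)))) = 0"
      unfolding hx using k by (simp add: power2_eq_square)
    ultimately have "((\<lambda>x. (E x)^2 + (m * ?k)^2 * (D x)^2) has_real_derivative 0) (at x)"
      by (simp only:)
    then show "((\<lambda>x. (E x)^2 + (m * ?k)^2 * (D x)^2) has_real_derivative 0) (at x within {\<epsilon>..1/2})"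
      by (rule has_field_derivative_at_within)
  qed simp
  then obtain g where g: "\<And>x. x \<in> {\<epsilon>..1/2} \<Longrightarrow> (E x)^2 + (m * ?k)^2 * (D x)^2 = g" by blast
  have "g = 0" using g[of \<epsilon>] z \<epsilon> by simp
  then have E0: "E x = 0" if "x \<in> {\<epsilon>..1/2}" for x
    using g[OF that] by (metis add_nonneg_eq_0_iff mult_nonneg_nonneg power2_eq_iff zero_le_power2 zero_eq_power2)
  have "\<exists>d. \<forall>x\<in>{\<epsilon>..1/2}. D x = d"
  proof (rule has_field_derivative_zero_constant)
    fix x assume x: "x \<in> {\<epsilon>..1/2}"
    then have xI: "x \<in> ?I" using \<epsilon> by auto
    have "(D has_real_derivative 0) (at x)" using Dd[OF xI] E0[OF x] by simp
    then show "(D has_real_derivative 0) (at x within {\<epsilon>..1/2})" by (rule has_field_derivative_at_within)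
  qed simp
  then have D0: "D x = 0" if "x \<in> {\<epsilon>..1/2}" for x using z that \<epsilon> by (metis atLeastAtMost_iff less_imp_le order_refl)
  show ?thesis
  proof (rule that[of c])
    fix x :: real assume x: "x \<in> {0<..1/2}"
    show "U x = c * lsol m x \<and> P x = c * lflux m x"
    proof (cases "x \<le> \<epsilon>")
      case True
      then show ?thesis using cU[of x] cP[of x] x by auto
    next
      case False
      then show ?thesis using D0[of x] E0[of x] x by (auto simp: D_def E_def)
    qed
  qed
qed

text \<open>Twice the phase that the solution has accumulated at the midpoint.\<close>

definition phase_total :: "real \<Rightarrow> real" where
  "phase_total m = m * (1 - 2 * \<epsilon>) + 2 * phase (m * \<epsilon>)"

lemma lsol_half:
  assumes m: "0 \<le> m" "m * \<epsilon> \<le> 1/2"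
  obtains R where "R > 0" "lsol m (1/2) = R * cos (phase_total m / 2)"
    "lflux m (1/2) = - \<kappa> * \<epsilon> * m * R * sin (phase_total m / 2)"
proof -
  have z: "0 \<le> m * \<epsilon>" using m \<epsilon> by simp
  obtain R where R: "R > 0" "J0 (m * \<epsilon>) = R * cos (phase (m * \<epsilon>))" "J1 (m * \<epsilon>) = R * sin (phase (m * \<epsilon>))"
    using phase_polar[OF z m(2)] by blast
  have e: "phase_total m / 2 = m * (1/2 - \<epsilon>) + phase (m * \<epsilon>)"
    by (simp add: phase_total_def field_simps)
  have "lsol m (1/2) = R * cos (phase_total m / 2)"
    unfolding e cos_add using \<epsilon> R by (simp add: lsol_def algebra_simps)
  moreover have "lflux m (1/2) = - \<kappa> * \<epsilon> * m * R * sin (phase_total m / 2)"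
    unfolding e sin_add using \<epsilon> R by (simp add: lflux_def algebra_simps)
  ultimately show ?thesis using that R(1) by blast
qed

lemma lsol_pl_half_nonzero:
  assumes m: "0 \<le> m" "m * \<epsilon> \<le> 1/2" and "c * lsol m (1/2) = 0" "c * lflux m (1/2) = 0"
  shows "c = 0"
proof (cases "m = 0")
  case True
  then have "lsol m (1/2) = 1" using \<epsilon> by (simp add: lsol_def)
  then show ?thesis using assms by simp
next
  case False
  obtain R where R: "R > 0" "lsol m (1/2) = R * cos (phase_total m / 2)"
    "lflux m (1/2) = - \<kappa> * \<epsilon> * m * R * sin (phase_total m / 2)" using lsol_half[OF m] .
  show ?thesis
  proof (rule ccontr)
    assume c: "c \<noteq> 0"
    then have "cos (phase_total m / 2) = 0" "sin (phase_total m / 2) = 0"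
      using assms(3,4) R False \<kappa> \<epsilon> by auto
    then show False using sin_cos_squared_add[of "phase_total m / 2"] by simp
  qed
qed

text \<open>A solution with vanishing flux at both ends is a multiple of \<open>lsol\<close> on the left half and a multiple
  of its mirror image on the right half; the last two equations match the two at \<open>1/2\<close>.\<close>

lemma sol_two_sided:
  assumes s: "sol (m^2) U P" and P0: "(P \<longlongrightarrow> 0) (at_right 0)" and P1: "(P \<longlongrightarrow> 0) (at_left 1)"
    and m: "0 \<le> m" "m * \<epsilon> \<le> 1/2"
  obtains c c' where "\<And>x. x \<in> {0<..1/2} \<Longrightarrow> U x = c * lsol m x"
    "\<And>x. x \<in> {0<..1/2} \<Longrightarrow> U (1 - x) = c' * lsol m x"
    "(c - c') * lsol m (1/2) = 0" "(c + c') * lflux m (1/2) = 0"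
proof -
  obtain c where c: "\<And>x. x \<in> {0<..1/2} \<Longrightarrow> U x = c * lsol m x \<and> P x = c * lflux m x"
    using sol_left_unique[OF s P0 m] by blast
  have "((\<lambda>x. P (1 - x)) \<longlongrightarrow> 0) (at_right 0)"
  proof -
    have "filterlim (\<lambda>x::real. 1 - x) (at_left 1) (at_right 0)"
      unfolding filterlim_at
      by (auto simp: eventually_at_right_field intro!: tendsto_eq_intros exI[of _ 1])
    then show ?thesis by (rule filterlim_compose[OF P1])
  qed
  then have "((\<lambda>x. - P (1 - x)) \<longlongrightarrow> 0) (at_right 0)" using tendsto_minus by fastforce
  then obtain c' where c': "\<And>x. x \<in> {0<..1/2} \<Longrightarrow> U (1 - x) = c' * lsol m x \<and> - P (1 - x) = c' * lflux m x"
    using sol_left_unique[OF sol_reflect[OF s] _ m] by blast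
  show ?thesis
    by (rule that[of c c']) (use c c' c[of "1/2"] c'[of "1/2"] in \<open>auto simp: algebra_simps\<close>)
qed

lemma sol_zero:
  assumes s: "sol (m^2) U P" and P0: "(P \<longlongrightarrow> 0) (at_right 0)" and P1: "(P \<longlongrightarrow> 0) (at_left 1)"
    and m: "0 \<le> m" "m * \<epsilon> \<le> 1/2" and z: "\<And>x. x \<in> {0<..\<epsilon>} \<Longrightarrow> U x = 0"
  shows "x \<in> {0<..<1} \<Longrightarrow> U x = 0"
proof -
  obtain c c' where c: "\<And>x. x \<in> {0<..1/2} \<Longrightarrow> U x = c * lsol m x"
    "\<And>x. x \<in> {0<..1/2} \<Longrightarrow> U (1 - x) = c' * lsol m x"
    "(c - c') * lsol m (1/2) = 0" "(c + c') * lflux m (1/2) = 0"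
    using sol_two_sided[OF s P0 P1 m] by blast
  have "J0 (m * \<epsilon>) > 0" using J_bounds(1)[of "m * \<epsilon>"] m \<epsilon> by simp
  then have "c = 0" using c(1)[of \<epsilon>] z[of \<epsilon>] \<epsilon> by (auto simp: lsol_def)
  then have "c' * lsol m (1/2) = 0" "c' * lflux m (1/2) = 0" using c(3,4) by simp_all
  then have "c' = 0" by (rule lsol_pl_half_nonzero[OF m])
  assume x: "x \<in> {0<..<1}"
  show "U x = 0"
  proof (cases "x \<le> 1/2")
    case True
    then show ?thesis using c(1)[of x] x \<open>c = 0\<close> by simp
  next
    case False
    then show ?thesis using c(2)[of "1 - x"] x \<open>c' = 0\<close> by simp
  qed
qed

lemma sol_eigencondition:
  assumes s: "sol (m^2) U P" and P0: "(P \<longlongrightarrow> 0) (at_right 0)" and P1: "(P \<longlongrightarrow> 0) (at_left 1)"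
    and m: "0 \<le> m" "m * \<epsilon> \<le> 1/2" and nz: "x \<in> {0<..<1}" "U x \<noteq> 0"
  shows "\<exists>j::int. phase_total m = j * pi"
proof -
  obtain c c' where c: "\<And>x. x \<in> {0<..1/2} \<Longrightarrow> U x = c * lsol m x"
    "\<And>x. x \<in> {0<..1/2} \<Longrightarrow> U (1 - x) = c' * lsol m x"
    "(c - c') * lsol m (1/2) = 0" "(c + c') * lflux m (1/2) = 0"
    using sol_two_sided[OF s P0 P1 m] by blast
  have "c \<noteq> 0"
  proof
    assume "c = 0"
    then have "U x = 0" using c(1) by (intro sol_zero[OF s P0 P1 m _ nz(1)]) (use \<epsilon> in auto)
    then show False using nz by simp
  qed
  then have yp: "lsol m (1/2) = 0 \<or> lflux m (1/2) = 0" using c(3,4) by auto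
  show ?thesis
  proof (cases "m = 0")
    case True
    then show ?thesis by (intro exI[of _ 0]) (simp add: phase_total_def)
  next
    case False
    obtain R where R: "R > 0" "lsol m (1/2) = R * cos (phase_total m / 2)"
      "lflux m (1/2) = - \<kappa> * \<epsilon> * m * R * sin (phase_total m / 2)" using lsol_half[OF m] .
    have "sin (phase_total m) = 2 * sin (phase_total m / 2) * cos (phase_total m / 2)"
      using sin_double[of "phase_total m / 2"] by simp
    also have "\<dots> = 0" using yp R False \<kappa> \<epsilon> by auto
    finally show ?thesis using sin_zero_iff_int2 by blast
  qed
qed

end

section \<open>From weak eigenfunctions to classical solutions\<close>

lemma multiplicity_leI:
  assumes "\<And>n u. (\<And>i. i < n \<Longrightarrow> u i \<in> eigenspace U w \<mu>) \<Longrightarrow> independent_AE (weighted U w) n u \<Longrightarrow> n \<le> N"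
  shows "multiplicity U w \<mu> \<le> enat N"
  unfolding multiplicity_def by (rule SUP_least) (use assms in auto)

lemma multiplicity_eq_0I:
  assumes z: "\<And>u. u \<in> eigenspace U w \<mu> \<Longrightarrow> AE x in weighted U w. u x = 0"
  shows "multiplicity U w \<mu> = 0"
proof -
  have "multiplicity U w \<mu> \<le> enat 0"
  proof (rule multiplicity_leI)
    fix n u assume u: "\<And>i. i < n \<Longrightarrow> u i \<in> eigenspace U w \<mu>" and ind: "independent_AE (weighted U w) n u"
    show "n \<le> 0"
    proof (rule ccontr)
      assume "\<not> n \<le> 0"
      then have n: "0 < n" by simp
      define c where "c = (\<lambda>i::nat. if i = 0 then 1 else (0::real))"
      have "(\<Sum>i<n. c i * u i x) = u 0 x" for x
      proof -
        have "(\<Sum>i<n. c i * u i x) = (\<Sum>i\<in>{0}. c i * u i x)"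
          by (rule sum.mono_neutral_right) (use n in \<open>auto simp: c_def\<close>)
        then show ?thesis by (simp add: c_def)
      qed
      then have "AE x in weighted U w. (\<Sum>i<n. c i * u i x) = 0" using z[OF u[OF n]] by simp
      then have "\<forall>i<n. c i = 0" using ind unfolding independent_AE_def by blast
      then have "c 0 = 0" using n by blast
      then show False by (simp add: c_def)
    qed
  qed
  then show ?thesis by (simp add: zero_enat_def[symmetric])
qed

lemma multiplicity_le_1I:
  assumes dep: "\<And>u v. u \<in> eigenspace U w \<mu> \<Longrightarrow> v \<in> eigenspace U w \<mu> \<Longrightarrow>
      \<exists>a b. (a \<noteq> 0 \<or> b \<noteq> 0) \<and> (AE x in weighted U w. a * u x + b * v x = 0)"
  shows "multiplicity U w \<mu> \<le> 1"
proof -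
  have "multiplicity U w \<mu> \<le> enat 1"
  proof (rule multiplicity_leI)
    fix n u assume u: "\<And>i. i < n \<Longrightarrow> u i \<in> eigenspace U w \<mu>" and ind: "independent_AE (weighted U w) n u"
    show "n \<le> 1"
    proof (rule ccontr)
      assume "\<not> n \<le> 1"
      then have n: "0 < n" "1 < n" by simp_all
      obtain a b where ab: "a \<noteq> 0 \<or> b \<noteq> 0" and ae: "AE x in weighted U w. a * u 0 x + b * u 1 x = 0"
        using dep[OF u[OF n(1)] u[OF n(2)]] by blast
      define c where "c = (\<lambda>i::nat. if i = 0 then a else if i = 1 then b else 0)"
      have "(\<Sum>i<n. c i * u i x) = a * u 0 x + b * u 1 x" for x
      proof -
        have "(\<Sum>i<n. c i * u i x) = (\<Sum>i\<in>{0,1}. c i * u i x)"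
          by (rule sum.mono_neutral_right) (use n in \<open>auto simp: c_def\<close>)
        then show ?thesis by (simp add: c_def)
      qed
      then have "AE x in weighted U w. (\<Sum>i<n. c i * u i x) = 0" using ae by simp
      then have "\<forall>i<n. c i = 0" using ind unfolding independent_AE_def by blast
      then have "c 0 = 0" "c 1 = 0" using n by auto
      then show False using ab by (simp add: c_def)
    qed
  qed
  then show ?thesis by (simp add: one_enat_def)
qed

lemma multiplicity_ge_1I:
  assumes u: "u \<in> eigenspace U w \<mu>" and nz: "\<not> (AE x in weighted U w. u x = 0)"
  shows "1 \<le> multiplicity U w \<mu>"
proof -
  have "enat 1 \<le> multiplicity U w \<mu>"
    unfolding multiplicity_def
  proof (rule SUP_upper, rule CollectI, intro exI conjI)
    show "\<forall>i<1. (\<lambda>_::nat. u) i \<in> eigenspace U w \<mu>" using u by simp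
    show "independent_AE (weighted U w) 1 (\<lambda>_. u)"
      unfolding independent_AE_def
    proof (intro allI impI)
      fix c :: "nat \<Rightarrow> real" and i :: nat
      assume ae: "AE x in weighted U w. (\<Sum>i<1. c i * u x) = 0" and i: "i < 1"
      have "c 0 = 0"
      proof (rule ccontr)
        assume "c 0 \<noteq> 0"
        then have "AE x in weighted U w. u x = 0" using ae by simp
        then show False using nz by blast
      qed
      then show "c i = 0" using i by simp
    qed
  qed
  then show ?thesis by (simp add: one_enat_def)
qed

lemma eigenfunction_negative_AE_zero:
  assumes u: "u \<in> eigenspace U w \<mu>" and "\<mu> < 0"
  shows "AE x in weighted U w. u x = 0"
proof -
  let ?W = "weighted U w"
  obtain g where ug: "(u, g) \<in> form_domain U w"
    and e: "\<forall>(v, q)\<in>form_domain U w. (\<integral>x. g x \<bullet> q x \<partial>?W) = (\<integral>x. (\<mu> * u x) * v x \<partial>?W)"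
    using u unfolding eigenspace_def form_operator_def by auto
  have L: "integrable ?W (\<lambda>x. (u x)^2)" using ug unfolding form_domain_def L2_def by auto
  have "0 \<le> (\<integral>x. g x \<bullet> g x \<partial>?W)" by (rule Bochner_Integration.integral_nonneg) simp
  also have "\<dots> = (\<integral>x. \<mu> * (u x)^2 \<partial>?W)"
    using e ug by (auto simp: power2_eq_square mult.assoc)
  also have "\<dots> = \<mu> * (\<integral>x. (u x)^2 \<partial>?W)" by simp
  finally have "(\<integral>x. (u x)^2 \<partial>?W) \<le> 0" using assms(2) by (simp add: zero_le_mult_iff)
  moreover have "0 \<le> (\<integral>x. (u x)^2 \<partial>?W)" by (rule Bochner_Integration.integral_nonneg) simp
  ultimately have "(\<integral>x. (u x)^2 \<partial>?W) = 0" by simp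
  then have "AE x in ?W. (u x)^2 = 0"
    using integral_nonneg_eq_0_iff_AE[OF L] by simp
  then show ?thesis by eventually_elim simp
qed

lemma L2_integrable:
  fixes f :: "'a \<Rightarrow> 'b::euclidean_space"
  assumes "f \<in> L2 M" "finite_measure M"
  shows "integrable M f"
proof (rule Bochner_Integration.integrable_bound)
  have "integrable M (\<lambda>x. 1::real)" by (rule finite_measure.integrable_const[OF assms(2)])
  then show "integrable M (\<lambda>x. 1 + (norm (f x))^2)" using assms(1) unfolding L2_def by simp
  show "f \<in> borel_measurable M" using assms(1) unfolding L2_def by simp
  show "AE x in M. norm (f x) \<le> norm (1 + (norm (f x))^2)"
  proof (rule AE_I2)
    fix x
    show "norm (f x) \<le> norm (1 + (norm (f x))^2)"
      using sum_squares_bound[of 1 "norm (f x)"] norm_ge_zero[of "f x"]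
      unfolding power_one mult_1_right real_norm_def by linarith
  qed
qed

lemma L2_loc_integrable:
  fixes f :: "real \<Rightarrow> real"
  assumes "f \<in> L2_loc {0<..<1}" "0 < a" "b < 1"
  shows "integrable (lebesgue_on {a..b}) f"
proof (rule L2_integrable)
  have "compact {a..b} \<and> {a..b} \<subseteq> {0<..<1}" using assms(2,3) by auto
  then show "f \<in> L2 (lebesgue_on {a..b})" using assms(1) unfolding L2_loc_def by blast
  show "finite_measure (lebesgue_on {a..b})" by (rule finite_measure_lebesgue_on) simp
qed

lemma prim_DERIV:
  assumes c: "continuous_on {0<..<1} f" and x: "x \<in> {0<..<1}"
  shows "(prim f has_real_derivative f x) (at x)"
proof -
  define a b where "a = min x (1/2) / 2" and "b = (max x (1/2) + 1) / 2"
  have ab: "0 < a" "a < x" "a \<le> 1/2" "x < b" "1/2 \<le> b" "b < 1"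
    using x by (auto simp: a_def b_def)
  have cab: "continuous_on {a..b} f" by (rule continuous_on_subset[OF c]) (use ab in auto)
  have fi: "f integrable_on {a..b}" by (rule integrable_continuous_interval[OF cab])
  have "((\<lambda>x. integral {a..x} f) has_real_derivative f x) (at x within {a..b})"
    by (rule integral_has_real_derivative[OF cab]) (use ab in auto)
  moreover have "at x within {a..b} = at x"
    using ab by (intro at_within_interior) (simp add: interior_atLeastAtMost_real)
  ultimately have "((\<lambda>x. integral {a..x} f) has_real_derivative f x) (at x)" by (simp only:)
  from DERIV_diff[OF this DERIV_const[of "integral {a..1/2} f"]] have "((\<lambda>x. integral {a..x} f - integral {a..1/2} f) has_real_derivative f x) (at x)"
    by (simp only: diff_0_right)
  then show ?thesis
    by (rule has_field_derivative_transform_within_open[of _ _ _ "{a<..<b}"])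
       (use ab prim_eq[OF fi ab(3,5)] in auto)
qed

text \<open>The endpoints \<open>0\<close> and \<open>1\<close> are included.\<close>

lemma prim_cong_AE:
  assumes ae: "AE x in lebesgue_on {0<..<1}. f x = g x" and x: "x \<in> {0..1}"
  shows "prim f x = prim g x"
proof -
  have "AE x in lebesgue. x \<in> {0<..<1} \<longrightarrow> f x = g x"
    using ae by (subst (asm) AE_restrict_space_iff) auto
  from AE_E3[OF this] obtain N where
    N: "\<And>x. x \<in> space lebesgue - N \<Longrightarrow> x \<in> {0<..<1} \<longrightarrow> f x = g x" and N0: "N \<in> null_sets lebesgue"
    by blast
  have n: "negligible (N \<union> {0, 1})"
    using N0 by (simp add: negligible_iff_null_sets)
  have 1: "integral {1/2..x} f = integral {1/2..x} g"
    by (rule integral_spike[OF n]) (use N x in auto)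
  have 2: "integral {x..1/2} f = integral {x..1/2} g"
    by (rule integral_spike[OF n]) (use N x in auto)
  from 1 2 show ?thesis by (simp add: prim_def)
qed

context trapezoid
begin

text \<open>Lebesgue measure on \<open>(0, 1)\<close>, and the measure \<open>h dx\<close>.\<close>

abbreviation M :: "real measure" where "M \<equiv> lebesgue_on {0<..<1}"
abbreviation W :: "real measure" where "W \<equiv> weighted {0<..<1} h"

lemma finite_M: "finite_measure M"
  by (rule finite_measure_lebesgue_on) simp

lemma const_integrable: "integrable M (\<lambda>x. c :: real)"
  by (rule finite_measure.integrable_const[OF finite_M])

lemma h_measurable: "h \<in> borel_measurable M"
  by (rule continuous_imp_measurable_on_sets_lebesgue[OF h_cont]) simp

lemma h_nonneg_AE: "AE x in M. 0 \<le> h x"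
proof (rule AE_I2)
  fix x assume "x \<in> space M"
  then show "0 \<le> h x" using h_pos[of x] by simp
qed

lemma measurable_W: "borel_measurable W = borel_measurable M"
  unfolding weighted_def by (rule measurable_cong_sets) simp_all

lemma integral_W:
  fixes f :: "real \<Rightarrow> real"
  assumes "f \<in> borel_measurable M"
  shows "(\<integral>x. f x \<partial>W) = (\<integral>x. h x * f x \<partial>M)"
  unfolding weighted_def using integral_density[OF assms h_measurable h_nonneg_AE] by simp

lemma integrable_W:
  fixes f :: "real \<Rightarrow> real"
  assumes "f \<in> borel_measurable M"
  shows "integrable W f \<longleftrightarrow> integrable M (\<lambda>x. h x * f x)"
  unfolding weighted_def using integrable_density[OF assms h_measurable h_nonneg_AE] by simp

lemma AE_W: "(AE x in W. Q x) \<longleftrightarrow> (AE x in M. Q x)"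
proof -
  have "(AE x in W. Q x) \<longleftrightarrow> (AE x in M. 0 < ennreal (h x) \<longrightarrow> Q x)"
    unfolding weighted_def using h_measurable by (intro AE_density) simp
  also have "\<dots> \<longleftrightarrow> (AE x in M. Q x)"
    using h_pos by (intro AE_cong) auto
  finally show ?thesis .
qed

lemma L2_W: 
  fixes v :: "real \<Rightarrow> real"
  shows "v \<in> L2 W \<longleftrightarrow> v \<in> borel_measurable M \<and> integrable M (\<lambda>x. h x * (v x)^2)"
proof -
  have "v \<in> L2 W \<longleftrightarrow> v \<in> borel_measurable M \<and> integrable W (\<lambda>x. (v x)^2)"
    by (simp only: L2_def mem_Collect_eq real_norm_def power2_abs measurable_W)
  also have "\<dots> \<longleftrightarrow> v \<in> borel_measurable M \<and> integrable M (\<lambda>x. h x * (v x)^2)"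
    by (rule conj_cong[OF refl integrable_W]) simp
  finally show ?thesis .
qed

lemma h_bound: "x \<in> {0<..<1} \<Longrightarrow> \<bar>h x\<bar> \<le> \<kappa>"
proof -
  assume x: "x \<in> {0<..<1}"
  have "h x \<le> \<kappa> * \<epsilon>" by (rule h_le)
  also have "\<dots> \<le> \<kappa> * 1" using \<kappa> \<epsilon> by (intro mult_left_mono) auto
  finally show ?thesis using h_pos[OF x] by simp
qed

lemma L2_W_hv_integrable:
  fixes v :: "real \<Rightarrow> real"
  assumes "v \<in> L2 W"
  shows "integrable M (\<lambda>x. h x * v x)"
proof -
  have m: "v \<in> borel_measurable M" and i: "integrable M (\<lambda>x. h x * (v x)^2)" using assms L2_W by auto
  have hi: "integrable M h"
    using integrable_times_bounded[OF const_integrable[of 1] h_measurable, of \<kappa>] h_bound by simp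
  have "integrable M (\<lambda>x. h x + h x * (v x)^2)" using hi i by simp
  then show ?thesis
  proof (rule Bochner_Integration.integrable_bound)
    show "(\<lambda>x. h x * v x) \<in> borel_measurable M" using m h_measurable by simp
    show "AE x in M. norm (h x * v x) \<le> norm (h x + h x * (v x)^2)"
    proof (rule AE_I2)
      fix x assume "x \<in> space M"
      then have h0: "0 \<le> h x" using h_pos[of x] by simp
      have "\<bar>v x\<bar> \<le> 1 + (v x)^2" using sum_squares_bound[of 1 "\<bar>v x\<bar>"] by simp
      then have "h x * \<bar>v x\<bar> \<le> h x * (1 + (v x)^2)" using h0 by (rule mult_left_mono)
      then show "norm (h x * v x) \<le> norm (h x + h x * (v x)^2)"
        using h0 by (simp add: abs_mult distrib_left add_nonneg_nonneg)
    qed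
  qed
qed

text \<open>Since \<open>h\<close> is bounded, the form domain contains all bounded \<open>C\<^sup>1\<close> functions with bounded derivative.\<close>

lemma C1_form_domain:
  assumes d: "\<And>x. x \<in> {0<..<1} \<Longrightarrow> (v has_real_derivative v' x) (at x)"
    and c: "continuous_on {0<..<1} v'"
    and b: "\<And>x. x \<in> {0<..<1} \<Longrightarrow> \<bar>v x\<bar> \<le> B" "\<And>x. x \<in> {0<..<1} \<Longrightarrow> \<bar>v' x\<bar> \<le> B"
  shows "(v, v') \<in> form_domain {0<..<1} h"
proof -
  have vc: "continuous_on {0<..<1} v"
    by (rule DERIV_continuous_on[OF has_field_derivative_at_within[OF d]])
  have L2l: "f \<in> L2_loc {0<..<1}" if f: "continuous_on {0<..<1} f" and bf: "\<And>x. x \<in> {0<..<1} \<Longrightarrow> \<bar>f x\<bar> \<le> B" for f :: "real \<Rightarrow> real"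
    unfolding L2_loc_def L2_def
  proof (intro CollectI allI impI conjI)
    fix K :: "real set" assume K: "compact K \<and> K \<subseteq> {0<..<1}"
    have fK: "continuous_on K f" using f K continuous_on_subset by blast
    have Ks: "K \<in> sets lebesgue" using K by (simp add: compact_imp_closed borel_closed)
    show "f \<in> borel_measurable (lebesgue_on K)" by (rule continuous_imp_measurable_on_sets_lebesgue[OF fK Ks])
    have "finite_measure (lebesgue_on K)" using K by (intro finite_measure_lebesgue_on lmeasurable_compact) auto
    then have "integrable (lebesgue_on K) (\<lambda>x. 1::real)" by (rule finite_measure.integrable_const)
    then have "integrable (lebesgue_on K) (\<lambda>x. 1 * (f x)^2)"
      using K by (intro integrable_times_continuous continuous_intros fK) auto
    then show "integrable (lebesgue_on K) (\<lambda>x. (norm (f x))^2)" by simp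
  qed
  have L2w: "f \<in> L2 W" if f: "continuous_on {0<..<1} f" and bf: "\<And>x. x \<in> {0<..<1} \<Longrightarrow> \<bar>f x\<bar> \<le> B" for f :: "real \<Rightarrow> real"
    unfolding L2_W
  proof
    show fm: "f \<in> borel_measurable M" by (rule continuous_imp_measurable_on_sets_lebesgue[OF f]) simp
    have "integrable M (\<lambda>x. 1 * (h x * (f x)^2))"
    proof (rule integrable_times_bounded[OF const_integrable, of _ "\<kappa> * B^2"])
      show "(\<lambda>x. h x * (f x)^2) \<in> borel_measurable M" using fm h_measurable by simp
      fix x assume "x \<in> space M"
      then have x: "x \<in> {0<..<1}" by simp
      have "\<bar>f x\<bar>^2 \<le> B^2" using bf[OF x] by (intro power_mono) auto
      then have "\<bar>h x\<bar> * (f x)^2 \<le> \<kappa> * B^2"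
        using h_bound[OF x] \<kappa> by (intro mult_mono) auto
      then show "\<bar>h x * (f x)^2\<bar> \<le> \<kappa> * B^2" by (simp add: abs_mult)
    qed
    then show "integrable M (\<lambda>x. h x * (f x)^2)" by simp
  qed
  have "weak_gradient {0<..<1} v v'"
    unfolding weak_gradient_def
  proof (intro ballI)
    fix \<phi> :: "real \<Rightarrow> real" and i :: real
    assume \<phi>: "\<phi> \<in> test_functions {0<..<1}" and i: "i \<in> Basis"
    obtain a b where ab: "0 < a" "a \<le> 1/4" "3/4 \<le> b" "b < 1" and \<phi>0: "\<And>x. x \<notin> {a<..<b} \<Longrightarrow> \<phi> x = 0"
      using test_function_support_interval[OF \<phi>] by blast
    note \<phi>d = test_function_realD[OF \<phi>]
    have d0: "deriv \<phi> x = 0" if "x \<notin> {a..b}" for x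
      by (rule deriv_eq_0_outside[OF _ that]) (use \<phi>0 in auto)
    have sub: "{a..b} \<subseteq> {0<..<1}" using ab by auto
    have vab: "continuous_on {a..b} v" "continuous_on {a..b} v'" "continuous_on {a..b} (deriv \<phi>)"
      by (rule continuous_on_subset[OF vc sub], rule continuous_on_subset[OF c sub],
          rule continuous_on_subset[OF \<phi>d(2) subset_UNIV])
    have \<phi>c: "continuous_on {a..b} \<phi>"
      by (rule DERIV_continuous_on[OF has_field_derivative_at_within[OF \<phi>d(1)]])
    have i1: "integrable (lebesgue_on {a..b}) (\<lambda>x. v x * deriv \<phi> x)"
      by (intro continuous_imp_integrable_real continuous_on_mult vab)
    have i2: "integrable (lebesgue_on {a..b}) (\<lambda>x. v' x * \<phi> x)"
      by (intro continuous_imp_integrable_real continuous_on_mult vab \<phi>c)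
    have "((\<lambda>x. v' x * \<phi> x + deriv \<phi> x * v x) has_integral (v b * \<phi> b - v a * \<phi> a)) {a..b}"
      by (rule has_integral_real_derivative) (use ab sub in \<open>auto intro!: DERIV_mult d \<phi>d(1)\<close>)
    then have "integral {a..b} (\<lambda>x. v' x * \<phi> x + deriv \<phi> x * v x) = 0"
      using \<phi>0[of a] \<phi>0[of b] by (simp add: integral_unique)
    moreover have "integral {a..b} (\<lambda>x. v' x * \<phi> x + deriv \<phi> x * v x)
       = (\<integral>x. v' x * \<phi> x + deriv \<phi> x * v x \<partial>lebesgue_on {a..b})"
      using i1 i2 by (intro lebesgue_integral_eq_integral[symmetric]) (simp_all add: mult.commute)
    moreover have "\<dots> = (\<integral>x. v' x * \<phi> x \<partial>lebesgue_on {a..b}) + (\<integral>x. v x * deriv \<phi> x \<partial>lebesgue_on {a..b})"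
      using Bochner_Integration.integral_add[OF i2 i1] by (simp add: mult.commute)
    ultimately have "(\<integral>x. v x * deriv \<phi> x \<partial>lebesgue_on {a..b}) = - (\<integral>x. v' x * \<phi> x \<partial>lebesgue_on {a..b})"
      by linarith
    moreover have "(\<integral>x. v x * deriv \<phi> x \<partial>M) = (\<integral>x. v x * deriv \<phi> x \<partial>lebesgue_on {a..b})"
      by (rule integral_lebesgue_on_support) (use sub d0 in auto)
    moreover have "(\<integral>x. v' x * \<phi> x \<partial>M) = (\<integral>x. v' x * \<phi> x \<partial>lebesgue_on {a..b})"
      by (rule integral_lebesgue_on_support) (use sub \<phi>0 in auto)
    ultimately show "(\<integral>x. v x * frechet_derivative \<phi> (at x) i \<partial>M) = - (\<integral>x. v' x \<bullet> i * \<phi> x \<partial>M)"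
      using i by (simp add: \<phi>d(3))
  qed
  then show ?thesis
    unfolding form_domain_def using L2l L2w vc c b by auto
qed

lemma test_function_form_domain:
  assumes \<phi>: "\<phi> \<in> test_functions {0<..<1}"
  shows "(\<phi>, deriv \<phi>) \<in> form_domain {0<..<1} h"
proof -
  note \<phi>d = test_function_realD[OF \<phi>]
  have c: "continuous_on S (deriv \<phi>)" "continuous_on S \<phi>" for S
    by (rule continuous_on_subset[OF \<phi>d(2) subset_UNIV],
        rule DERIV_continuous_on[OF has_field_derivative_at_within[OF \<phi>d(1)]])
  have "bounded (\<phi> ` {0..1})" "bounded (deriv \<phi> ` {0..1})"
    by (rule compact_imp_bounded[OF compact_continuous_image[OF _ compact_Icc]], rule c)+
  then obtain B1 B2 where "\<And>x. x \<in> {0..1} \<Longrightarrow> \<bar>\<phi> x\<bar> \<le> B1" "\<And>x. x \<in> {0..1} \<Longrightarrow> \<bar>deriv \<phi> x\<bar> \<le> B2"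
    unfolding bounded_iff by fastforce
  then show ?thesis
    by (intro C1_form_domain[of _ _ "max B1 B2"] \<phi>d c) (auto simp: le_max_iff_disj)
qed

text \<open>Testing with test functions shows that \<open>h g\<close> is a primitive of \<open>- \<mu> h u\<close>; since \<open>h u\<close> is integrable up
  to the boundary, the flux extends continuously to \<open>[0, 1]\<close>. Testing with \<open>1\<close> and with \<open>x\<close> shows that
  it vanishes at both ends.\<close>

lemma eigenfunction_classical:
  assumes u: "u \<in> eigenspace {0<..<1} h \<mu>"
  obtains U P where "sol \<mu> U P" "(P \<longlongrightarrow> 0) (at_right 0)" "(P \<longlongrightarrow> 0) (at_left 1)"
    "AE x in W. u x = U x"
proof -
  obtain g where ug: "(u, g) \<in> form_domain {0<..<1} h"
    and e: "\<And>v q. (v, q) \<in> form_domain {0<..<1} h \<Longrightarrow> (\<integral>x. g x \<bullet> q x \<partial>W) = (\<integral>x. (\<mu> * u x) * v x \<partial>W)"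
    using u unfolding eigenspace_def form_operator_def by auto
  have ul: "u \<in> L2_loc {0<..<1}" and gl: "g \<in> L2_loc {0<..<1}" and wg: "weak_gradient {0<..<1} u g"
    and uW: "u \<in> L2 W" and gW: "g \<in> L2 W" using ug unfolding form_domain_def by auto
  have um: "u \<in> borel_measurable M" and gm: "g \<in> borel_measurable M" using uW gW L2_W by auto
  define F where "F = (\<lambda>x. - \<mu> * h x * u x)"
  have FM: "integrable M F"
  proof -
    have "integrable M (\<lambda>x. (- \<mu>) * (h x * u x))"
      by (rule Bochner_Integration.integrable_mult_right[OF L2_W_hv_integrable[OF uW]])
    then show ?thesis by (simp add: F_def mult.assoc)
  qed
  have weak: "(\<integral>x. (h x * g x) * q x \<partial>M) = - (\<integral>x. F x * v x \<partial>M)"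
    if vq: "(v, q) \<in> form_domain {0<..<1} h" for v q
  proof -
    have "v \<in> L2 W" "q \<in> L2 W" using vq unfolding form_domain_def by auto
    then have m: "v \<in> borel_measurable M" "q \<in> borel_measurable M" using L2_W by auto
    have "(\<integral>x. g x \<bullet> q x \<partial>W) = (\<integral>x. h x * (g x * q x) \<partial>M)"
      using integral_W[of "\<lambda>x. g x * q x"] m gm by simp
    moreover have "(\<integral>x. (\<mu> * u x) * v x \<partial>W) = (\<integral>x. h x * ((\<mu> * u x) * v x) \<partial>M)"
      using m um by (intro integral_W) simp
    ultimately have "(\<integral>x. h x * (g x * q x) \<partial>M) = (\<integral>x. h x * ((\<mu> * u x) * v x) \<partial>M)"
      using e[OF vq] by simp
    moreover have "h x * ((\<mu> * u x) * v x) = - (F x * v x)" for x by (simp add: F_def)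
    ultimately show ?thesis by (simp add: mult.assoc)
  qed
  have F01: "integrable (lebesgue_on {0..1}) F"
  proof -
    have "integrable (lebesgue_on {0..1}) F = integrable M F"
      by (rule integrable_lebesgue_on_support) (auto simp: F_def h_def \<epsilon> less_imp_le)
    then show ?thesis using FM by simp
  qed
  have Fi: "F integrable_on {0..1}" by (rule integrable_on_lebesgue_on[OF F01]) simp
  have "\<exists>c. AE x in M. h x * g x = c + prim F x"
  proof (rule weak_primitive)
    fix a b :: real assume ab: "0 < a" "b < 1"
    have "integrable (lebesgue_on {a..b}) (\<lambda>x. g x * h x)"
      by (intro integrable_times_continuous L2_loc_integrable[OF gl ab] h_cont) simp
    then show "integrable (lebesgue_on {a..b}) (\<lambda>x. h x * g x)" by (simp add: mult.commute)
    show "integrable (lebesgue_on {a..b}) F"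
      by (rule integrable_subinterval[OF F01]) (use ab in auto)
  next
    fix \<phi> :: "real \<Rightarrow> real" assume "\<phi> \<in> test_functions {0<..<1}"
    then show "(\<integral>x. (h x * g x) * deriv \<phi> x \<partial>M) = - (\<integral>x. F x * \<phi> x \<partial>M)"
      by (intro weak test_function_form_domain)
  qed
  then obtain c where c: "AE x in M. h x * g x = c + prim F x" ..
  define P where "P = (\<lambda>x. c + prim F x)"
  have "\<exists>c. AE x in M. u x = c + prim g x"
  proof (rule weak_primitive)
    fix \<phi> :: "real \<Rightarrow> real" assume \<phi>: "\<phi> \<in> test_functions {0<..<1}"
    have "(\<integral>x. u x * frechet_derivative \<phi> (at x) 1 \<partial>M) = - (\<integral>x. (g x \<bullet> 1) * \<phi> x \<partial>M)"
      using wg \<phi> unfolding weak_gradient_def by simp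
    then show "(\<integral>x. u x * deriv \<phi> x \<partial>M) = - (\<integral>x. g x * \<phi> x \<partial>M)"
      by (simp add: test_function_realD(3)[OF \<phi>])
  qed (use L2_loc_integrable ul gl in auto)
  then obtain c2 where c2: "AE x in M. u x = c2 + prim g x" ..
  have gP: "AE x in M. g x = P x / h x"
  proof -
    have "AE x in M. x \<in> {0<..<1}" by (rule AE_I2) simp
    with c show ?thesis
    proof eventually_elim
      case (elim x)
      then have "h x \<noteq> 0" using h_pos[of x] by simp
      then show ?case using elim by (simp add: P_def eq_divide_eq mult.commute)
    qed
  qed
  define U where "U = (\<lambda>x. c2 + prim (\<lambda>x. P x / h x) x)"
  have uU: "AE x in M. u x = U x"
  proof -
    have "AE x in M. x \<in> {0<..<1}" by (rule AE_I2) simp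
    with c2 show ?thesis
    proof eventually_elim
      case (elim x)
      then show ?case using prim_cong_AE[OF gP, of x] by (simp add: U_def)
    qed
  qed
  \<comment> \<open>\<open>F\<close> is integrable on all of \<open>[0, 1]\<close>, so the representation holds up to the endpoints.\<close>
  have PF: "P x = c - integral {0..1/2} F + integral {0..x} F" if "x \<in> {0..1}" for x
    using prim_eq[OF Fi _ _ that] by (simp add: P_def)
  have Pc: "continuous_on {0..1} P"
  proof -
    have "continuous_on {0..1} (\<lambda>x. c - integral {0..1/2} F + integral {0..x} F)"
      by (intro continuous_intros indefinite_integral_continuous_1[OF Fi])
    then show ?thesis by (rule continuous_on_eq) (simp add: PF)
  qed
  have Pc': "continuous_on {0<..<1} P" by (rule continuous_on_subset[OF Pc]) auto
  have hn: "h x \<noteq> 0" if "x \<in> {0<..<1}" for x using h_pos[OF that] by simp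
  have Phc: "continuous_on {0<..<1} (\<lambda>x. P x / h x)"
    by (intro continuous_on_divide Pc' h_cont) (use hn in auto)
  have Ud: "(U has_real_derivative P x / h x) (at x)" if x: "x \<in> {0<..<1}" for x
    using DERIV_add[OF DERIV_const[of c2] prim_DERIV[OF Phc x]] by (simp add: U_def)
  have Uc: "continuous_on {0<..<1} U"
    by (rule DERIV_continuous_on[OF has_field_derivative_at_within[OF Ud]])
  have FU: "AE x in M. F x = - \<mu> * h x * U x" using uU by eventually_elim (simp add: F_def)
  have Pd: "(P has_real_derivative - \<mu> * h x * U x) (at x)" if x: "x \<in> {0<..<1}" for x
  proof -
    have cc: "continuous_on {0<..<1} (\<lambda>x. - \<mu> * h x * U x)"
      by (intro continuous_on_mult continuous_on_const h_cont Uc)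
    have "((\<lambda>x. c + prim (\<lambda>x. - \<mu> * h x * U x) x) has_real_derivative 0 + - \<mu> * h x * U x) (at x)"
      by (rule DERIV_add[OF DERIV_const prim_DERIV[OF cc x]])
    then have "((\<lambda>x. c + prim (\<lambda>x. - \<mu> * h x * U x) x) has_real_derivative - \<mu> * h x * U x) (at x)"
      by (simp only: add_0_left)
    then show ?thesis
      by (rule has_field_derivative_transform_within_open[of _ _ _ "{0<..<1}"]) (use x prim_cong_AE[OF FU] in \<open>auto simp: P_def\<close>)
  qed
  have s: "sol \<mu> U P" unfolding sol_def using Ud Pd by blast
  have const1: "((\<lambda>_. 1), (\<lambda>_. 0)) \<in> form_domain {0<..<1} h"
    by (rule C1_form_domain[of _ _ 1]) (auto intro!: continuous_intros)
  have ident1: "((\<lambda>x. x), (\<lambda>_. 1)) \<in> form_domain {0<..<1} h"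
    by (rule C1_form_domain[of _ _ 1]) (auto intro!: continuous_intros)
  have F0M: "(\<integral>x. F x * k x \<partial>M) = integral {0..1} (\<lambda>x. F x * k x)"
    if "integrable (lebesgue_on {0..1}) (\<lambda>x. F x * k x)" for k
  proof -
    have "(\<integral>x. F x * k x \<partial>lebesgue_on {0..1}) = (\<integral>x. F x * k x \<partial>M)"
      by (rule integral_lebesgue_on_support) (auto simp: F_def h_def \<epsilon> less_imp_le)
    then show ?thesis using lebesgue_integral_eq_integral[OF that] by simp
  qed
  \<comment> \<open>The test function \<open>1\<close> gives \<open>P 0 = P 1\<close>.\<close>
  have tot: "integral {0..1} F = 0"
    using weak[OF const1] F0M[of "\<lambda>_. 1"] F01 by simp
  have Fx: "integrable (lebesgue_on {0..1}) (\<lambda>x. F x * x)"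
    by (intro integrable_times_continuous F01 continuous_intros) simp
  \<comment> \<open>The test function \<open>x\<close> gives the value of \<open>\<integral> P\<close>, and integration by parts then yields \<open>P 0 = 0\<close>.\<close>
  have "(\<integral>x. P x \<partial>M) = (\<integral>x. h x * g x \<partial>M)"
  proof (rule integral_cong_AE)
    show "P \<in> borel_measurable M" by (rule continuous_imp_measurable_on_sets_lebesgue[OF Pc']) simp
    show "AE x in M. P x = h x * g x" using c by eventually_elim (simp add: P_def)
  qed (use h_measurable gm in simp)
  also have "\<dots> = - (\<integral>x. F x * x \<partial>M)" using weak[OF ident1] by simp
  also have "\<dots> = - integral {0..1} (\<lambda>x. F x * x)" using F0M[OF Fx] by simp
  finally have PM: "(\<integral>x. P x \<partial>M) = - integral {0..1} (\<lambda>x. F x * x)" .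
  have "(\<integral>x. P x \<partial>M) = integral {0..1} P"
  proof -
    have "bounded (P ` {0..1})" by (rule compact_imp_bounded[OF compact_continuous_image[OF Pc compact_Icc]])
    then obtain B where B: "\<forall>y\<in>P ` {0..1}. norm y \<le> B" unfolding bounded_iff by blast
    have "integrable M (\<lambda>x. 1 * P x)"
      by (rule integrable_times_bounded[OF const_integrable continuous_imp_measurable_on_sets_lebesgue[OF Pc'], of B])
         (use B in auto)
    then have "(\<integral>x. P x \<partial>M) = integral {0<..<1} P"
      by (intro lebesgue_integral_eq_integral) auto
    then show ?thesis by (simp add: integral_open_interval_real)
  qed
  also have "\<dots> = integral {0..1} (\<lambda>x. P 0 + integral {0..x} F)"
    by (rule integral_cong) (simp add: PF)
  also have "\<dots> = P 0 + integral {0..1} (\<lambda>x. integral {0..x} F * 1)"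
    by (subst integral_add)
       (auto intro!: integrable_continuous_interval continuous_intros indefinite_integral_continuous_1[OF Fi])
  also have "integral {0..1} (\<lambda>x. integral {0..x} F * 1) + integral {0..1} (\<lambda>x. F x * x) = integral {0..1} F * 1"
    by (rule integral_by_parts_primitive[OF _ F01, of "\<lambda>x. x" "\<lambda>x. 1"]) (auto intro!: continuous_intros)
  then have "P 0 + integral {0..1} (\<lambda>x. integral {0..x} F * 1) = P 0 - integral {0..1} (\<lambda>x. F x * x)"
    using tot by simp
  finally have P0: "P 0 = 0" using PM by simp
  have P1: "P 1 = 0" using PF[of 1] PF[of 0] P0 tot by simp
  have "(P \<longlongrightarrow> P 0) (at 0 within {0..1})" "(P \<longlongrightarrow> P 1) (at 1 within {0..1})"
    using Pc unfolding continuous_on_def by auto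
  then have "(P \<longlongrightarrow> 0) (at_right 0)" "(P \<longlongrightarrow> 0) (at_left 1)"
    by (simp_all add: P0 P1 at_within_Icc_at_right at_within_Icc_at_left)
  moreover have "AE x in W. u x = U x" using uU AE_W by simp
  ultimately show ?thesis using that s by blast
qed

end

section \<open>Cutoff functions and integration by parts in the form domain\<close>

text \<open>A smooth cutoff on \<open>(0, 1)\<close> that vanishes within distance \<open>1/n\<close> of the endpoints and equals \<open>1\<close> beyond
  distance \<open>2/n\<close>, and its derivative.\<close>

definition cutoff :: "nat \<Rightarrow> real \<Rightarrow> real" where
  "cutoff n x = smooth_step (n * x - 1) * smooth_step (n * (1 - x) - 1)"

definition cutoff' :: "nat \<Rightarrow> real \<Rightarrow> real" where
  "cutoff' n x = n * deriv smooth_step (n * x - 1) * smooth_step (n * (1 - x) - 1)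
     - n * smooth_step (n * x - 1) * deriv smooth_step (n * (1 - x) - 1)"

lemma cutoff_DERIV: "(cutoff n has_real_derivative cutoff' n x) (at x)"
proof -
  have 1: "((\<lambda>x. smooth_step (n * x - 1)) has_real_derivative deriv smooth_step (n * x - 1) * n) (at x)"
    by (rule DERIV_chain2[where f=smooth_step and g="\<lambda>x. n * x - 1", OF smooth_step_DERIV])
       (auto intro!: derivative_eq_intros)
  have 2: "((\<lambda>x. smooth_step (n * (1 - x) - 1)) has_real_derivative deriv smooth_step (n * (1 - x) - 1) * (- n)) (at x)"
    by (rule DERIV_chain2[where f=smooth_step and g="\<lambda>x. n * (1 - x) - 1", OF smooth_step_DERIV])
       (auto intro!: derivative_eq_intros)
  show ?thesis
    unfolding cutoff_def[abs_def] cutoff'_def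
    by (rule DERIV_cong[OF DERIV_mult[OF 1 2]]) (simp add: mult_ac)
qed

lemma C_k_cutoff: "C_k m (cutoff n)"
proof -
  have "C_k m (\<lambda>x::real. smooth_step (n * x + (-1)) * smooth_step ((- real n) * x + (real n - 1)))"
    by (intro C_k_mult C_k_affine C_k_smooth_step)
  moreover have "(\<lambda>x::real. smooth_step (n * x + (-1)) * smooth_step ((- real n) * x + (real n - 1))) = cutoff n"
    unfolding cutoff_def by (intro ext arg_cong2[of _ _ _ _ "(*)"] arg_cong[of _ _ smooth_step])
      (simp_all add: algebra_simps)
  ultimately show ?thesis by simp
qed

lemma continuous_on_cutoff: "continuous_on S (cutoff n)" "continuous_on S (cutoff' n)"
proof -
  show "continuous_on S (cutoff n)"
    by (rule DERIV_continuous_on[OF has_field_derivative_at_within[OF cutoff_DERIV]])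
  have "cutoff' n = deriv (cutoff n)" using DERIV_imp_deriv[OF cutoff_DERIV] by auto
  then have "continuous_on UNIV (cutoff' n)"
    using C_k_imp_continuous[OF C_k_Suc_realD(2)[OF C_k_cutoff[of "Suc 0"]]] by simp
  then show "continuous_on S (cutoff' n)" using continuous_on_subset by blast
qed

lemma cutoff_bounds: "0 \<le> cutoff n x" "\<bar>cutoff n x\<bar> \<le> 1"
proof -
  show 1: "0 \<le> cutoff n x" by (simp add: cutoff_def smooth_step_nonneg)
  have "cutoff n x \<le> 1"
    unfolding cutoff_def by (rule mult_le_one) (auto simp: smooth_step_nonneg smooth_step_le_1)
  with 1 show "\<bar>cutoff n x\<bar> \<le> 1" by simp
qed

lemma cutoff_outside:
  assumes n: "n > 0" and x: "x \<notin> {1 / n<..<1 - 1 / n}"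
  shows "cutoff n x = 0"
proof -
  have "x \<le> 1 / n \<or> 1 - x \<le> 1 / n" using x by auto
  then have "n * x - 1 \<le> 0 \<or> n * (1 - x) - 1 \<le> 0" using n by (auto simp: field_simps)
  then show ?thesis by (auto simp: cutoff_def smooth_step_0)
qed

lemma cutoff'_outside:
  assumes n: "n > 0" and x: "x \<notin> {1 / n..1 - 1 / n}"
  shows "cutoff' n x = 0"
proof -
  have "x < 1 / n \<or> 1 - x < 1 / n" using x by auto
  then have "n * x - 1 < 0 \<or> n * (1 - x) - 1 < 0" using n by (auto simp: field_simps)
  then show ?thesis by (auto simp: cutoff'_def smooth_step_0 deriv_smooth_step_0)
qed

lemma eventually_real_mult_gt:
  fixes t c :: real
  assumes "t > 0"
  shows "\<forall>\<^sub>F n in sequentially. real n * t > c"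
proof -
  obtain N :: nat where N: "c / t < N" using reals_Archimedean2 by blast
  have "real n * t > c" if "n \<ge> N" for n
  proof -
    have "c / t < n" using that N by (meson less_le_trans of_nat_le_iff)
    then show ?thesis using assms by (simp add: pos_divide_less_eq)
  qed
  then show ?thesis by (rule eventually_sequentiallyI)
qed

lemma cutoff_eventually:
  assumes x: "x \<in> {0<..<1}"
  shows "\<forall>\<^sub>F n in sequentially. cutoff n x = 1 \<and> cutoff' n x = 0"
proof -
  have "\<forall>\<^sub>F n in sequentially. real n * x > 2 \<and> real n * (1 - x) > 2"
    using x by (intro eventually_conj eventually_real_mult_gt) auto
  then show ?thesis
    by (rule eventually_mono)
       (auto simp: cutoff_def cutoff'_def smooth_step_1 deriv_smooth_step_0)
qed

text \<open>The derivative of the cutoff is at most of the order of the inverse distance to the boundary.\<close>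

lemma cutoff'_bound: "\<exists>K>0. \<forall>n x. x \<in> {0<..<1} \<longrightarrow> \<bar>cutoff' n x\<bar> * min x (1 - x) \<le> K"
proof -
  obtain K where K: "K > 0" "\<And>x. \<bar>deriv smooth_step x\<bar> \<le> K" using deriv_smooth_step_bounded by blast
  have b: "real n * \<bar>deriv smooth_step (n * t - 1)\<bar> * t \<le> 2 * K" if "t > 0" for n :: nat and t :: real
  proof (cases "n * t \<le> 2")
    case True
    have "(real n * t) * \<bar>deriv smooth_step (n * t - 1)\<bar> \<le> 2 * K"
      using True K that by (intro mult_mono) auto
    then show ?thesis by (simp add: mult_ac)
  next
    case False
    then show ?thesis using K by (simp add: deriv_smooth_step_0)
  qed
  have "\<bar>cutoff' n x\<bar> * min x (1 - x) \<le> 4 * K" if x: "x \<in> {0<..<1}" for n x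
  proof -
    define A where "A = real n * \<bar>deriv smooth_step (n * x - 1)\<bar>"
    define B where "B = real n * \<bar>deriv smooth_step (n * (1 - x) - 1)\<bar>"
    have AB: "0 \<le> A" "0 \<le> B" by (simp_all add: A_def B_def)
    have "\<bar>cutoff' n x\<bar> \<le> \<bar>n * deriv smooth_step (n * x - 1) * smooth_step (n * (1 - x) - 1)\<bar>
       + \<bar>n * smooth_step (n * x - 1) * deriv smooth_step (n * (1 - x) - 1)\<bar>"
      unfolding cutoff'_def by (rule abs_triangle_ineq4)
    also have "\<dots> = A * smooth_step (n * (1 - x) - 1) + B * smooth_step (n * x - 1)"
      by (simp add: A_def B_def abs_mult smooth_step_nonneg)
    also have "\<dots> \<le> A * 1 + B * 1"
      by (intro add_mono mult_left_mono smooth_step_le_1 AB)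
    finally have "\<bar>cutoff' n x\<bar> * min x (1 - x) \<le> (A * 1 + B * 1) * min x (1 - x)"
      using x by (intro mult_right_mono) auto
    also have "\<dots> = A * min x (1 - x) + B * min x (1 - x)" by (simp add: distrib_right)
    also have "\<dots> \<le> A * x + B * (1 - x)"
      by (intro add_mono mult_left_mono AB) auto
    also have "\<dots> \<le> 2 * K + 2 * K"
      using b[of x n] b[of "1 - x" n] x by (intro add_mono) (auto simp: A_def B_def)
    finally show ?thesis by simp
  qed
  then show ?thesis using K(1) by (intro exI[of _ "4 * K"]) auto
qed

lemma integral_tendsto_eventually_eq:
  fixes s :: "nat \<Rightarrow> 'a \<Rightarrow> real"
  assumes "f \<in> borel_measurable M" "\<And>n. s n \<in> borel_measurable M" "integrable M w"
    and ev: "\<And>x. x \<in> space M \<Longrightarrow> \<forall>\<^sub>F n in sequentially. s n x = f x"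
    and b: "\<And>n x. x \<in> space M \<Longrightarrow> \<bar>s n x\<bar> \<le> w x"
  shows "(\<lambda>n. \<integral>x. s n x \<partial>M) \<longlonglongrightarrow> (\<integral>x. f x \<partial>M)"
proof (rule integral_dominated_convergence[OF assms(1-3)])
  show "AE x in M. (\<lambda>n. s n x) \<longlonglongrightarrow> f x"
    by (rule AE_I2) (rule tendsto_eventually[OF ev])
  show "AE x in M. norm (s n x) \<le> w x" for n
    by (rule AE_I2) (simp add: b)
qed

text \<open>The weak gradient may be tested with \<open>C\<^sup>1\<close> functions.\<close>

lemma weak_gradient_C1:
  fixes v q :: "real \<Rightarrow> real"
  assumes v: "v \<in> L2_loc {0<..<1}" and q: "q \<in> L2_loc {0<..<1}" and w: "weak_gradient {0<..<1} v q"
    and ab: "0 < a" "a \<le> 1/2" "1/2 \<le> b" "b < 1"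
    and d: "\<And>x. x \<in> {a..b} \<Longrightarrow> (\<phi> has_real_derivative \<phi>' x) (at x)"
    and c: "continuous_on {a..b} \<phi>'" and z: "\<phi> a = 0" "\<phi> b = 0"
  shows "(\<integral>x. v x * \<phi>' x \<partial>lebesgue_on {a..b}) = - (\<integral>x. q x * \<phi> x \<partial>lebesgue_on {a..b})"
proof -
  let ?M = "lebesgue_on {a..b}"
  have "\<exists>c. AE x in lebesgue_on {0<..<1}. v x = c + prim q x"
  proof (rule weak_primitive)
    fix \<psi> :: "real \<Rightarrow> real" assume \<psi>: "\<psi> \<in> test_functions {0<..<1}"
    have "(\<integral>x. v x * frechet_derivative \<psi> (at x) 1 \<partial>lebesgue_on {0<..<1})
        = - (\<integral>x. (q x \<bullet> 1) * \<psi> x \<partial>lebesgue_on {0<..<1})"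
      using w \<psi> unfolding weak_gradient_def by simp
    then show "(\<integral>x. v x * deriv \<psi> x \<partial>lebesgue_on {0<..<1}) = - (\<integral>x. q x * \<psi> x \<partial>lebesgue_on {0<..<1})"
      by (simp add: test_function_realD(3)[OF \<psi>])
  qed (use L2_loc_integrable v q in auto)
  then obtain k where k: "AE x in lebesgue_on {0<..<1}. v x = k + prim q x" ..
  have k': "AE x in ?M. v x = k + prim q x"
  proof -
    have "AE x in lebesgue. x \<in> {0<..<1} \<longrightarrow> v x = k + prim q x"
      using k by (subst (asm) AE_restrict_space_iff) auto
    then have "AE x in lebesgue. x \<in> {a..b} \<longrightarrow> v x = k + prim q x"
      by eventually_elim (use ab in auto)
    then show ?thesis by (subst AE_restrict_space_iff) auto
  qed
  have qi: "integrable ?M q" and vi: "integrable ?M v" using L2_loc_integrable v q ab by auto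
  note p = prim_by_parts[OF qi ab(2,3) d c z]
  have ci: "integrable ?M (\<lambda>x. k * \<phi>' x)" by (intro continuous_imp_integrable_real continuous_intros c)
  have "(\<phi>' has_integral (\<phi> b - \<phi> a)) {a..b}"
    by (rule has_integral_real_derivative) (use ab d in auto)
  then have "integral {a..b} (\<lambda>x. k * \<phi>' x) = 0" using z by (simp add: integral_unique)
  then have c0: "(\<integral>x. k * \<phi>' x \<partial>?M) = 0" using lebesgue_integral_eq_integral[OF ci] by auto
  have "(\<integral>x. v x * \<phi>' x \<partial>?M) = (\<integral>x. k * \<phi>' x + prim q x * \<phi>' x \<partial>?M)"
  proof (rule integral_cong_AE)
    show "(\<lambda>x. v x * \<phi>' x) \<in> borel_measurable ?M"
      by (rule borel_measurable_integrable[OF integrable_times_continuous[OF vi compact_Icc c]])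
    show "(\<lambda>x. k * \<phi>' x + prim q x * \<phi>' x) \<in> borel_measurable ?M"
      using ci p(1) by (intro borel_measurable_add borel_measurable_integrable)
    show "AE x in ?M. v x * \<phi>' x = k * \<phi>' x + prim q x * \<phi>' x"
      using k' by eventually_elim (simp add: distrib_right)
  qed
  also have "\<dots> = (\<integral>x. k * \<phi>' x \<partial>?M) + (\<integral>x. prim q x * \<phi>' x \<partial>?M)"
    by (rule Bochner_Integration.integral_add[OF ci p(1)])
  finally show ?thesis using c0 p(2) by simp
qed

context trapezoid
begin

text \<open>No boundary terms appear for arbitrary \<open>v\<close> in the form domain. The function \<open>v\<close> itself need not be
  integrable up to the boundary, only \<open>h v\<close> is; this is why \<open>P\<close> has to decay faster than \<open>h\<close>.\<close>

lemma form_domain_by_parts: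
  assumes vq: "(v, q) \<in> form_domain {0<..<1} h"
    and d: "\<And>x. x \<in> {0<..<1} \<Longrightarrow> (P has_real_derivative w x) (at x)"
    and wc: "continuous_on {0<..<1} w"
    and Pb: "\<And>x. x \<in> {0<..<1} \<Longrightarrow> \<bar>P x\<bar> \<le> C * h x * min x (1 - x)"
    and wb: "\<And>x. x \<in> {0<..<1} \<Longrightarrow> \<bar>w x\<bar> \<le> C * h x"
  shows "(\<integral>x. P x * q x \<partial>M) = - (\<integral>x. w x * v x \<partial>M)"
proof -
  have vl: "v \<in> L2_loc {0<..<1}" and ql: "q \<in> L2_loc {0<..<1}" and wg: "weak_gradient {0<..<1} v q"
    and vW: "v \<in> L2 W" and qW: "q \<in> L2 W" using vq unfolding form_domain_def by auto
  have vm: "v \<in> borel_measurable M" and qm: "q \<in> borel_measurable M" using vW qW L2_W by auto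
  obtain K where K: "K > 0" "\<And>n x. x \<in> {0<..<1} \<Longrightarrow> \<bar>cutoff' n x\<bar> * min x (1 - x) \<le> K"
    using cutoff'_bound by blast
  have Pc: "continuous_on {0<..<1} P"
    by (rule DERIV_continuous_on[OF has_field_derivative_at_within[OF d]])
  have Pm: "P \<in> borel_measurable M" and wm: "w \<in> borel_measurable M"
    by (rule continuous_imp_measurable_on_sets_lebesgue; use Pc wc in simp)+
  have C0: "0 \<le> C"
  proof -
    have "0 \<le> C * h (1/2)" using wb[of "1/2"] by (simp add: abs_ge_zero order_trans[OF abs_ge_zero])
    moreover have "h (1/2) > 0" by (rule h_pos) simp
    ultimately show ?thesis by (simp add: zero_le_mult_iff)
  qed
  note cc = continuous_on_cutoff
  have cm: "cutoff n \<in> borel_measurable M" "cutoff' n \<in> borel_measurable M" for n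
    by (rule continuous_imp_measurable_on_sets_lebesgue[OF cc(1)], simp,
        rule continuous_imp_measurable_on_sets_lebesgue[OF cc(2)], simp)
  have eq: "(\<integral>x. v x * (w x * cutoff n x + cutoff' n x * P x) \<partial>M) = - (\<integral>x. q x * (P x * cutoff n x) \<partial>M)"
    if n: "n \<ge> 2" for n
  proof -
    have n0: "n > 0" using n by simp
    have "1 / real n \<le> 1/2" using n by (simp add: field_simps)
    then have ab: "0 < 1 / real n" "1 / real n \<le> 1/2" "1/2 \<le> 1 - 1 / real n" "1 - 1 / real n < 1"
      using n0 by auto
    have sub: "{1 / real n..1 - 1 / real n} \<subseteq> {0<..<1}"
    proof
      fix x assume "x \<in> {1 / real n..1 - 1 / real n}"
      then have "1 / real n \<le> x" "x \<le> 1 - 1 / real n" by simp_all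
      then have "0 < x" "x < 1" using ab(1,4) by linarith+
      then show "x \<in> {0<..<1}" by simp
    qed
    have "(\<integral>x. v x * (w x * cutoff n x + cutoff' n x * P x) \<partial>lebesgue_on {1 / real n..1 - 1 / real n})
       = - (\<integral>x. q x * (P x * cutoff n x) \<partial>lebesgue_on {1 / real n..1 - 1 / real n})"
    proof (rule weak_gradient_C1[OF vl ql wg ab])
      show "((\<lambda>x. P x * cutoff n x) has_real_derivative w x * cutoff n x + cutoff' n x * P x) (at x)"
        if "x \<in> {1 / real n..1 - 1 / real n}" for x
        by (rule DERIV_mult[OF d cutoff_DERIV]) (use that sub in auto)
      show "continuous_on {1 / real n..1 - 1 / real n} (\<lambda>x. w x * cutoff n x + cutoff' n x * P x)"
        by (intro continuous_on_add continuous_on_mult cc continuous_on_subset[OF wc sub]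
            continuous_on_subset[OF Pc sub])
      show "P (1 / real n) * cutoff n (1 / real n) = 0"
        by (simp add: cutoff_outside[OF n0])
      show "P (1 - 1 / real n) * cutoff n (1 - 1 / real n) = 0"
        by (simp add: cutoff_outside[OF n0])
    qed
    moreover have "(\<integral>x. v x * (w x * cutoff n x + cutoff' n x * P x) \<partial>M)
      = (\<integral>x. v x * (w x * cutoff n x + cutoff' n x * P x) \<partial>lebesgue_on {1 / real n..1 - 1 / real n})"
      by (rule integral_lebesgue_on_support) (use sub cutoff_outside[OF n0] cutoff'_outside[OF n0] in auto)
    moreover have "(\<integral>x. q x * (P x * cutoff n x) \<partial>M)
      = (\<integral>x. q x * (P x * cutoff n x) \<partial>lebesgue_on {1 / real n..1 - 1 / real n})"
      by (rule integral_lebesgue_on_support) (use sub cutoff_outside[OF n0] in auto)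
    ultimately show ?thesis by simp
  qed
  have lim1: "(\<lambda>n. \<integral>x. v x * (w x * cutoff n x + cutoff' n x * P x) \<partial>M) \<longlonglongrightarrow> (\<integral>x. v x * w x \<partial>M)"
  proof (rule integral_tendsto_eventually_eq[where w="\<lambda>x. (C + K * C) * \<bar>h x * v x\<bar>"])
    show "integrable M (\<lambda>x. (C + K * C) * \<bar>h x * v x\<bar>)"
      by (intro Bochner_Integration.integrable_mult_right Bochner_Integration.integrable_abs L2_W_hv_integrable[OF vW])
    show "(\<lambda>x. v x * (w x * cutoff n x + cutoff' n x * P x)) \<in> borel_measurable M" for n
      by (intro borel_measurable_times borel_measurable_add vm wm cm Pm)
    show "(\<lambda>x. v x * w x) \<in> borel_measurable M" by (intro borel_measurable_times vm wm)
    show "\<forall>\<^sub>F n in sequentially. v x * (w x * cutoff n x + cutoff' n x * P x) = v x * w x"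
      if "x \<in> space M" for x
      by (rule eventually_mono[OF cutoff_eventually]) (use that in auto)
    show "\<bar>v x * (w x * cutoff n x + cutoff' n x * P x)\<bar> \<le> (C + K * C) * \<bar>h x * v x\<bar>"
      if "x \<in> space M" for n x
    proof -
      from that have x: "x \<in> {0<..<1}" by simp
      have hx: "h x > 0" by (rule h_pos[OF x])
      have "\<bar>w x * cutoff n x\<bar> \<le> (C * h x) * 1"
        unfolding abs_mult by (intro mult_mono wb x cutoff_bounds) (use C0 hx in auto)
      moreover have "\<bar>cutoff' n x * P x\<bar> \<le> K * C * h x"
      proof -
        have "\<bar>cutoff' n x\<bar> * \<bar>P x\<bar> \<le> \<bar>cutoff' n x\<bar> * (C * h x * min x (1 - x))"
          by (intro mult_left_mono Pb x) simp
        also have "\<dots> = (\<bar>cutoff' n x\<bar> * min x (1 - x)) * (C * h x)" by (simp only: mult_ac)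
        also have "\<dots> \<le> K * (C * h x)" using C0 hx by (intro mult_right_mono K x) auto
        finally show ?thesis by (simp add: abs_mult mult_ac)
      qed
      ultimately have "\<bar>w x * cutoff n x + cutoff' n x * P x\<bar> \<le> (C + K * C) * h x"
        using abs_triangle_ineq[of "w x * cutoff n x" "cutoff' n x * P x"] by (simp add: distrib_right)
      then have "\<bar>v x\<bar> * \<bar>w x * cutoff n x + cutoff' n x * P x\<bar> \<le> \<bar>v x\<bar> * ((C + K * C) * h x)"
        by (rule mult_left_mono) simp
      then show ?thesis
        using hx by (simp add: abs_mult mult_ac)
    qed
  qed
  have lim2: "(\<lambda>n. \<integral>x. q x * (P x * cutoff n x) \<partial>M) \<longlonglongrightarrow> (\<integral>x. q x * P x \<partial>M)"
  proof (rule integral_tendsto_eventually_eq[where w="\<lambda>x. C * \<bar>h x * q x\<bar>"])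
    show "integrable M (\<lambda>x. C * \<bar>h x * q x\<bar>)"
      by (intro Bochner_Integration.integrable_mult_right Bochner_Integration.integrable_abs L2_W_hv_integrable[OF qW])
    show "(\<lambda>x. q x * (P x * cutoff n x)) \<in> borel_measurable M" for n
      by (intro borel_measurable_times qm cm Pm)
    show "(\<lambda>x. q x * P x) \<in> borel_measurable M" by (intro borel_measurable_times qm Pm)
    show "\<forall>\<^sub>F n in sequentially. q x * (P x * cutoff n x) = q x * P x" if "x \<in> space M" for x
      by (rule eventually_mono[OF cutoff_eventually]) (use that in auto)
    show "\<bar>q x * (P x * cutoff n x)\<bar> \<le> C * \<bar>h x * q x\<bar>" if "x \<in> space M" for n x
    proof -
      from that have x: "x \<in> {0<..<1}" by simp
      have hx: "h x > 0" by (rule h_pos[OF x])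
      have "C * h x * min x (1 - x) \<le> C * h x * 1" using C0 hx x by (intro mult_left_mono) auto
      then have "\<bar>P x\<bar> \<le> C * h x" using Pb[OF x] by simp
      then have "\<bar>P x\<bar> * \<bar>cutoff n x\<bar> \<le> C * h x * 1"
        by (intro mult_mono cutoff_bounds) (use C0 hx in auto)
      then have "\<bar>q x\<bar> * (\<bar>P x\<bar> * \<bar>cutoff n x\<bar>) \<le> \<bar>q x\<bar> * (C * h x * 1)"
        by (rule mult_left_mono) simp
      then show ?thesis
        using hx by (simp add: abs_mult mult_ac)
    qed
  qed
  have "\<forall>\<^sub>F n in sequentially. (\<integral>x. v x * (w x * cutoff n x + cutoff' n x * P x) \<partial>M)
      = - (\<integral>x. q x * (P x * cutoff n x) \<partial>M)"
    using eq by (rule eventually_sequentiallyI)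
  with lim1 have "(\<lambda>n. - (\<integral>x. q x * (P x * cutoff n x) \<partial>M)) \<longlonglongrightarrow> (\<integral>x. v x * w x \<partial>M)"
    by (rule Lim_transform_eventually)
  then have "(\<integral>x. v x * w x \<partial>M) = - (\<integral>x. q x * P x \<partial>M)"
    using tendsto_minus[OF lim2] LIMSEQ_unique by blast
  then show ?thesis by (simp add: mult.commute)
qed

end

section \<open>Eigenvalues of the trapezoidal weight\<close>

context trapezoid
begin

lemma lsol_bound:
  assumes m: "0 \<le> m" "m * \<epsilon> \<le> 1/2" and x: "0 \<le> x"
  shows "\<bar>lsol m x\<bar> \<le> 2"
proof -
  have J: "\<bar>J0 z\<bar> \<le> 16/15 \<and> \<bar>J1 z\<bar> \<le> 4/15" if "0 \<le> z" "z \<le> 1/2" for z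
    using J_bounds[OF that] that by auto
  show ?thesis
  proof (cases "x \<le> \<epsilon>")
    case True
    have "m * x \<le> m * \<epsilon>" using True m by (intro mult_left_mono) auto
    then have "\<bar>J0 (m * x)\<bar> \<le> 16/15" using J[of "m * x"] m x by simp
    then show ?thesis using True by (simp add: lsol_def)
  next
    case False
    have "\<bar>J0 (m * \<epsilon>) * cos (m * (x - \<epsilon>))\<bar> \<le> 16/15 * 1"
      unfolding abs_mult using J[of "m * \<epsilon>"] m \<epsilon> by (intro mult_mono abs_cos_le_one) auto
    moreover have "\<bar>J1 (m * \<epsilon>) * sin (m * (x - \<epsilon>))\<bar> \<le> 4/15 * 1"
      unfolding abs_mult using J[of "m * \<epsilon>"] m \<epsilon> by (intro mult_mono abs_sin_le_one) auto
    ultimately show ?thesis using False unfolding lsol_def by (simp only: if_False)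
  qed
qed

text \<open>The second factor \<open>x\<close> is the decay of the flux beyond that of \<open>h\<close>.\<close>

lemma lflux_bound:
  assumes m: "0 \<le> m" "m * \<epsilon> \<le> 1/2" and x: "0 < x" "x \<le> 1/2"
  shows "\<bar>lflux m x\<bar> \<le> (m^2 + 2 * m / \<epsilon>) * h x * x"
proof (cases "x \<le> \<epsilon>")
  case True
  have mx: "m * x \<le> m * \<epsilon>" using True m by (intro mult_left_mono) auto
  have hx: "h x = \<kappa> * x" using True by (rule h_left)
  have J: "0 \<le> J1 (m * x)" "J1 (m * x) \<le> 8/15 * (m * x)" using J_bounds[of "m * x"] m x mx by auto
  have "\<bar>lflux m x\<bar> = \<kappa> * x * m * J1 (m * x)"
    using True J m x \<kappa> by (simp add: lflux_def abs_mult)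
  also have "\<dots> \<le> \<kappa> * x * m * (1 * (m * x))"
    using J m x \<kappa> by (intro mult_left_mono) auto
  also have "\<dots> = m^2 * (\<kappa> * x * x)" by (simp add: power2_eq_square mult_ac)
  also have "\<dots> \<le> (m^2 + 2 * m / \<epsilon>) * (\<kappa> * x * x)"
    using m x \<kappa> \<epsilon> by (intro mult_right_mono) auto
  finally show ?thesis by (simp add: hx mult_ac)
next
  case False
  have hx: "h x = \<kappa> * \<epsilon>" using False x \<epsilon> by (intro h_mid) auto
  have J: "\<bar>J0 (m * \<epsilon>)\<bar> \<le> 16/15" "\<bar>J1 (m * \<epsilon>)\<bar> \<le> 4/15"
    using J_bounds[of "m * \<epsilon>"] m \<epsilon> by auto
  have "\<bar>J0 (m * \<epsilon>) * sin (m * (x - \<epsilon>))\<bar> \<le> 16/15 * 1"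
    unfolding abs_mult using J by (intro mult_mono abs_sin_le_one) auto
  moreover have "\<bar>J1 (m * \<epsilon>) * cos (m * (x - \<epsilon>))\<bar> \<le> 4/15 * 1"
    unfolding abs_mult using J by (intro mult_mono abs_cos_le_one) auto
  ultimately have b: "\<bar>J0 (m * \<epsilon>) * sin (m * (x - \<epsilon>)) + J1 (m * \<epsilon>) * cos (m * (x - \<epsilon>))\<bar> \<le> 2"
    by linarith
  have "\<bar>lflux m x\<bar> = \<kappa> * \<epsilon> * m * \<bar>J0 (m * \<epsilon>) * sin (m * (x - \<epsilon>)) + J1 (m * \<epsilon>) * cos (m * (x - \<epsilon>))\<bar>"
    using False m \<kappa> \<epsilon> by (simp add: lflux_def abs_mult)
  also have "\<dots> \<le> \<kappa> * \<epsilon> * m * 2" using b m \<kappa> \<epsilon> by (intro mult_left_mono) auto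
  also have "\<dots> = (2 * m / \<epsilon>) * (\<kappa> * \<epsilon>) * \<epsilon>" using \<epsilon> by simp
  also have "\<dots> \<le> (m^2 + 2 * m / \<epsilon>) * (\<kappa> * \<epsilon>) * x"
    using False m x \<kappa> \<epsilon> by (intro mult_mono) auto
  finally show ?thesis by (simp add: hx)
qed

text \<open>If the phase condition holds, either \<open>lsol\<close> or its flux vanishes at \<open>1/2\<close>; then the odd or the even
  reflection at \<open>1/2\<close> is an eigenfunction.\<close>

lemma eigenvalue_exists:
  assumes m: "0 \<le> m" "m * \<epsilon> \<le> 1/2" and j: "phase_total m = real j * pi"
  shows "1 \<le> multiplicity {0<..<1} h (m^2)"
proof -
  obtain R where R: "R > 0" "lsol m (1/2) = R * cos (phase_total m / 2)"
    "lflux m (1/2) = - \<kappa> * \<epsilon> * m * R * sin (phase_total m / 2)" using lsol_half[OF m] .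
  have "2 * sin (phase_total m / 2) * cos (phase_total m / 2) = sin (phase_total m)"
    using sin_double[of "phase_total m / 2"] by simp
  also have "\<dots> = 0" unfolding j by simp
  finally have dich: "lsol m (1/2) = 0 \<or> lflux m (1/2) = 0" using R by auto
  \<comment> \<open>\<open>s = - 1\<close> is the odd reflection, \<open>s = 1\<close> the even one.\<close>
  obtain s :: real where s: "\<bar>s\<bar> = 1" "lsol m (1/2) = s * lsol m (1/2)" "lflux m (1/2) = - s * lflux m (1/2)"
  proof (cases "lsol m (1/2) = 0")
    case True
    then show ?thesis using that[of "-1"] by simp
  next
    case False
    then show ?thesis using that[of 1] dich by simp
  qed
  define U where "U = (\<lambda>x. if x \<le> 1/2 then lsol m x else s * lsol m (1 - x))"
  define P where "P = (\<lambda>x. if x \<le> 1/2 then lflux m x else - s * lflux m (1 - x))"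
  have half: "(1/2::real) = 1 - 1/2" by simp
  have Ud: "(U has_real_derivative P x / h x) (at x)"
    and Pd: "(P has_real_derivative - (m^2) * h x * U x) (at x)" if x: "x \<in> {0<..<1}" for x
  proof -
    have yr: "((\<lambda>x. s * lsol m (1 - x)) has_real_derivative s * (- (lflux m (1 - x) / h x))) (at x)"
      and pr: "((\<lambda>x. - s * lflux m (1 - x)) has_real_derivative - s * (- (- (m^2) * h x * lsol m (1 - x)))) (at x)"
      if "\<epsilon> < x" "x < 1" for x
    proof -
      have "0 < 1 - x" "1 - x < 1 - \<epsilon>" using that by auto
      note l = lsol_sol[OF this, of m, unfolded h_reflect]
      show "((\<lambda>x. s * lsol m (1 - x)) has_real_derivative s * (- (lflux m (1 - x) / h x))) (at x)"
        by (rule DERIV_cmult[OF DERIV_reflect[OF l(1)]])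
      show "((\<lambda>x. - s * lflux m (1 - x)) has_real_derivative - s * (- (- (m^2) * h x * lsol m (1 - x)))) (at x)"
        by (rule DERIV_cmult[OF DERIV_reflect[OF l(2)]])
    qed
    have "(U has_real_derivative (if x \<le> 1/2 then lflux m x / h x else s * (- (lflux m (1 - x) / h x)))) (at x)"
      unfolding U_def
    proof (rule DERIV_piecewise)
      show "(lsol m has_real_derivative lflux m x / h x) (at x)" if "x \<le> 1/2"
        using that x \<epsilon> by (intro lsol_sol) auto
      show "((\<lambda>x. s * lsol m (1 - x)) has_real_derivative s * (- (lflux m (1 - x) / h x))) (at x)" if "1/2 \<le> x"
        using that x \<epsilon> by (intro yr) auto
      show "lsol m (1/2) = s * lsol m (1 - 1/2)" using s(2) half by (simp only:)
      have r: "s * (- (lflux m (1 - 1/2) / h (1/2))) = (- s * lflux m (1/2)) / h (1/2)" by simp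
      show "lflux m x / h x = s * (- (lflux m (1 - x) / h x))" if "x = 1/2"
        unfolding that r by (rule arg_cong[OF s(3), of "\<lambda>t. t / h (1/2)"])
    qed
    then show "(U has_real_derivative P x / h x) (at x)" by (simp add: P_def split: if_splits)
    have "(P has_real_derivative (if x \<le> 1/2 then - (m^2) * h x * lsol m x
        else - s * (- (- (m^2) * h x * lsol m (1 - x))))) (at x)"
      unfolding P_def
    proof (rule DERIV_piecewise)
      show "(lflux m has_real_derivative - (m^2) * h x * lsol m x) (at x)" if "x \<le> 1/2"
        using that x \<epsilon> by (intro lsol_sol) auto
      show "((\<lambda>x. - s * lflux m (1 - x)) has_real_derivative - s * (- (- (m^2) * h x * lsol m (1 - x)))) (at x)" if "1/2 \<le> x"
        using that x \<epsilon> by (intro pr) auto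
      show "lflux m (1/2) = - s * lflux m (1 - 1/2)" using s(3) half by (simp only:)
      have r: "- s * (- (- (m^2) * h (1/2) * lsol m (1 - 1/2))) = - (m^2) * h (1/2) * (s * lsol m (1/2))" by simp
      show "- (m^2) * h x * lsol m x = - s * (- (- (m^2) * h x * lsol m (1 - x)))" if "x = 1/2"
        unfolding that r by (rule arg_cong[OF s(2), of "\<lambda>t. - (m^2) * h (1/2) * t"])
    qed
    moreover have "(if x \<le> 1/2 then - (m^2) * h x * lsol m x
        else - s * (- (- (m^2) * h x * lsol m (1 - x)))) = - (m^2) * h x * U x"
      by (simp add: U_def)
    ultimately show "(P has_real_derivative - (m^2) * h x * U x) (at x)" by (simp only:)
  qed
  have Ub: "\<bar>U x\<bar> \<le> 2" if x: "x \<in> {0<..<1}" for x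
    using lsol_bound[OF m, of x] lsol_bound[OF m, of "1 - x"] x s(1) by (auto simp: U_def abs_mult)
  define C where "C = m^2 + 2 * m / \<epsilon>"
  have C0: "0 \<le> C" using m \<epsilon> by (simp add: C_def)
  have Pb: "\<bar>P x\<bar> \<le> C * h x * min x (1 - x)" if x: "x \<in> {0<..<1}" for x
  proof (cases "x \<le> 1/2")
    case True
    then show ?thesis using lflux_bound[OF m, of x] x by (simp add: P_def C_def min_def)
  next
    case False
    then show ?thesis using lflux_bound[OF m, of "1 - x"] x s(1)
      by (simp add: P_def C_def abs_mult h_reflect min_def)
  qed
  have hp: "h x > 0" if "x \<in> {0<..<1}" for x using h_pos[OF that] .
  have Phb: "\<bar>P x / h x\<bar> \<le> C" if x: "x \<in> {0<..<1}" for x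
  proof -
    have "\<bar>P x\<bar> \<le> C * h x * 1"
      using x C0 hp[OF x] by (intro order_trans[OF Pb[OF x]] mult_left_mono) auto
    then show ?thesis using hp[OF x] by (simp add: abs_divide pos_divide_le_eq)
  qed
  have Pc: "continuous_on {0<..<1} P" and Uc: "continuous_on {0<..<1} U"
    by (rule DERIV_continuous_on[OF has_field_derivative_at_within[OF Pd]], assumption,
        rule DERIV_continuous_on[OF has_field_derivative_at_within[OF Ud]], assumption)
  have fd: "(U, \<lambda>x. P x / h x) \<in> form_domain {0<..<1} h"
  proof (rule C1_form_domain[of U _ "max 2 C", OF Ud])
    have "h x \<noteq> 0" if "x \<in> {0<..<1}" for x using hp[OF that] by simp
    then show "continuous_on {0<..<1} (\<lambda>x. P x / h x)"
      by (intro continuous_on_divide Pc h_cont) auto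
    show "\<bar>U x\<bar> \<le> max 2 C" if "x \<in> {0<..<1}" for x using Ub[OF that] by simp
    show "\<bar>P x / h x\<bar> \<le> max 2 C" if "x \<in> {0<..<1}" for x using Phb[OF that] by simp
  qed
  have UL: "U \<in> L2 W" and gL: "(\<lambda>x. P x / h x) \<in> L2 W" using fd unfolding form_domain_def by auto
  then have Um: "U \<in> borel_measurable M" and gm: "(\<lambda>x. P x / h x) \<in> borel_measurable M" using L2_W by auto
  have "U \<in> eigenspace {0<..<1} h (m^2)"
    unfolding eigenspace_def mem_Collect_eq form_operator_def
  proof (intro conjI exI)
    have "integrable M (\<lambda>x. (m^2)^2 * (h x * (U x)^2))" using UL L2_W by simp
    then show "(\<lambda>x. m^2 * U x) \<in> L2 W"
      unfolding L2_W using Um by (simp add: power_mult_distrib mult_ac)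
    show "(U, \<lambda>x. P x / h x) \<in> form_domain {0<..<1} h" by (rule fd)
    show "\<forall>(v, q)\<in>form_domain {0<..<1} h. (\<integral>x. (P x / h x) \<bullet> q x \<partial>W) = (\<integral>x. (m^2 * U x) * v x \<partial>W)"
    proof (intro ballI, clarify)
      fix v q assume vq: "(v, q) \<in> form_domain {0<..<1} h"
      then have "v \<in> L2 W" "q \<in> L2 W" unfolding form_domain_def by auto
      then have vm: "v \<in> borel_measurable M" and qm: "q \<in> borel_measurable M" using L2_W by auto
      have "(\<integral>x. (P x / h x) \<bullet> q x \<partial>W) = (\<integral>x. h x * ((P x / h x) * q x) \<partial>M)"
        using integral_W[OF borel_measurable_times[OF gm qm]] by (simp only: inner_real_def)
      also have "\<dots> = (\<integral>x. P x * q x \<partial>M)"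
        by (rule Bochner_Integration.integral_cong) (use hp in fastforce)+
      also have "\<dots> = - (\<integral>x. (- (m^2) * h x * U x) * v x \<partial>M)"
      proof (rule form_domain_by_parts[OF vq Pd, where C="C + 2 * m^2"])
        show "continuous_on {0<..<1} (\<lambda>x. - (m^2) * h x * U x)"
          by (intro continuous_on_mult continuous_on_const h_cont Uc)
        fix x :: real assume x: "x \<in> {0<..<1}"
        have "C * h x * min x (1 - x) \<le> (C + 2 * m^2) * h x * min x (1 - x)"
          using x hp[OF x] by (intro mult_right_mono) auto
        then show "\<bar>P x\<bar> \<le> (C + 2 * m^2) * h x * min x (1 - x)" using Pb[OF x] by simp
        have "\<bar>- (m^2) * h x * U x\<bar> = (m^2 * h x) * \<bar>U x\<bar>" using hp[OF x] by (simp add: abs_mult)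
        also have "\<dots> \<le> (m^2 * h x) * 2" using hp[OF x] Ub[OF x] by (intro mult_left_mono) auto
        also have "\<dots> = (2 * m^2) * h x" by simp
        also have "\<dots> \<le> (C + 2 * m^2) * h x" using hp[OF x] C0 by (intro mult_right_mono) auto
        finally show "\<bar>- (m^2) * h x * U x\<bar> \<le> (C + 2 * m^2) * h x" .
      qed
      also have "\<dots> = (\<integral>x. h x * ((m^2 * U x) * v x) \<partial>M)"
        by (subst Bochner_Integration.integral_minus[symmetric]) (simp add: mult_ac)
      also have "\<dots> = (\<integral>x. (m^2 * U x) * v x \<partial>W)"
        using integral_W[of "\<lambda>x. (m^2 * U x) * v x"] Um vm by simp
      finally show "(\<integral>x. (P x / h x) \<bullet> q x \<partial>W) = (\<integral>x. (m^2 * U x) * v x \<partial>W)" .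
    qed
  qed
  moreover have "\<not> (AE x in W. U x = 0)"
  proof
    assume "AE x in W. U x = 0"
    then have "AE x in M. U x = 0" using AE_W by simp
    then have "AE x in lebesgue. x \<in> {0<..<1} \<longrightarrow> U x = 0"
      by (subst (asm) AE_restrict_space_iff) auto
    then have "AE x in lebesgue. x \<notin> {0<..<\<epsilon>}"
    proof eventually_elim
      case (elim x)
      show ?case
      proof
        assume x: "x \<in> {0<..<\<epsilon>}"
        have "m * x \<le> m * \<epsilon>" using x m by (intro mult_left_mono) auto
        then have "J0 (m * x) > 0" using J_bounds(1)[of "m * x"] m x by auto
        then show False using elim x \<epsilon> by (auto simp: U_def lsol_def)
      qed
    qed
    then have "negligible {0<..<\<epsilon>}"
      by (simp add: negligible_iff_null_sets AE_iff_null_sets)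
    then show False using open_not_negligible[of "{0<..<\<epsilon>}"] \<epsilon> by auto
  qed
  ultimately show ?thesis by (rule multiplicity_ge_1I)
qed

lemma multiplicity_le_1:
  assumes "0 \<le> \<mu>" "sqrt \<mu> * \<epsilon> \<le> 1/2"
  shows "multiplicity {0<..<1} h \<mu> \<le> 1"
proof (rule multiplicity_le_1I)
  fix u v assume u: "u \<in> eigenspace {0<..<1} h \<mu>" and v: "v \<in> eigenspace {0<..<1} h \<mu>"
  define m where "m = sqrt \<mu>"
  have m: "0 \<le> m" "m * \<epsilon> \<le> 1/2" and \<mu>: "\<mu> = m^2" using assms by (simp_all add: m_def)
  obtain U P where U: "sol \<mu> U P" "(P \<longlongrightarrow> 0) (at_right 0)" "(P \<longlongrightarrow> 0) (at_left 1)" "AE x in W. u x = U x"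
    using eigenfunction_classical[OF u] .
  obtain V Q where V: "sol \<mu> V Q" "(Q \<longlongrightarrow> 0) (at_right 0)" "(Q \<longlongrightarrow> 0) (at_left 1)" "AE x in W. v x = V x"
    using eigenfunction_classical[OF v] .
  obtain c where c: "\<And>x. x \<in> {0<..1/2} \<Longrightarrow> U x = c * lsol m x \<and> P x = c * lflux m x"
    using sol_left_unique[OF U(1)[unfolded \<mu>] U(2) m] by blast
  obtain d where d: "\<And>x. x \<in> {0<..1/2} \<Longrightarrow> V x = d * lsol m x \<and> Q x = d * lflux m x"
    using sol_left_unique[OF V(1)[unfolded \<mu>] V(2) m] by blast
  obtain a b where ab: "a \<noteq> 0 \<or> b \<noteq> 0" "a * c + b * d = 0"
  proof (cases "c = 0 \<and> d = 0")
    case True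
    then show ?thesis using that[of 1 0] by simp
  next
    case False
    then show ?thesis using that[of d "- c"] by auto
  qed
  have z: "a * U x + b * V x = 0" if "x \<in> {0<..<1}" for x
  proof (rule sol_zero[OF sol_lincomb[OF U(1)[unfolded \<mu>] V(1)[unfolded \<mu>], of a b] _ _ m _ that])
    show "((\<lambda>x. a * P x + b * Q x) \<longlongrightarrow> 0) (at_right 0)"
      using tendsto_add[OF tendsto_mult_left[OF U(2), of a] tendsto_mult_left[OF V(2), of b]] by simp
    show "((\<lambda>x. a * P x + b * Q x) \<longlongrightarrow> 0) (at_left 1)"
      using tendsto_add[OF tendsto_mult_left[OF U(3), of a] tendsto_mult_left[OF V(3), of b]] by simp
    fix x assume "x \<in> {0<..\<epsilon>}"
    then have "x \<in> {0<..1/2}" using \<epsilon> by auto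
    then have "a * U x + b * V x = (a * c + b * d) * lsol m x" using c[of x] d[of x] by (simp add: algebra_simps)
    then show "a * U x + b * V x = 0" using ab(2) by simp
  qed
  have "AE x in W. x \<in> {0<..<1}" unfolding AE_W by (rule AE_I2) simp
  with U(4) V(4) have "AE x in W. a * u x + b * v x = 0"
    by eventually_elim (use z in simp)
  then show "\<exists>a b. (a \<noteq> 0 \<or> b \<noteq> 0) \<and> (AE x in W. a * u x + b * v x = 0)" using ab(1) by blast
qed

lemma multiplicity_eq_0:
  assumes "\<mu> < 0 \<or> (0 \<le> \<mu> \<and> sqrt \<mu> * \<epsilon> \<le> 1/2 \<and> (\<nexists>j::int. phase_total (sqrt \<mu>) = j * pi))"
  shows "multiplicity {0<..<1} h \<mu> = 0"
proof (rule multiplicity_eq_0I)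
  fix u assume u: "u \<in> eigenspace {0<..<1} h \<mu>"
  show "AE x in W. u x = 0"
  proof (cases "\<mu> < 0")
    case True
    then show ?thesis using eigenfunction_negative_AE_zero[OF u] by blast
  next
    case False
    then have m: "0 \<le> sqrt \<mu>" "sqrt \<mu> * \<epsilon> \<le> 1/2" and nj: "\<nexists>j::int. phase_total (sqrt \<mu>) = j * pi"
      and \<mu>: "\<mu> = (sqrt \<mu>)^2" using assms by auto
    obtain U P where U: "sol \<mu> U P" "(P \<longlongrightarrow> 0) (at_right 0)" "(P \<longlongrightarrow> 0) (at_left 1)" "AE x in W. u x = U x"
      using eigenfunction_classical[OF u] .
    have s: "sol ((sqrt \<mu>)^2) U P" using U(1) \<mu> by simp
    have z: "U x = 0" if "x \<in> {0<..<1}" for x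
      using sol_eigencondition[OF s U(2,3) m that] nj by blast
    have "AE x in W. x \<in> {0<..<1}" unfolding AE_W by (rule AE_I2) simp
    with U(4) show ?thesis by eventually_elim (use z in simp)
  qed
qed

lemma phase_total_strict_mono:
  assumes "0 \<le> m" "m < m'" "m' * \<epsilon> \<le> 1/2"
  shows "phase_total m < phase_total m'"
proof -
  have "phase (m * \<epsilon>) \<le> phase (m' * \<epsilon>)"
    using assms \<epsilon> by (intro phase_mono mult_right_mono) auto
  moreover have "m * (1 - 2 * \<epsilon>) < m' * (1 - 2 * \<epsilon>)"
    using assms \<epsilon> by (intro mult_strict_right_mono) auto
  ultimately show ?thesis by (simp add: phase_total_def)
qed

lemma phase_total_bounds:
  assumes "0 \<le> m" "m * \<epsilon> \<le> 1/2"
  shows "m * (1 - 2 * \<epsilon>) \<le> phase_total m" "phase_total m \<le> m * (1 - 6/7 * \<epsilon>)"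
  using phase_bounds[of "m * \<epsilon>"] assms \<epsilon> by (auto simp: phase_total_def algebra_simps)

text \<open>The assumption keeps all frequencies \<open>m\<close> under consideration at most \<open>1 / (2 \<epsilon>)\<close>, where the bounds on
  the Bessel functions are valid. The proof has two parts: there are at least \<open>k + 1\<close> eigenvalues, so
  that the infimum is over a nonempty set; and at most \<open>k\<close> of them are below the bound.\<close>

theorem trapezoid_eigenvalue_lower_bound:
  assumes k: "2 * \<epsilon> * (real k * pi) \<le> 1 - 2 * \<epsilon>"
  shows "(real k * pi / (1 - 6/7 * \<epsilon>))^2 \<le> kth_eigenvalue {0<..<1} h k"
  unfolding kth_eigenvalue_def
proof (rule cInf_greatest)
  let ?E = "\<lambda>\<mu>. multiplicity {0<..<1} h \<mu>"
  have e6: "0 < 1 - 6/7 * \<epsilon>" "1 - 2 * \<epsilon> \<le> 1 - 6/7 * \<epsilon>" using \<epsilon> by auto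
  define m0 where "m0 = 1 / (2 * \<epsilon>)"
  have m0: "0 < m0" "m0 * \<epsilon> = 1/2" using \<epsilon> by (auto simp: m0_def)
  have small: "m * \<epsilon> \<le> 1/2" if "m \<le> m0" for m
    using mult_right_mono[OF that, of \<epsilon>] m0 \<epsilon> by simp
  have km0: "real k * pi \<le> m0 * (1 - 2 * \<epsilon>)"
    using k \<epsilon> by (simp add: m0_def pos_le_divide_eq mult_ac)
  have cont: "continuous_on {0..m0} phase_total"
  proof -
    have "continuous_on {0..m0} (\<lambda>m. phase (m * \<epsilon>))"
      by (rule continuous_on_compose2[OF continuous_on_phase])
         (use small \<epsilon> in \<open>auto intro!: continuous_intros\<close>)
    then show ?thesis unfolding phase_total_def[abs_def] by (intro continuous_intros)
  qed
  \<comment> \<open>The phase condition has a solution for every multiple \<open>j \<pi>\<close> with \<open>j \<le> k\<close>.\<close>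
  have "\<exists>m. 0 \<le> m \<and> m \<le> m0 \<and> phase_total m = real j * pi" if "j \<le> k" for j
  proof (rule IVT')
    show "phase_total 0 \<le> real j * pi" by (simp add: phase_total_def)
    have "real j * pi \<le> real k * pi" using that by (intro mult_right_mono) auto
    also have "\<dots> \<le> m0 * (1 - 2 * \<epsilon>)" by (rule km0)
    also have "\<dots> \<le> phase_total m0" using m0 by (intro phase_total_bounds) auto
    finally show "real j * pi \<le> phase_total m0" .
  qed (use m0 cont in auto)
  then obtain f where f: "\<And>j. j \<le> k \<Longrightarrow> 0 \<le> f j \<and> f j \<le> m0 \<and> phase_total (f j) = real j * pi" by metis
  define F where "F = (\<lambda>j. (f j)^2) ` {..k}"
  have inj: "inj_on (\<lambda>j. (f j)^2) {..k}"
  proof (rule inj_onI)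
    fix i j assume i: "i \<in> {..k}" and j: "j \<in> {..k}" and eq: "(f i)^2 = (f j)^2"
    then have "i \<le> k" "j \<le> k" by simp_all
    then have fi: "0 \<le> f i" "phase_total (f i) = real i * pi"
      and fj: "0 \<le> f j" "phase_total (f j) = real j * pi" using f by blast+
    have "f i = f j" by (rule power2_eq_imp_eq[OF eq fi(1) fj(1)])
    then have "real i * pi = real j * pi" using fi(2) fj(2) by metis
    then show "i = j" by simp
  qed
  have "1 \<le> ?E \<mu>" if "\<mu> \<in> F" for \<mu>
    using that f small unfolding F_def by (auto intro!: eigenvalue_exists)
  then have "(\<Sum>\<mu>\<in>F. 1) \<le> (\<Sum>\<mu>\<in>F. ?E \<mu>)" by (intro sum_mono) auto
  moreover have "(\<Sum>\<mu>\<in>F. 1 :: enat) = enat (Suc k)"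
    using inj by (simp add: F_def card_image of_nat_eq_enat)
  ultimately have "enat (Suc k) \<le> (\<Sum>\<mu>\<in>F. ?E \<mu>)" by simp
  then have "enat k < (\<Sum>\<mu>\<in>F. ?E \<mu>)" using less_le_trans[of "enat k" "enat (Suc k)"] by simp
  moreover have "finite F" "F \<subseteq> {..Max F}" by (auto simp: F_def)
  ultimately show "{t. \<exists>F. finite F \<and> F \<subseteq> {..t} \<and> enat k < (\<Sum>\<mu>\<in>F. ?E \<mu>)} \<noteq> {}" by blast
next
  let ?E = "\<lambda>\<mu>. multiplicity {0<..<1} h \<mu>"
  fix t assume "t \<in> {t. \<exists>F. finite F \<and> F \<subseteq> {..t} \<and> enat k < (\<Sum>\<mu>\<in>F. ?E \<mu>)}"
  then obtain F where F: "finite F" "F \<subseteq> {..t}" "enat k < (\<Sum>\<mu>\<in>F. ?E \<mu>)" by blast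
  have e6: "0 < 1 - 6/7 * \<epsilon>" "1 - 2 * \<epsilon> \<le> 1 - 6/7 * \<epsilon>" using \<epsilon> by auto
  show "(real k * pi / (1 - 6/7 * \<epsilon>))^2 \<le> t"
  proof (rule ccontr)
    assume "\<not> ?thesis"
    then have t: "t < (real k * pi / (1 - 6/7 * \<epsilon>))^2" by simp
    have small: "sqrt \<mu> < real k * pi / (1 - 6/7 * \<epsilon>) \<and> sqrt \<mu> * \<epsilon> \<le> 1/2" if "\<mu> \<in> F" "0 \<le> \<mu>" for \<mu>
    proof -
      have "\<mu> < (real k * pi / (1 - 6/7 * \<epsilon>))^2" using F(2) that t by auto
      then have 1: "sqrt \<mu> < real k * pi / (1 - 6/7 * \<epsilon>)"
        using e6 by (intro real_less_lsqrt) (auto simp: that)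
      have "sqrt \<mu> * \<epsilon> \<le> real k * pi / (1 - 6/7 * \<epsilon>) * \<epsilon>" using 1 \<epsilon> by (intro mult_right_mono) auto
      also have "\<dots> = (real k * pi * \<epsilon>) / (1 - 6/7 * \<epsilon>)" by simp
      also have "\<dots> \<le> 1/2"
      proof -
        define X where "X = real k * pi * \<epsilon>"
        have "2 * \<epsilon> * (real k * pi) = 2 * X" by (simp add: X_def mult_ac)
        with k have "2 * X \<le> 1 - 2 * \<epsilon>" by (simp only:)
        then have "2 * X \<le> 1 - 6/7 * \<epsilon>" by (rule order_trans[OF _ e6(2)])
        then have "X \<le> 1/2 * (1 - 6/7 * \<epsilon>)" by simp
        then have "real k * pi * \<epsilon> \<le> 1/2 * (1 - 6/7 * \<epsilon>)" unfolding X_def .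
        then show ?thesis by (simp only: pos_divide_le_eq[OF e6(1)])
      qed
      finally show ?thesis using 1 by simp
    qed
    define E where "E = {\<mu>\<in>F. 0 \<le> \<mu> \<and> (\<exists>j::int. phase_total (sqrt \<mu>) = j * pi)}"
    have fE: "finite E" using F(1) by (simp add: E_def)
    have "?E \<mu> \<le> (if \<mu> \<in> E then 1 else 0)" if "\<mu> \<in> F" for \<mu>
    proof (cases "\<mu> \<in> E")
      case True
      then show ?thesis using multiplicity_le_1[of \<mu>] small[OF that] by (auto simp: E_def)
    next
      case False
      then have "?E \<mu> = 0" using that small[OF that] by (intro multiplicity_eq_0) (auto simp: E_def)
      then show ?thesis by simp
    qed
    then have "(\<Sum>\<mu>\<in>F. ?E \<mu>) \<le> (\<Sum>\<mu>\<in>F. if \<mu> \<in> E then 1 else 0)" by (intro sum_mono) auto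
    also have "\<dots> = (\<Sum>\<mu>\<in>E. 1)"
      by (rule sum.mono_neutral_cong_right) (use F(1) in \<open>auto simp: E_def\<close>)
    also have "\<dots> = enat (card E)" by (simp add: of_nat_eq_enat)
    finally have "k < card E" using F(3) by (metis enat_ord_simps(2) less_le_trans)
    moreover have "card E \<le> k"
    proof -
      \<comment> \<open>Eigenvalues below the bound have the phase \<open>j \<pi>\<close> for some \<open>j < k\<close>, each \<open>j\<close> occurring at most once.\<close>
      have "\<exists>j. j < k \<and> phase_total (sqrt \<mu>) = real j * pi" if \<mu>: "\<mu> \<in> E" for \<mu>
      proof -
        obtain j :: int where j: "phase_total (sqrt \<mu>) = j * pi" using \<mu> by (auto simp: E_def)
        have s: "0 \<le> sqrt \<mu>" "sqrt \<mu> * \<epsilon> \<le> 1/2" "sqrt \<mu> < real k * pi / (1 - 6/7 * \<epsilon>)"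
          using \<mu> small[of \<mu>] by (auto simp: E_def)
        have "0 \<le> sqrt \<mu> * (1 - 2 * \<epsilon>)" using s \<epsilon> by simp
        also have "\<dots> \<le> phase_total (sqrt \<mu>)" by (rule phase_total_bounds[OF s(1,2)])
        finally have "0 \<le> real_of_int j * pi" using j by simp
        then have j0: "0 \<le> j" using pi_gt_zero by (auto simp: zero_le_mult_iff)
        have "phase_total (sqrt \<mu>) \<le> sqrt \<mu> * (1 - 6/7 * \<epsilon>)" by (rule phase_total_bounds[OF s(1,2)])
        also have "\<dots> < real k * pi" using s(3) e6 by (simp only: pos_less_divide_eq)
        finally have "real_of_int j * pi < real k * pi" using j by simp
        then have "real_of_int j < real k" by simp
        then have "j < int k" by linarith
        then show ?thesis using j j0 by (intro exI[of _ "nat j"]) auto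
      qed
      then obtain f where f: "\<And>\<mu>. \<mu> \<in> E \<Longrightarrow> f \<mu> < k \<and> phase_total (sqrt \<mu>) = real (f \<mu>) * pi" by metis
      have "inj_on f E"
      proof (rule inj_onI)
        fix a b assume a: "a \<in> E" and b: "b \<in> E" and eq: "f a = f b"
        then have "phase_total (sqrt a) = phase_total (sqrt b)" using f by metis
        then have "\<not> sqrt a < sqrt b" "\<not> sqrt b < sqrt a"
          using phase_total_strict_mono[of "sqrt a" "sqrt b"] phase_total_strict_mono[of "sqrt b" "sqrt a"]
            small[of a] small[of b] a b by (auto simp: E_def)
        then show "a = b" by simp
      qed
      moreover have "f ` E \<subseteq> {..<k}" using f by auto
      ultimately show ?thesis using card_inj_on_le[of f E "{..<k}"] by simp
    qed
    ultimately show False by simp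
  qed
qed

end

section \<open>Weak gradients of smooth functions\<close>

lemma integral_translate:
  fixes f :: "'a::euclidean_space \<Rightarrow> real"
  assumes f: "f \<in> borel_measurable borel"
  shows "(\<integral>x. f (c + x) \<partial>lborel) = (\<integral>x. f x \<partial>lborel)"
proof -
  have "(\<integral>x. f x \<partial>lborel) = (\<integral>x. f x \<partial>distr lborel borel ((+) c))"
    by (simp only: lborel_distr_plus)
  also have "\<dots> = (\<integral>x. f (c + x) \<partial>lborel)"
    by (rule integral_distr) (use f in auto)
  finally show ?thesis by simp
qed

text \<open>By translation invariance the difference quotients have integral \<open>0\<close>; they converge boundedly on a
  fixed ball.\<close>

lemma integral_partial_derivative_eq_0:
  fixes \<psi> :: "'a::euclidean_space \<Rightarrow> real"
  assumes d: "\<And>x. (\<psi> has_derivative D x) (at x)"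
    and c: "continuous_on UNIV (\<lambda>x. D x i)" and i: "i \<in> Basis"
    and K: "compact K" and z: "\<And>x. x \<notin> K \<Longrightarrow> \<psi> x = 0"
  shows "(\<integral>x. D x i \<partial>lebesgue) = 0"
proof -
  obtain r where r: "r > 0" "\<And>x. x \<in> K \<Longrightarrow> norm x \<le> r"
    using compact_imp_bounded[OF K] unfolding bounded_pos by blast
  have ni: "norm i = 1" using i by simp
  have \<psi>c: "continuous_on UNIV \<psi>"
    using d by (meson has_derivative_continuous continuous_at_imp_continuous_on)
  have \<psi>m: "\<psi> \<in> borel_measurable borel" by (rule borel_measurable_continuous_onI[OF \<psi>c])
  have Dm: "(\<lambda>x. D x i) \<in> borel_measurable borel" by (rule borel_measurable_continuous_onI[OF c])
  have "bounded ((\<lambda>x. D x i) ` cball 0 (r + 2))"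
    by (rule compact_imp_bounded[OF compact_continuous_image[OF continuous_on_subset[OF c subset_UNIV]]]) simp
  then obtain B where B: "B > 0" "\<And>x. norm x \<le> r + 2 \<Longrightarrow> \<bar>D x i\<bar> \<le> B"
    unfolding bounded_pos by (auto simp: dist_norm)
  have line: "((\<lambda>s. \<psi> (x + s *\<^sub>R i)) has_real_derivative D (x + s *\<^sub>R i) i) (at s)" for x s
  proof -
    have "((\<lambda>s. \<psi> (x + s *\<^sub>R i)) has_derivative (\<lambda>h. D (x + s *\<^sub>R i) (h *\<^sub>R i))) (at s)"
      by (rule has_derivative_compose[where g=\<psi> and f="\<lambda>s. x + s *\<^sub>R i", OF _ d])
         (auto intro!: derivative_eq_intros)
    moreover have "D (x + s *\<^sub>R i) (h *\<^sub>R i) = D (x + s *\<^sub>R i) i * h" for h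
      using linear_scale[OF has_derivative_linear[OF d[of "x + s *\<^sub>R i"]], of h i] by (simp add: mult.commute)
    ultimately show ?thesis by (simp add: has_field_derivative_def)
  qed
  define t where "t = (\<lambda>n. 1 / (real n + 1))"
  have t: "0 < t n" "t n \<le> 1" for n by (simp_all add: t_def)
  have t0: "t \<longlonglongrightarrow> 0"
    unfolding t_def using LIMSEQ_inverse_real_of_nat by (simp add: inverse_eq_divide add.commute)
  define q where "q = (\<lambda>n x. (\<psi> (x + t n *\<^sub>R i) - \<psi> x) / t n)"
  have \<psi>int: "integrable lborel \<psi>"
  proof -
    have "integrable lborel (\<lambda>x. indicator K x *\<^sub>R \<psi> x)"
      by (rule borel_integrable_compact[OF K continuous_on_subset[OF \<psi>c subset_UNIV]])
    moreover have "(\<lambda>x. indicator K x *\<^sub>R \<psi> x) = \<psi>" using z by (fastforce simp: indicator_def)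
    ultimately show ?thesis by simp
  qed
  have \<psi>int': "integrable lborel (\<lambda>x. \<psi> (c + x))" for c
  proof -
    have "integrable (distr lborel borel ((+) c)) \<psi>" using \<psi>int by (simp only: lborel_distr_plus)
    then show ?thesis by (subst (asm) integrable_distr_eq) (auto simp: \<psi>m)
  qed
  have q0: "(\<integral>x. q n x \<partial>lborel) = 0" for n
  proof -
    have "(\<integral>x. \<psi> (t n *\<^sub>R i + x) - \<psi> x \<partial>lborel) = (\<integral>x. \<psi> (t n *\<^sub>R i + x) \<partial>lborel) - (\<integral>x. \<psi> x \<partial>lborel)"
      by (rule Bochner_Integration.integral_diff[OF \<psi>int' \<psi>int])
    also have "\<dots> = 0" using integral_translate[OF \<psi>m] by simp
    finally show ?thesis by (simp add: q_def add.commute)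
  qed
  have lim: "(\<lambda>n. \<integral>x. q n x \<partial>lborel) \<longlonglongrightarrow> (\<integral>x. D x i \<partial>lborel)"
  proof (rule integral_dominated_convergence[where w="\<lambda>x. B * indicator (cball 0 (r + 1)) x"])
    have "integrable lborel (\<lambda>x::'a. indicator (cball 0 (r + 1)) x *\<^sub>R B)"
      by (rule borel_integrable_compact) auto
    then show "integrable lborel (\<lambda>x::'a. B * indicator (cball 0 (r + 1)) x)"
      by (simp add: mult.commute)
    show "(\<lambda>x. D x i) \<in> borel_measurable lborel" using Dm by simp
    have "(\<lambda>x. \<psi> (x + t n *\<^sub>R i)) \<in> borel_measurable borel" for n
      by (intro borel_measurable_continuous_onI continuous_on_compose2[OF \<psi>c] continuous_intros) auto
    then show "q n \<in> borel_measurable lborel" for n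
      unfolding q_def using \<psi>m by simp
    show "AE x in lborel. (\<lambda>n. q n x) \<longlonglongrightarrow> D x i"
    proof (rule AE_I2)
      fix x
      have "((\<lambda>s. (\<psi> (x + s *\<^sub>R i) - \<psi> (x + 0 *\<^sub>R i)) / (s - 0)) \<longlongrightarrow> D (x + 0 *\<^sub>R i) i) (at 0)"
        using line[of x 0] unfolding has_field_derivative_iff .
      then have l: "((\<lambda>s. (\<psi> (x + s *\<^sub>R i) - \<psi> x) / s) \<longlongrightarrow> D x i) (at 0)" by simp
      have "filterlim t (at 0) sequentially"
        unfolding filterlim_at using t0 t by (auto simp: less_imp_neq[THEN not_sym])
      from filterlim_compose[OF l this] show "(\<lambda>n. q n x) \<longlonglongrightarrow> D x i" unfolding q_def .
    qed
    show "AE x in lborel. norm (q n x) \<le> B * indicator (cball 0 (r + 1)) x" for n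
    proof (rule AE_I2)
      fix x :: 'a
      show "norm (q n x) \<le> B * indicator (cball 0 (r + 1)) x"
      proof (cases "norm x \<le> r + 1")
        case True
        have "norm (\<psi> (x + t n *\<^sub>R i) - \<psi> (x + 0 *\<^sub>R i)) \<le> B * norm (t n - 0)"
        proof (rule field_differentiable_bound[of "{0..t n}" "\<lambda>s. \<psi> (x + s *\<^sub>R i)" "\<lambda>s. D (x + s *\<^sub>R i) i"])
          fix s assume s: "s \<in> {0..t n}"
          show "((\<lambda>s. \<psi> (x + s *\<^sub>R i)) has_field_derivative D (x + s *\<^sub>R i) i) (at s within {0..t n})"
            by (rule has_field_derivative_at_within[OF line])
          have "norm (x + s *\<^sub>R i) \<le> norm x + \<bar>s\<bar> * norm i" by (metis norm_scaleR norm_triangle_ineq)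
          also have "\<dots> \<le> r + 2" using True s t[of n] ni by auto
          finally show "norm (D (x + s *\<^sub>R i) i) \<le> B" using B(2) by simp
        qed (use t[of n] in auto)
        then have "\<bar>\<psi> (x + t n *\<^sub>R i) - \<psi> x\<bar> \<le> B * t n" using t[of n] by simp
        then show ?thesis using True t[of n] by (simp add: q_def abs_divide pos_divide_le_eq)
      next
        case False
        have "norm x \<le> norm (x + t n *\<^sub>R i) + \<bar>t n\<bar> * norm i"
          by (metis add_diff_cancel_right' norm_scaleR norm_triangle_ineq4)
        then have "r < norm (x + t n *\<^sub>R i)" using False t[of n] ni by simp
        then have "x + t n *\<^sub>R i \<notin> K" "x \<notin> K" using r(2) False by (auto simp: not_le[symmetric] dest: r(2))
        then show ?thesis using z False by (simp add: q_def)
      qed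
    qed
  qed
  have "(\<integral>x. D x i \<partial>lborel) = 0" using lim unfolding q0 by (simp add: LIMSEQ_const_iff)
  moreover have "(\<integral>x. D x i \<partial>lebesgue) = (\<integral>x. D x i \<partial>lborel)"
    by (rule integral_completion) (use Dm in simp)
  ultimately show ?thesis by simp
qed

lemma continuous_bounded_L2:
  fixes f :: "'a::euclidean_space \<Rightarrow> 'b::euclidean_space"
  assumes f: "continuous_on UNIV f" and b: "\<And>x. norm (f x) \<le> B" and S: "S \<in> lmeasurable"
  shows "f \<in> L2 (lebesgue_on S)"
  unfolding L2_def
proof (intro CollectI conjI)
  have Sl: "S \<in> sets lebesgue" using S by (simp add: fmeasurableD)
  show fm: "f \<in> borel_measurable (lebesgue_on S)"
    by (rule continuous_imp_measurable_on_sets_lebesgue[OF continuous_on_subset[OF f subset_UNIV] Sl])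
  have "integrable (lebesgue_on S) (\<lambda>x. 1::real)"
    by (rule finite_measure.integrable_const[OF finite_measure_lebesgue_on[OF S]])
  then have "integrable (lebesgue_on S) (\<lambda>x. 1 * (norm (f x))^2)"
  proof (rule integrable_times_bounded[where B="B^2"])
    show "(\<lambda>x. (norm (f x))^2) \<in> borel_measurable (lebesgue_on S)" using fm by simp
    show "\<bar>(norm (f x))^2\<bar> \<le> B^2" for x using b[of x] by (simp add: power_mono)
  qed
  then show "integrable (lebesgue_on S) (\<lambda>x. (norm (f x))^2)" by simp
qed

lemma continuous_bounded_L2_loc:
  fixes f :: "'a::euclidean_space \<Rightarrow> 'b::euclidean_space"
  assumes "continuous_on UNIV f" and "\<And>x. norm (f x) \<le> B"
  shows "f \<in> L2_loc U"
  unfolding L2_loc_def using continuous_bounded_L2[OF assms lmeasurable_compact] by blast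

lemma weighted_1: "weighted U (\<lambda>_. 1) = lebesgue_on U"
  by (simp add: weighted_def density_1)

lemma C1_weak_gradient:
  fixes u :: "'a::euclidean_space \<Rightarrow> real"
  assumes d: "\<And>x. (u has_derivative (\<lambda>h. g x \<bullet> h)) (at x)" and c: "continuous_on UNIV g" and U: "open U"
  shows "weak_gradient U u g"
  unfolding weak_gradient_def
proof (intro ballI)
  fix \<phi> and i :: 'a
  assume \<phi>: "\<phi> \<in> test_functions U" and i: "i \<in> Basis"
  define K where "K = closure {x. \<phi> x \<noteq> 0}"
  have K: "compact K" "K \<subseteq> U" and C: "C_k (Suc 0) \<phi>" using \<phi> unfolding test_functions_def K_def by auto
  have z: "\<phi> x = 0" if "x \<notin> K" for x using that closure_subset[of "{x. \<phi> x \<noteq> 0}"] by (auto simp: K_def)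
  note \<phi>d = C_k_has_derivative[OF C]
  have \<phi>'c: "continuous_on UNIV (\<lambda>x. frechet_derivative \<phi> (at x) i)" using C i by simp
  have z': "frechet_derivative \<phi> (at x) i = 0" if "x \<notin> K" for x
  proof -
    have "open (- K)" using K by (simp add: compact_imp_closed open_Compl)
    then have "((\<lambda>_. 0) has_derivative frechet_derivative \<phi> (at x)) (at x)"
      by (rule has_derivative_transform_within_open[OF \<phi>d]) (use that z in auto)
    then have "frechet_derivative \<phi> (at x) = (\<lambda>_. 0)"
      using has_derivative_unique has_derivative_const by blast
    then show ?thesis by simp
  qed
  have uc: "continuous_on UNIV u" and \<phi>c: "continuous_on UNIV \<phi>"
    using d \<phi>d by (meson has_derivative_continuous continuous_at_imp_continuous_on)+
  let ?D = "\<lambda>x h. u x * frechet_derivative \<phi> (at x) h + (g x \<bullet> h) * \<phi> x"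
  have "(\<integral>x. ?D x i \<partial>lebesgue) = 0"
  proof (rule integral_partial_derivative_eq_0[OF has_derivative_mult[OF d \<phi>d] _ i K(1)])
    show "continuous_on UNIV (\<lambda>x. ?D x i)" by (intro continuous_intros uc \<phi>'c c \<phi>c)
    show "u x * \<phi> x = 0" if "x \<notin> K" for x using z[OF that] by simp
  qed
  moreover have "(\<integral>x. ?D x i \<partial>lebesgue) = (\<integral>x. ?D x i \<partial>lebesgue_on K)"
    using integral_lebesgue_on_support[of K UNIV "\<lambda>x. ?D x i"] K z z'
    by (simp add: compact_imp_closed borel_closed lebesgue_on_UNIV_eq)
  moreover have Kl: "K \<in> sets lebesgue" "U \<in> sets lebesgue" using K U by (auto simp: compact_imp_closed borel_closed)
  have ci: "integrable (lebesgue_on K) f" if "continuous_on UNIV f" for f :: "'a \<Rightarrow> real"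
  proof -
    have i: "integrable lborel (\<lambda>x. indicator K x *\<^sub>R f x)"
      by (rule borel_integrable_compact[OF K(1) continuous_on_subset[OF that subset_UNIV]])
    have "integrable lebesgue (\<lambda>x. indicator K x *\<^sub>R f x)"
      using i integrable_completion[OF borel_measurable_integrable[OF i]] by blast
    then show ?thesis using Kl by (simp add: integrable_restrict_space)
  qed
  have "(\<integral>x. ?D x i \<partial>lebesgue_on K) = (\<integral>x. u x * frechet_derivative \<phi> (at x) i \<partial>lebesgue_on K)
      + (\<integral>x. (g x \<bullet> i) * \<phi> x \<partial>lebesgue_on K)"
    by (rule Bochner_Integration.integral_add) (intro ci continuous_intros uc \<phi>'c c \<phi>c)+
  moreover have "(\<integral>x. u x * frechet_derivative \<phi> (at x) i \<partial>lebesgue_on U) = (\<integral>x. u x * frechet_derivative \<phi> (at x) i \<partial>lebesgue_on K)"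
    by (rule integral_lebesgue_on_support) (use K Kl z' in auto)
  moreover have "(\<integral>x. (g x \<bullet> i) * \<phi> x \<partial>lebesgue_on U) = (\<integral>x. (g x \<bullet> i) * \<phi> x \<partial>lebesgue_on K)"
    by (rule integral_lebesgue_on_support) (use K Kl z in auto)
  ultimately show "(\<integral>x. u x * frechet_derivative \<phi> (at x) i \<partial>lebesgue_on U) = - (\<integral>x. (g x \<bullet> i) * \<phi> x \<partial>lebesgue_on U)"
    by linarith
qed

section \<open>Neumann eigenvalues of a rectangle\<close>

text \<open>The open rectangle \<open>(0, a) \<times> (0, b)\<close>.\<close>

definition rectangle :: "real \<Rightarrow> real \<Rightarrow> (real^2) set" where
  "rectangle a b = box 0 (vector [a, b])"

lemma mem_rectangle: "x \<in> rectangle a b \<longleftrightarrow> 0 < x$1 \<and> x$1 < a \<and> 0 < x$2 \<and> x$2 < b"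
  by (auto simp: rectangle_def mem_box_cart forall_2)

lemma inner_axis1: "(x::real^2) \<bullet> axis 1 1 = x$1" and inner_axis2: "(x::real^2) \<bullet> axis 2 1 = x$2"
  by (simp_all add: inner_axis)

lemma nth_has_derivative: "((\<lambda>x::real^2. x$i) has_derivative (\<lambda>h. h$i)) (at x)"
  by (rule bounded_linear_imp_has_derivative[OF bounded_linear_vec_nth])

lemma rectangle_lmeasurable: "rectangle a b \<in> lmeasurable"
  by (simp add: rectangle_def)

text \<open>The normal derivative of \<open>cos (l x\<^sub>1)\<close> with \<open>l = j \<pi> / a\<close> vanishes on the boundary, and
  \<open>\<bar>sin (l x\<^sub>1)\<bar>\<close> is bounded by a multiple of the distance to the sides \<open>x\<^sub>1 = 0\<close> and \<open>x\<^sub>1 = a\<close>. This absorbs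
  the derivative of the cutoff in \<open>x\<^sub>1\<close>; the cutoff in \<open>x\<^sub>2\<close> is not differentiated.\<close>

lemma rectangle_eigenfunction:
  fixes j :: nat
  assumes ab: "0 < a" "0 < b"
  shows "(\<lambda>x. cos (real j * pi / a * x$1)) \<in> eigenspace (rectangle a b) (\<lambda>_. 1) ((real j * pi / a)^2)"
proof -
  let ?R = "rectangle a b"
  let ?M = "lebesgue_on ?R"
  let ?e = "axis 1 1 :: real^2"
  define l where "l = real j * pi / a"
  define u where "u = (\<lambda>x::real^2. cos (l * x$1))"
  define g where "g = (\<lambda>x::real^2. (- l * sin (l * x$1)) *\<^sub>R ?e)"
  have ne: "norm ?e = 1" by simp
  have oR: "open ?R" by (simp add: rectangle_def open_box)
  have Rl: "?R \<in> sets lebesgue" using rectangle_lmeasurable by (simp add: fmeasurableD)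
  have ud: "(u has_derivative (\<lambda>h. g x \<bullet> h)) (at x)" for x
  proof -
    have "((\<lambda>t. cos (l * t)) has_real_derivative - l * sin (l * t)) (at t)" for t
      by (auto intro!: derivative_eq_intros)
    then have "(u has_derivative (\<lambda>h. h$1 * (- l * sin (l * x$1)))) (at x)"
      unfolding u_def by (rule DERIV_compose_FDERIV[OF _ nth_has_derivative])
    moreover have "(\<lambda>h. h$1 * (- l * sin (l * x$1))) = (\<lambda>h. g x \<bullet> h)"
      by (rule ext) (simp add: g_def inner_commute[of "axis 1 1"] inner_axis1 mult.commute)
    ultimately show ?thesis by simp
  qed
  have gc: "continuous_on UNIV g" unfolding g_def by (intro continuous_intros)
  have uc: "continuous_on UNIV u" unfolding u_def by (intro continuous_intros)
  have ub: "norm (u x) \<le> 1" for x by (simp add: u_def)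
  have gb: "norm (g x) \<le> \<bar>l\<bar>" for x
    using mult_left_mono[OF abs_sin_le_one[of "l * x$1"] abs_ge_zero[of l]] by (simp add: g_def abs_mult)
  have fd: "(u, g) \<in> form_domain ?R (\<lambda>_. 1)"
    unfolding form_domain_def weighted_1
    using continuous_bounded_L2[OF uc ub rectangle_lmeasurable] continuous_bounded_L2[OF gc gb rectangle_lmeasurable]
      continuous_bounded_L2_loc[OF uc ub] continuous_bounded_L2_loc[OF gc gb] C1_weak_gradient[OF ud gc oR]
    by blast
  obtain K where K: "K > 0" "\<And>n x. x \<in> {0<..<1} \<Longrightarrow> \<bar>cutoff' n x\<bar> * min x (1 - x) \<le> K"
    using cutoff'_bound by blast
  have sinb: "\<bar>sin (l * x$1)\<bar> \<le> real j * pi * min (x$1 / a) (1 - x$1 / a)" if x: "x \<in> ?R" for x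
  proof -
    have x1: "0 < x$1" "x$1 < a" using x by (auto simp: mem_rectangle)
    have e: "l * x$1 = real j * pi * (x$1 / a)" by (simp add: l_def)
    have "\<bar>sin (l * x$1)\<bar> \<le> \<bar>l * x$1\<bar>" by (rule abs_sin_x_le_abs_x)
    also have "\<dots> = real j * pi * (x$1 / a)" using x1 ab by (simp add: e abs_mult)
    finally have 1: "\<bar>sin (l * x$1)\<bar> \<le> real j * pi * (x$1 / a)" .
    have "l * x$1 = real j * pi - real j * pi * (1 - x$1 / a)" unfolding e by (simp add: algebra_simps)
    then have "sin (l * x$1) = - (cos (real j * pi) * sin (real j * pi * (1 - x$1 / a)))"
      by (simp add: sin_diff)
    then have "\<bar>sin (l * x$1)\<bar> = \<bar>sin (real j * pi * (1 - x$1 / a))\<bar>"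
      by (simp add: abs_mult)
    also have "\<dots> \<le> \<bar>real j * pi * (1 - x$1 / a)\<bar>" by (rule abs_sin_x_le_abs_x)
    also have "\<dots> = real j * pi * (1 - x$1 / a)" using x1 ab by (simp add: abs_mult)
    finally show ?thesis using 1 by (simp add: min_def)
  qed
  have main: "(\<integral>x. g x \<bullet> q x \<partial>?M) = (\<integral>x. (l^2 * u x) * v x \<partial>?M)"
    if vq: "(v, q) \<in> form_domain ?R (\<lambda>_. 1)" for v q
  proof -
    have wg: "weak_gradient ?R v q" and vL: "v \<in> L2 ?M" and qL: "q \<in> L2 ?M"
      using vq unfolding form_domain_def weighted_1 by auto
    have vm: "v \<in> borel_measurable ?M" and qm: "q \<in> borel_measurable ?M" using vL qL unfolding L2_def by auto
    have fin: "finite_measure ?M" by (rule finite_measure_lebesgue_on[OF rectangle_lmeasurable])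
    have vi: "integrable ?M v" by (rule L2_integrable[OF vL fin])
    have qi: "integrable ?M (\<lambda>x. q x \<bullet> ?e)"
      by (rule integrable_inner_left, rule L2_integrable[OF qL fin])
    \<comment> \<open>\<open>\<phi> n\<close> is the test function \<open>sin (l x\<^sub>1)\<close>, cut off near all four sides.\<close>
    define F where "F = (\<lambda>n t. sin (l * t) * cutoff n (t / a))"
    define F' where "F' = (\<lambda>n t. l * cos (l * t) * cutoff n (t / a) + cutoff' n (t / a) / a * sin (l * t))"
    define \<phi> where "\<phi> = (\<lambda>n (x::real^2). F n (x$1) * cutoff n (x$2 / b))"
    have Fd: "(F n has_real_derivative F' n t) (at t)" for n t
    proof -
      have 1: "((\<lambda>t. sin (l * t)) has_real_derivative l * cos (l * t)) (at t)"
        by (auto intro!: derivative_eq_intros)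
      have 2: "((\<lambda>t. cutoff n (t / a)) has_real_derivative cutoff' n (t / a) * (1 / a)) (at t)"
        by (rule DERIV_chain2[where f="cutoff n" and g="\<lambda>t. t / a", OF cutoff_DERIV])
           (use ab in \<open>auto intro!: derivative_eq_intros\<close>)
      show ?thesis unfolding F_def F'_def using DERIV_mult[OF 1 2] by simp
    qed
    have \<phi>d: "(\<phi> n has_derivative (\<lambda>h. F n (x$1) * (h$2 * (cutoff' n (x$2 / b) / b)) + (h$1 * F' n (x$1)) * cutoff n (x$2 / b))) (at x)" for n x
    proof -
      have 1: "((\<lambda>x::real^2. F n (x$1)) has_derivative (\<lambda>h. h$1 * F' n (x$1))) (at x)"
        by (rule DERIV_compose_FDERIV[OF Fd nth_has_derivative])
      have c: "((\<lambda>t. cutoff n (t / b)) has_real_derivative cutoff' n (t / b) / b) (at t)" for t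
      proof -
        have "((\<lambda>t. cutoff n (t / b)) has_real_derivative cutoff' n (t / b) * (1 / b)) (at t)"
          by (rule DERIV_chain2[where f="cutoff n" and g="\<lambda>t. t / b", OF cutoff_DERIV])
             (use ab in \<open>auto intro!: derivative_eq_intros\<close>)
        then show ?thesis by simp
      qed
      have 2: "((\<lambda>x::real^2. cutoff n (x$2 / b)) has_derivative (\<lambda>h. h$2 * (cutoff' n (x$2 / b) / b))) (at x)"
        by (rule DERIV_compose_FDERIV[OF c nth_has_derivative])
      show ?thesis unfolding \<phi>_def by (rule has_derivative_mult[OF 1 2])
    qed
    have \<phi>1: "frechet_derivative (\<phi> n) (at x) ?e = F' n (x$1) * cutoff n (x$2 / b)" for n x
    proof -
      have "frechet_derivative (\<phi> n) (at x) = (\<lambda>h. F n (x$1) * (h$2 * (cutoff' n (x$2 / b) / b)) + (h$1 * F' n (x$1)) * cutoff n (x$2 / b))"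
        using frechet_derivative_at[OF \<phi>d] by simp
      then show ?thesis by (simp add: axis_def)
    qed
    have \<phi>t: "\<phi> n \<in> test_functions ?R" if n: "n \<ge> 2" for n
    proof (rule test_functionsI)
      show "C_k m (\<phi> n)" for m
      proof -
        have "C_k m (\<lambda>x::real^2. (sin (l * (x \<bullet> ?e) + 0) * cutoff n (1 / a * (x \<bullet> ?e) + 0)) * cutoff n (1 / b * (x \<bullet> axis 2 1) + 0))"
          by (intro C_k_mult C_k_compose_inner C_k_cutoff conjunct1[OF C_k_sin_cos])
        then show ?thesis by (simp add: \<phi>_def F_def inner_axis1 inner_axis2)
      qed
      have n0: "n > 0" using n by simp
      let ?K = "cbox (vector [a / n, b / n]) (vector [a - a / n, b - b / n]) :: (real^2) set"
      show "compact ?K" by (rule compact_cbox)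
      show "?K \<subseteq> ?R"
      proof
        fix x assume "x \<in> ?K"
        then have x: "a / n \<le> x$1" "x$1 \<le> a - a / n" "b / n \<le> x$2" "x$2 \<le> b - b / n"
          by (auto simp: mem_box_cart forall_2)
        have "0 < a / n" "0 < b / n" using ab n0 by simp_all
        then show "x \<in> ?R" using x unfolding mem_rectangle by linarith
      qed
      fix x assume "x \<notin> ?K"
      then have "x$1 < a / n \<or> a - a / n < x$1 \<or> x$2 < b / n \<or> b - b / n < x$2"
        by (auto simp: mem_box_cart forall_2 not_le)
      then have "x$1 / a \<notin> {1 / n<..<1 - 1 / n} \<or> x$2 / b \<notin> {1 / n<..<1 - 1 / n}"
        using ab by (auto simp: field_simps)
      then show "\<phi> n x = 0" using cutoff_outside[OF n0] by (auto simp: \<phi>_def F_def)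
    qed
    have eq: "(\<integral>x. v x * (F' n (x$1) * cutoff n (x$2 / b)) \<partial>?M) = - (\<integral>x. (q x \<bullet> ?e) * \<phi> n x \<partial>?M)" if n: "n \<ge> 2" for n
    proof -
      have "?e \<in> Basis" by simp
      then have "(\<integral>x. v x * frechet_derivative (\<phi> n) (at x) ?e \<partial>?M) = - (\<integral>x. (q x \<bullet> ?e) * \<phi> n x \<partial>?M)"
        using wg \<phi>t[OF n] unfolding weak_gradient_def by blast
      then show ?thesis by (simp only: \<phi>1)
    qed
    have ev: "\<forall>\<^sub>F n in sequentially. cutoff n (x$1 / a) = 1 \<and> cutoff' n (x$1 / a) = 0 \<and> cutoff n (x$2 / b) = 1"
      if x: "x \<in> ?R" for x
    proof -
      have "x$1 / a \<in> {0<..<1}" "x$2 / b \<in> {0<..<1}" using x ab by (auto simp: mem_rectangle)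
      from eventually_conj[OF cutoff_eventually[OF this(1)] cutoff_eventually[OF this(2)]]
      show ?thesis by (rule eventually_mono) simp
    qed
    note cc = continuous_on_cutoff(1) and cc' = continuous_on_cutoff(2)
    have m1: "(\<lambda>x. F' n (x$1) * cutoff n (x$2 / b)) \<in> borel_measurable ?M" for n
      by (rule continuous_imp_measurable_on_sets_lebesgue[OF _ Rl], unfold F'_def)
         (use ab in \<open>intro continuous_intros continuous_on_compose2[OF cc] continuous_on_compose2[OF cc'], auto\<close>)
    have m2: "\<phi> n \<in> borel_measurable ?M" for n
      by (rule continuous_imp_measurable_on_sets_lebesgue[OF _ Rl], unfold \<phi>_def F_def)
         (use ab in \<open>intro continuous_intros continuous_on_compose2[OF cc], auto\<close>)
    have m3: "(\<lambda>x. l * cos (l * x$1)) \<in> borel_measurable ?M" "(\<lambda>x. sin (l * x$1)) \<in> borel_measurable ?M"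
      by (rule continuous_imp_measurable_on_sets_lebesgue[OF _ Rl], intro continuous_intros)+
    have lim1: "(\<lambda>n. \<integral>x. v x * (F' n (x$1) * cutoff n (x$2 / b)) \<partial>?M) \<longlonglongrightarrow> (\<integral>x. v x * (l * cos (l * x$1)) \<partial>?M)"
    proof (rule integral_tendsto_eventually_eq[where w="\<lambda>x. (\<bar>l\<bar> + real j * pi * K / a) * \<bar>v x\<bar>"])
      show "integrable ?M (\<lambda>x. (\<bar>l\<bar> + real j * pi * K / a) * \<bar>v x\<bar>)"
        by (intro Bochner_Integration.integrable_mult_right Bochner_Integration.integrable_abs vi)
      show "(\<lambda>x. v x * (F' n (x$1) * cutoff n (x$2 / b))) \<in> borel_measurable ?M" for n
        by (intro borel_measurable_times[OF vm m1])
      show "(\<lambda>x. v x * (l * cos (l * x$1))) \<in> borel_measurable ?M" by (intro borel_measurable_times[OF vm m3(1)])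
      show "\<forall>\<^sub>F n in sequentially. v x * (F' n (x$1) * cutoff n (x$2 / b)) = v x * (l * cos (l * x$1))"
        if "x \<in> space ?M" for x
        by (rule eventually_mono[OF ev]) (use that in \<open>auto simp: F'_def\<close>)
      show "\<bar>v x * (F' n (x$1) * cutoff n (x$2 / b))\<bar> \<le> (\<bar>l\<bar> + real j * pi * K / a) * \<bar>v x\<bar>"
        if "x \<in> space ?M" for n x
      proof -
        from that have x: "x \<in> ?R" by simp
        have s: "x$1 / a \<in> {0<..<1}" using x ab by (auto simp: mem_rectangle)
        have "\<bar>l * cos (l * x$1) * cutoff n (x$1 / a)\<bar> \<le> (\<bar>l\<bar> * 1) * 1"
          unfolding abs_mult by (intro mult_mono abs_cos_le_one cutoff_bounds) auto
        moreover have "\<bar>cutoff' n (x$1 / a) / a * sin (l * x$1)\<bar> \<le> real j * pi * K / a"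
        proof -
          have "\<bar>cutoff' n (x$1 / a)\<bar> * \<bar>sin (l * x$1)\<bar> \<le> \<bar>cutoff' n (x$1 / a)\<bar> * (real j * pi * min (x$1 / a) (1 - x$1 / a))"
            by (intro mult_left_mono sinb[OF x]) simp
          also have "\<dots> = real j * pi * (\<bar>cutoff' n (x$1 / a)\<bar> * min (x$1 / a) (1 - x$1 / a))" by (simp only: mult_ac)
          also have "\<dots> \<le> real j * pi * K" by (intro mult_left_mono K(2)[OF s]) simp
          finally show ?thesis using ab by (simp add: abs_mult abs_divide divide_right_mono)
        qed
        ultimately have "\<bar>F' n (x$1)\<bar> \<le> \<bar>l\<bar> + real j * pi * K / a"
          unfolding F'_def by (intro order_trans[OF abs_triangle_ineq]) simp
        then have "\<bar>F' n (x$1)\<bar> * \<bar>cutoff n (x$2 / b)\<bar> \<le> (\<bar>l\<bar> + real j * pi * K / a) * 1"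
          using K ab by (intro mult_mono cutoff_bounds) auto
        then have "\<bar>v x\<bar> * (\<bar>F' n (x$1)\<bar> * \<bar>cutoff n (x$2 / b)\<bar>) \<le> \<bar>v x\<bar> * ((\<bar>l\<bar> + real j * pi * K / a) * 1)"
          by (rule mult_left_mono) simp
        then show ?thesis
          unfolding abs_mult by (simp only: mult_1_right mult.commute)
      qed
    qed
    have lim2: "(\<lambda>n. \<integral>x. (q x \<bullet> ?e) * \<phi> n x \<partial>?M) \<longlonglongrightarrow> (\<integral>x. (q x \<bullet> ?e) * sin (l * x$1) \<partial>?M)"
    proof (rule integral_tendsto_eventually_eq[where w="\<lambda>x. \<bar>q x \<bullet> ?e\<bar>"])
      show "integrable ?M (\<lambda>x. \<bar>q x \<bullet> ?e\<bar>)" by (rule Bochner_Integration.integrable_abs[OF qi])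
      show "(\<lambda>x. (q x \<bullet> ?e) * \<phi> n x) \<in> borel_measurable ?M" for n
        by (intro borel_measurable_times borel_measurable_integrable[OF qi] m2)
      show "(\<lambda>x. (q x \<bullet> ?e) * sin (l * x$1)) \<in> borel_measurable ?M"
        by (intro borel_measurable_times borel_measurable_integrable[OF qi] m3)
      show "\<forall>\<^sub>F n in sequentially. (q x \<bullet> ?e) * \<phi> n x = (q x \<bullet> ?e) * sin (l * x$1)"
        if "x \<in> space ?M" for x
        by (rule eventually_mono[OF ev]) (use that in \<open>auto simp: \<phi>_def F_def\<close>)
      show "\<bar>(q x \<bullet> ?e) * \<phi> n x\<bar> \<le> \<bar>q x \<bullet> ?e\<bar>" for n x
      proof -
        have "\<bar>\<phi> n x\<bar> \<le> (1 * 1) * 1"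
          unfolding \<phi>_def F_def abs_mult by (intro mult_mono abs_sin_le_one cutoff_bounds) auto
        then have "\<bar>q x \<bullet> ?e\<bar> * \<bar>\<phi> n x\<bar> \<le> \<bar>q x \<bullet> ?e\<bar> * 1" by (intro mult_left_mono) auto
        then show ?thesis
          unfolding abs_mult by (simp only: mult_1_right)
      qed
    qed
    have "\<forall>\<^sub>F n in sequentially. (\<integral>x. v x * (F' n (x$1) * cutoff n (x$2 / b)) \<partial>?M) = - (\<integral>x. (q x \<bullet> ?e) * \<phi> n x \<partial>?M)"
      using eq by (rule eventually_sequentiallyI)
    with lim1 have "(\<lambda>n. - (\<integral>x. (q x \<bullet> ?e) * \<phi> n x \<partial>?M)) \<longlonglongrightarrow> (\<integral>x. v x * (l * cos (l * x$1)) \<partial>?M)"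
      by (rule Lim_transform_eventually)
    then have key: "(\<integral>x. v x * (l * cos (l * x$1)) \<partial>?M) = - (\<integral>x. (q x \<bullet> ?e) * sin (l * x$1) \<partial>?M)"
      using tendsto_minus[OF lim2] LIMSEQ_unique by blast
    have "(\<integral>x. g x \<bullet> q x \<partial>?M) = (\<integral>x. (- l) * ((q x \<bullet> ?e) * sin (l * x$1)) \<partial>?M)"
      by (rule Bochner_Integration.integral_cong[OF refl]) (simp add: g_def inner_commute mult_ac)
    also have "\<dots> = l * (- (\<integral>x. (q x \<bullet> ?e) * sin (l * x$1) \<partial>?M))" by simp
    also have "\<dots> = l * (\<integral>x. v x * (l * cos (l * x$1)) \<partial>?M)" by (simp only: key)
    also have "\<dots> = (\<integral>x. l * (v x * (l * cos (l * x$1))) \<partial>?M)" by simp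
    also have "\<dots> = (\<integral>x. (l^2 * u x) * v x \<partial>?M)"
      by (rule Bochner_Integration.integral_cong[OF refl]) (simp add: u_def power2_eq_square mult_ac)
    finally show ?thesis .
  qed
  have "(\<lambda>x. l^2 * u x) \<in> L2 ?M"
  proof (rule continuous_bounded_L2[OF _ _ rectangle_lmeasurable])
    show "continuous_on UNIV (\<lambda>x. l^2 * u x)" by (intro continuous_intros uc)
    show "norm (l^2 * u x) \<le> l^2" for x
      using mult_left_mono[OF ub[of x], of "l^2"] by (simp add: abs_mult)
  qed
  then have "form_operator ?R (\<lambda>_. 1) u (\<lambda>x. l^2 * u x)"
    unfolding form_operator_def weighted_1 using fd main by auto
  then show ?thesis unfolding eigenspace_def by (simp add: u_def l_def)
qed

theorem rectangle_eigenvalue_upper_bound: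
  assumes ab: "0 < a" "0 < b"
  shows "neumann_eigenvalue k (rectangle a b) \<le> (real k * pi / a)^2"
  unfolding neumann_eigenvalue_def kth_eigenvalue_def
proof (rule cInf_lower)
  let ?R = "rectangle a b"
  let ?E = "\<lambda>\<mu>. multiplicity ?R (\<lambda>_. 1) \<mu>"
  let ?T = "{t. \<exists>F. finite F \<and> F \<subseteq> {..t} \<and> enat k < (\<Sum>\<mu>\<in>F. ?E \<mu>)}"
  define f where "f = (\<lambda>j. (real j * pi / a)^2)"
  have m1: "1 \<le> ?E (f j)" for j
    unfolding f_def
  proof (rule multiplicity_ge_1I[OF rectangle_eigenfunction[OF ab]])
    show "\<not> (AE x in weighted ?R (\<lambda>_. 1). cos (real j * pi / a * x$1) = 0)"
    proof
      assume "AE x in weighted ?R (\<lambda>_. 1). cos (real j * pi / a * x$1) = 0"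
      then have ae: "AE x in lebesgue. x \<in> ?R \<longrightarrow> cos (real j * pi / a * x$1) = 0"
        unfolding weighted_1 using rectangle_lmeasurable
        by (subst (asm) AE_restrict_space_iff) (auto simp: fmeasurableD)
      \<comment> \<open>For \<open>0 < x\<^sub>1 < c\<close> the argument of the cosine is below \<open>\<pi> / 2\<close>.\<close>
      define c where "c = a / (2 * (real j + 1))"
      have c: "0 < c" "c < a" using ab by (auto simp: c_def field_simps add_pos_nonneg)
      have "AE x in lebesgue. x \<notin> rectangle c b"
        using ae
      proof eventually_elim
        case (elim x)
        show ?case
        proof
          assume x: "x \<in> rectangle c b"
          then have xR: "x \<in> ?R" and x1: "0 < x$1" "x$1 < c" using c by (auto simp: mem_rectangle)
          have "real j * pi / a * x$1 \<le> real j * pi / a * c" using x1 ab by (intro mult_left_mono) auto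
          also have "\<dots> = (real j / (real j + 1)) * (pi / 2)" using ab by (simp add: c_def)
          also have "\<dots> < 1 * (pi / 2)" by (intro mult_strict_right_mono) auto
          finally have "real j * pi / a * x$1 < pi / 2" by simp
          moreover have "- (pi / 2) < real j * pi / a * x$1"
            by (rule less_le_trans[of _ 0]) (use x1 ab in auto)
          ultimately have "cos (real j * pi / a * x$1) > 0" by (intro cos_gt_zero_pi) auto
          then show False using elim xR by auto
        qed
      qed
      then have "negligible (rectangle c b)"
        by (simp add: negligible_iff_null_sets AE_iff_null_sets rectangle_def)
      moreover have "open (rectangle c b)" by (simp add: rectangle_def open_box)
      moreover have "vector [c/2, b/2] \<in> rectangle c b" using c ab by (simp add: mem_rectangle)
      ultimately show False using open_not_negligible by blast
    qed
  qed
  have inj: "inj_on f {..k}"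
  proof (rule inj_onI)
    fix i j assume "f i = f j"
    then have "real i * pi / a = real j * pi / a"
      unfolding f_def by (rule power2_eq_imp_eq) (use ab in auto)
    then show "i = j" using ab by simp
  qed
  have "(\<Sum>\<mu>\<in>f ` {..k}. 1) \<le> (\<Sum>\<mu>\<in>f ` {..k}. ?E \<mu>)" using m1 by (intro sum_mono) auto
  moreover have "(\<Sum>\<mu>\<in>f ` {..k}. 1 :: enat) = enat (Suc k)"
    using inj by (simp add: card_image of_nat_eq_enat)
  ultimately have "enat (Suc k) \<le> (\<Sum>\<mu>\<in>f ` {..k}. ?E \<mu>)" by simp
  then have "enat k < (\<Sum>\<mu>\<in>f ` {..k}. ?E \<mu>)" using less_le_trans[of "enat k" "enat (Suc k)"] by simp
  moreover have "f ` {..k} \<subseteq> {..(real k * pi / a)^2}"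
  proof clarify
    fix j assume "j \<le> k"
    then show "f j \<le> (real k * pi / a)^2"
      unfolding f_def using ab by (intro power_mono divide_right_mono mult_right_mono) auto
  qed
  ultimately show "(real k * pi / a)^2 \<in> ?T" by blast
  show "bdd_below ?T"
  proof (rule bdd_belowI[of _ 0])
    fix t assume "t \<in> ?T"
    then obtain F where F: "finite F" "F \<subseteq> {..t}" "enat k < (\<Sum>\<mu>\<in>F. ?E \<mu>)" by blast
    have "\<exists>\<mu>\<in>F. ?E \<mu> \<noteq> 0"
    proof (rule ccontr)
      assume "\<not> ?thesis"
      then have "(\<Sum>\<mu>\<in>F. ?E \<mu>) = 0" by (intro sum.neutral) auto
      then show False using F(3) by simp
    qed
    then obtain \<mu> where \<mu>: "\<mu> \<in> F" "?E \<mu> \<noteq> 0" by blast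
    have "\<not> \<mu> < 0"
      using \<mu>(2) multiplicity_eq_0I[of ?R "\<lambda>_. 1" \<mu>] eigenfunction_negative_AE_zero by blast
    then show "0 \<le> t" using F(2) \<mu>(1) by auto
  qed
qed

section \<open>The rectangle with its diagonal\<close>

text \<open>Only the values of the weight on \<open>U\<close> matter.\<close>

lemma kth_eigenvalue_cong:
  assumes w: "\<And>x. x \<in> U \<Longrightarrow> w x = w' x" and m: "w \<in> borel_measurable (lebesgue_on U)"
    and U: "U \<in> sets lebesgue"
  shows "kth_eigenvalue U w' k = kth_eigenvalue U w k"
proof -
  have sp: "space (lebesgue_on U) = U" using U by (simp add: space_restrict_space)
  have m': "w' \<in> borel_measurable (lebesgue_on U)"
    using m measurable_cong[of "lebesgue_on U" w w' borel] w sp by simp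
  have "weighted U w' = weighted U w"
    unfolding weighted_def
  proof (rule density_cong)
    show "AE x in lebesgue_on U. ennreal (w' x) = ennreal (w x)"
      by (rule AE_I2) (simp add: w)
  qed (use m m' in simp_all)
  then show ?thesis
    by (simp only: kth_eigenvalue_def multiplicity_def eigenspace_def form_operator_def form_domain_def)
qed

context
  fixes a b :: real
  assumes ab: "0 < a" "0 < b" and circ: "a^2 + b^2 = 1" and bsmall: "b \<le> 1/2"
begin

lemma side_bounds: "b^2 \<le> 1/4" "0 < b^2" "b^2 \<le> a^2" "a^2 = 1 - b^2" "b \<le> a"
proof -
  have "b^2 \<le> (1/2)^2" using ab bsmall by (intro power_mono) auto
  then show 1: "b^2 \<le> 1/4" by (simp add: power2_eq_square)
  show "0 < b^2" using ab by simp
  show "a^2 = 1 - b^2" using circ by simp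
  then show 2: "b^2 \<le> a^2" using 1 by simp
  show "b \<le> a" using 2 ab by (auto intro: power2_le_imp_le)
qed

text \<open>In the coordinates given by the diagonal, the four sides bound \<open>y\<close> by linear functions of \<open>x\<close>; the
  shape of the section changes at \<open>x = b\<^sup>2\<close> and \<open>x = 1 - b\<^sup>2 = a\<^sup>2\<close>, below the corners.\<close>

lemma section_length_rectangle:
  assumes x: "x \<in> {0<..<1}"
  shows "section_length (rectangle a b) 0 (vector [a, b]) x = 1 / (a * b) * min x (min (b^2) (1 - x))"
proof -
  define hi where "hi = min (x * a^2) ((1 - x) * b^2) / (a * b)"
  define lo where "lo = - (min (x * b^2) ((1 - x) * a^2) / (a * b))"
  have p: "0 < a * b" using ab by simp
  have set_eq: "{y. coord_point 0 (vector [a, b]) x y \<in> rectangle a b} = {lo<..<hi}"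
  proof (intro set_eqI)
    fix y
    have c1: "0 < x * a - y * b \<longleftrightarrow> y * (a * b) < x * a^2"
    proof -
      have "0 < x * a - y * b \<longleftrightarrow> 0 < a * (x * a - y * b)" using ab by (simp add: zero_less_mult_iff)
      then show ?thesis by (simp add: algebra_simps power2_eq_square)
    qed
    have c2: "x * a - y * b < a \<longleftrightarrow> - ((1 - x) * a^2) < y * (a * b)"
    proof -
      have "x * a - y * b < a \<longleftrightarrow> 0 < a * (a - (x * a - y * b))" using ab by (simp add: zero_less_mult_iff)
      then show ?thesis by (simp add: algebra_simps power2_eq_square)
    qed
    have c3: "0 < x * b + y * a \<longleftrightarrow> - (x * b^2) < y * (a * b)"
    proof -
      have 1: "0 < x * b + y * a \<longleftrightarrow> 0 < b * (x * b + y * a)" using ab by (simp add: zero_less_mult_iff)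
      have 2: "b * (x * b + y * a) = y * (a * b) - - (x * b^2)" by (simp add: algebra_simps power2_eq_square)
      show ?thesis unfolding 1 2 by (rule diff_gt_0_iff_gt)
    qed
    have c4: "x * b + y * a < b \<longleftrightarrow> y * (a * b) < (1 - x) * b^2"
    proof -
      have "x * b + y * a < b \<longleftrightarrow> 0 < b * (b - (x * b + y * a))" using ab by (simp add: zero_less_mult_iff)
      then show ?thesis by (simp add: algebra_simps power2_eq_square)
    qed
    have "coord_point 0 (vector [a, b]) x y \<in> rectangle a b \<longleftrightarrow>
      0 < x * a - y * b \<and> x * a - y * b < a \<and> 0 < x * b + y * a \<and> x * b + y * a < b"
      by (simp add: mem_rectangle coord_point_def rot90_def)
    also have "\<dots> \<longleftrightarrow> y * (a * b) < min (x * a^2) ((1 - x) * b^2) \<and> - min (x * b^2) ((1 - x) * a^2) < y * (a * b)"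
      unfolding c1 c2 c3 c4 by (auto simp: min_def)
    also have "\<dots> \<longleftrightarrow> y \<in> {lo<..<hi}"
      using p by (simp add: lo_def hi_def pos_less_divide_eq minus_divide_left pos_divide_less_eq del: minus_divide_left[symmetric]) (auto simp: field_simps)
    finally show "y \<in> {y. coord_point 0 (vector [a, b]) x y \<in> rectangle a b} \<longleftrightarrow> y \<in> {lo<..<hi}" by simp
  qed
  have e: "min (x * a^2) ((1 - x) * b^2) + min (x * b^2) ((1 - x) * a^2) = min x (min (b^2) (1 - x))"
  proof -
    define c where "c = b^2"
    have a2: "a^2 = 1 - c" using side_bounds by (simp add: c_def)
    have c: "0 < c" "c \<le> 1/4" using side_bounds by (simp_all add: c_def)
    have m1: "min (x * (1 - c)) ((1 - x) * c) = (if x \<le> c then x * (1 - c) else (1 - x) * c)"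
      by (auto simp: min_def algebra_simps)
    have m2: "min (x * c) ((1 - x) * (1 - c)) = (if x \<le> 1 - c then x * c else (1 - x) * (1 - c))"
      by (auto simp: min_def algebra_simps)
    show ?thesis
      unfolding a2 c_def[symmetric] m1 m2 using c x by (auto simp: min_def algebra_simps)
  qed
  have "hi - lo = (min (x * a^2) ((1 - x) * b^2) + min (x * b^2) ((1 - x) * a^2)) / (a * b)"
    by (simp add: hi_def lo_def add_divide_distrib)
  then have d: "hi - lo = 1 / (a * b) * min x (min (b^2) (1 - x))" unfolding e by simp
  have "0 \<le> hi - lo" unfolding d using p x side_bounds by simp
  then have "measure lebesgue {lo<..<hi} = hi - lo" by simp
  then show ?thesis unfolding section_length_def set_eq d by simp
qed

lemma rectangle_interval_eigenvalue:
  assumes k: "2 * b^2 * (real k * pi) \<le> 1 - 2 * b^2"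
  shows "(real k * pi / (1 - 6/7 * b^2))^2 \<le> interval_eigenvalue k (rectangle a b) 0 (vector [a, b])"
proof -
  have t: "trapezoid (1 / (a * b)) (b^2)"
    by unfold_locales (use ab side_bounds in auto)
  interpret T: trapezoid "1 / (a * b)" "b^2" by (rule t)
  have "interval_eigenvalue k (rectangle a b) 0 (vector [a, b]) = kth_eigenvalue {0<..<1} T.h k"
    unfolding interval_eigenvalue_def
    by (rule kth_eigenvalue_cong[OF _ T.h_measurable])
       (simp_all add: section_length_rectangle T.h_def)
  then show ?thesis using T.trapezoid_eigenvalue_lower_bound[OF k] by simp
qed

lemma norm_diagonal: "norm (vector [a, b] :: real^2) = 1"
  using circ by (simp add: norm_vec_def L2_set_def sum_2)

lemma closure_rectangle: "closure (rectangle a b) = cbox 0 (vector [a, b])"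
proof -
  have "vector [a/2, b/2] \<in> rectangle a b" using ab by (simp add: mem_rectangle)
  then show ?thesis unfolding rectangle_def by (intro closure_box) auto
qed

lemma rectangle_unit_diameter: "unit_diameter_domain (rectangle a b)"
  unfolding unit_diameter_domain_def
proof (intro conjI)
  show "open (rectangle a b)" by (simp add: rectangle_def open_box)
  show "convex (rectangle a b)" by (simp add: rectangle_def convex_box)
  show bd: "bounded (rectangle a b)" by (simp add: rectangle_def bounded_box)
  have "\<forall>i\<in>Basis. (0::real^2) \<bullet> i \<le> vector [a, b] \<bullet> i"
  proof
    fix i :: "real^2" assume "i \<in> Basis"
    then obtain j where "i = axis j 1" using axis_inverse by blast
    moreover have "0 \<le> (vector [a, b] :: real^2) $ j" using ab exhaust_2[of j] by auto
    ultimately show "0 \<bullet> i \<le> vector [a, b] \<bullet> i" by (simp add: inner_axis)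
  qed
  then have "diameter (cbox 0 (vector [a, b] :: real^2)) = dist 0 (vector [a, b] :: real^2)"
    by (rule diameter_cbox)
  then show "diameter (rectangle a b) = 1"
    using diameter_closure[OF bd] by (simp add: closure_rectangle norm_diagonal)
qed

lemma rectangle_diagonal: "diameter_segment (rectangle a b) 0 (vector [a, b])"
  unfolding diameter_segment_def closure_rectangle
  using ab by (simp add: norm_diagonal mem_box_cart forall_2)

lemma bounded_proj: "bounded (proj_perp e ` rectangle a b)"
proof -
  have "bounded_linear (proj_perp e)"
    unfolding proj_perp_def[abs_def]
    by (intro bounded_linear_sub bounded_linear_ident bounded_linear_scaleR_const bounded_linear_inner_left)
  then show ?thesis by (intro bounded_linear_image) (simp_all add: rectangle_def bounded_box)
qed

lemma min_width_rectangle_le: "min_width (rectangle a b) \<le> b"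
proof -
  have "min_width (rectangle a b) \<le> diameter (proj_perp (axis 1 1) ` rectangle a b)"
    unfolding min_width_def
  proof (rule cINF_lower)
    show "bdd_below ((\<lambda>e. diameter (proj_perp e ` rectangle a b)) ` sphere 0 1)"
      by (rule bdd_belowI[of _ 0]) (auto intro: diameter_ge_0 bounded_proj)
    show "axis 1 1 \<in> sphere (0::real^2) 1" by simp
  qed
  also have "\<dots> \<le> b"
  proof (rule diameter_le)
    show "proj_perp (axis 1 1) ` rectangle a b \<noteq> {} \<or> 0 \<le> b" using ab by simp
    fix p q assume "p \<in> proj_perp (axis 1 1) ` rectangle a b" "q \<in> proj_perp (axis 1 1) ` rectangle a b"
    then obtain x y where xy: "x \<in> rectangle a b" "y \<in> rectangle a b"
      "p = proj_perp (axis 1 1) x" "q = proj_perp (axis 1 1) y" by auto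
    have "(p - q)$1 = 0" "(p - q)$2 = x$2 - y$2"
      by (simp_all add: xy proj_perp_def inner_axis1) (simp_all add: axis_def)
    then have "norm (p - q) = \<bar>x$2 - y$2\<bar>" by (simp add: norm_vec_def L2_set_def sum_2)
    also have "\<dots> \<le> b" using xy(1,2) by (auto simp: mem_rectangle)
    finally show "norm (p - q) \<le> b" .
  qed
  finally show ?thesis .
qed

text \<open>The rectangle contains a segment of length \<open>b / 2\<close> in every direction.\<close>

lemma min_width_rectangle_pos: "0 < min_width (rectangle a b)"
proof -
  have "b / 2 \<le> min_width (rectangle a b)"
    unfolding min_width_def
  proof (rule cINF_greatest)
    show "sphere (0::real^2) 1 \<noteq> {}" by simp
    fix e :: "real^2" assume "e \<in> sphere 0 1"
    then have ne: "norm e = 1" by simp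
    define f where "f = rot90 e"
    have fe: "f \<bullet> e = 0" by (simp add: f_def rot90_def inner_vec_def sum_2)
    have nf: "norm f = 1" using ne by (simp add: f_def rot90_def norm_vec_def L2_set_def sum_2 add.commute)
    have fc: "\<bar>f$1\<bar> \<le> 1" "\<bar>f$2\<bar> \<le> 1" using component_le_norm_cart[of f] nf by auto
    define p where "p = vector [a/2, b/2] + (b/4) *\<^sub>R f"
    define q where "q = vector [a/2, b/2] - (b/4) *\<^sub>R f"
    have fb: "\<bar>b/4 * f$1\<bar> \<le> b/4" "\<bar>b/4 * f$2\<bar> \<le> b/4"
      using fc ab mult_left_mono[of "\<bar>f$1\<bar>" 1 "b/4"] mult_left_mono[of "\<bar>f$2\<bar>" 1 "b/4"] by (simp_all add: abs_mult)
    define s where "s = b/4 * f$1"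
    define t where "t = b/4 * f$2"
    have st: "s \<le> b/4" "- s \<le> b/4" "t \<le> b/4" "- t \<le> b/4"
      using fb unfolding s_def t_def abs_le_iff by auto
    have pq: "p$1 = a/2 + s" "p$2 = b/2 + t" "q$1 = a/2 - s" "q$2 = b/2 - t"
      by (simp_all add: p_def q_def s_def t_def)
    have "p \<in> rectangle a b" "q \<in> rectangle a b"
      unfolding mem_rectangle pq using st ab side_bounds(5) by (intro conjI; linarith)+
    then have "dist (proj_perp e p) (proj_perp e q) \<le> diameter (proj_perp e ` rectangle a b)"
      by (intro diameter_bounded_bound bounded_proj imageI)
    moreover have "proj_perp e p - proj_perp e q = (b/2) *\<^sub>R f"
    proof -
      have "proj_perp e p - proj_perp e q = (p - q) - ((p - q) \<bullet> e) *\<^sub>R e"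
        by (simp add: proj_perp_def algebra_simps)
      moreover have "p - q = (b/2) *\<^sub>R f" by (simp add: p_def q_def scaleR_add_left[symmetric])
      ultimately show ?thesis using fe by simp
    qed
    then have "dist (proj_perp e p) (proj_perp e q) = b/2" using nf ab by (simp add: dist_norm)
    ultimately show "b / 2 \<le> diameter (proj_perp e ` rectangle a b)" by simp
  qed
  then show ?thesis using ab by simp
qed

text \<open>With \<open>c = b\<^sup>2\<close> the claim rests on \<open>1 - c - (1 - 6/7 c)\<^sup>2 = 5/7 c - 36/49 c\<^sup>2 \<ge> c / 2\<close> for \<open>c \<le> 1/4\<close>.\<close>

lemma rectangle_gap:
  assumes k: "k \<ge> 1" "2 * b^2 * (real k * pi) \<le> 1 - 2 * b^2"
  shows "b^2 \<le> interval_eigenvalue k (rectangle a b) 0 (vector [a, b]) - neumann_eigenvalue k (rectangle a b)"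
proof -
  define c where "c = b^2"
  have c: "0 < c" "c \<le> 1/4" using side_bounds by (simp_all add: c_def)
  define d where "d = (1 - 6/7 * c)^2"
  have a2: "a^2 = 1 - c" using side_bounds by (simp add: c_def)
  have d: "0 < d" "d \<le> 1" using c by (auto simp: d_def power_le_one)
  have "(1 - c) - d = c * (5/7 - 36/49 * c)" by (simp add: d_def power2_eq_square algebra_simps)
  also have "\<dots> \<ge> c * (1/2)" using c by (intro mult_left_mono) auto
  finally have num: "c / 2 \<le> (1 - c) - d" by simp
  have "(1 - c) * d \<le> 1 * 1" using c d by (intro mult_mono) auto
  then have den: "0 < (1 - c) * d" "(1 - c) * d \<le> 1" using c d by auto
  have "c / 2 = (c / 2) / 1" by simp
  also have "\<dots> \<le> ((1 - c) - d) / ((1 - c) * d)" using num den c by (intro frac_le) auto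
  also have "\<dots> = 1 / d - 1 / (1 - c)"
  proof -
    have "1 / d - 1 / (1 - c) = (1 * (1 - c) - 1 * d) / (d * (1 - c))"
      using c d by (intro diff_frac_eq) auto
    then show ?thesis by (simp add: mult.commute)
  qed
  finally have gap: "c / 2 \<le> 1 / d - 1 / (1 - c)" .
  have kp: "9 \<le> (real k * pi)^2"
  proof -
    have "1 * 3 \<le> real k * pi" using k pi_gt3 by (intro mult_mono) auto
    then have "3^2 \<le> (real k * pi)^2" by (intro power_mono) auto
    then show ?thesis by simp
  qed
  have "c \<le> 9 * (c / 2)" using c by simp
  also have "\<dots> \<le> (real k * pi)^2 * (1 / d - 1 / (1 - c))"
    using kp gap c by (intro mult_mono) auto
  also have "\<dots> = (real k * pi / (1 - 6/7 * b^2))^2 - (real k * pi / a)^2"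
    by (simp add: power_divide a2 d_def c_def[symmetric] right_diff_distrib)
  also have "\<dots> \<le> interval_eigenvalue k (rectangle a b) 0 (vector [a, b]) - neumann_eigenvalue k (rectangle a b)"
    by (intro diff_mono rectangle_interval_eigenvalue rectangle_eigenvalue_upper_bound ab k)
  finally show ?thesis by (simp add: c_def)
qed

end

lemma thin_domains_with_gap:
  fixes k :: nat
  assumes k: "k \<ge> 1"
  shows "\<forall>\<^sub>F b in at_right 0. \<exists>\<Omega> A B. unit_diameter_domain \<Omega> \<and> diameter_segment \<Omega> A B \<and>
     0 < min_width \<Omega> \<and> min_width \<Omega> \<le> b \<and>
     b^2 \<le> interval_eigenvalue k \<Omega> A B - neumann_eigenvalue k \<Omega>"
proof -
  have "((\<lambda>b::real. 2 * b^2 * (real k * pi) + 2 * b^2) \<longlongrightarrow> 2 * 0^2 * (real k * pi) + 2 * 0^2) (at_right 0)"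
    by (intro tendsto_intros)
  then have "\<forall>\<^sub>F b in at_right 0. 2 * b^2 * (real k * pi) + 2 * b^2 < 1"
    by (intro order_tendstoD) auto
  moreover have "\<forall>\<^sub>F b::real in at_right 0. b < 1/2" by (auto simp: eventually_at_right_field intro!: exI[of _ "1/2"])
  moreover have "\<forall>\<^sub>F b::real in at_right 0. 0 < b" by (rule eventually_at_right_less)
  ultimately show ?thesis
  proof eventually_elim
    case (elim b)
    define a where "a = sqrt (1 - b^2)"
    have "b^2 \<le> (1/2)^2" using elim by (intro power_mono) auto
    then have b4: "b^2 \<le> 1/4" by (simp add: power2_eq_square)
    then have a: "0 < a" "a^2 + b^2 = 1" by (simp_all add: a_def)
    have b: "0 < b" "b \<le> 1/2" "2 * b^2 * (real k * pi) \<le> 1 - 2 * b^2" using elim by simp_all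
    show ?case
      using rectangle_unit_diameter[OF a(1) b(1) a(2) b(2)] rectangle_diagonal[OF a(1) b(1) a(2) b(2)]
        min_width_rectangle_pos[OF a(1) b(1) a(2) b(2)] min_width_rectangle_le[OF a(1) b(1) a(2) b(2)]
        rectangle_gap[OF a(1) b(1) a(2) b(2) k b(3)] by blast
  qed
qed

theorem corollary9p2:
  fixes k :: nat
  assumes "k \<ge> 1"
  shows "(\<forall>\<eta>::real. \<eta> > 0 \<longrightarrow>
           \<not> (\<exists>C::real. \<forall>\<Omega> A B.
                unit_diameter_domain \<Omega> \<and> diameter_segment \<Omega> A B \<longrightarrow>
                  0 \<le> interval_eigenvalue k \<Omega> A B - neumann_eigenvalue k \<Omega> \<and>
                  interval_eigenvalue k \<Omega> A B - neumann_eigenvalue k \<Omega>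
                    \<le> C * min_width \<Omega> powr (2 + \<eta>)))
       \<and> \<not> (\<exists>\<omega>::real \<Rightarrow> real.
                (\<forall>W>0. \<omega> W \<ge> 0) \<and> \<omega> \<in> o[at_right 0](\<lambda>W. W\<^sup>2) \<and>
                (\<forall>\<Omega> A B.
                   unit_diameter_domain \<Omega> \<and> diameter_segment \<Omega> A B \<longrightarrow>
                     interval_eigenvalue k \<Omega> A B - neumann_eigenvalue k \<Omega>
                       \<le> \<omega> (min_width \<Omega>)))"
proof (intro conjI allI impI notI)
  fix \<eta> :: real
  assume \<eta>: "\<eta> > 0"
  assume "\<exists>C::real. \<forall>\<Omega> A B.
                unit_diameter_domain \<Omega> \<and> diameter_segment \<Omega> A B \<longrightarrow>
                  0 \<le> interval_eigenvalue k \<Omega> A B - neumann_eigenvalue k \<Omega> \<and>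
                  interval_eigenvalue k \<Omega> A B - neumann_eigenvalue k \<Omega>
                    \<le> C * min_width \<Omega> powr (2 + \<eta>)"
  then obtain C where C: "\<And>\<Omega> A B. unit_diameter_domain \<Omega> \<Longrightarrow> diameter_segment \<Omega> A B \<Longrightarrow>
      interval_eigenvalue k \<Omega> A B - neumann_eigenvalue k \<Omega> \<le> C * min_width \<Omega> powr (2 + \<eta>)" by blast
  have "((\<lambda>b::real. \<bar>C\<bar> * b powr \<eta>) \<longlongrightarrow> \<bar>C\<bar> * 0) (at_right 0)"
    by (intro tendsto_mult tendsto_const tendsto_zero_powrI[OF tendsto_ident_at tendsto_const _ \<eta>])
       (auto simp: eventually_at_right_field intro!: exI[of _ 1])
  then have "\<forall>\<^sub>F b in at_right 0. \<bar>C\<bar> * b powr \<eta> < 1" by (intro order_tendstoD) auto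
  moreover have "\<forall>\<^sub>F b::real in at_right 0. 0 < b" by (rule eventually_at_right_less)
  ultimately have "\<forall>\<^sub>F b::real in at_right 0. False"
    using thin_domains_with_gap[OF assms]
  proof eventually_elim
    case (elim b)
    then obtain \<Omega> A B where \<Omega>: "unit_diameter_domain \<Omega>" "diameter_segment \<Omega> A B"
      and W: "0 < min_width \<Omega>" "min_width \<Omega> \<le> b"
      and gap: "b^2 \<le> interval_eigenvalue k \<Omega> A B - neumann_eigenvalue k \<Omega>" by blast
    have "b^2 \<le> C * min_width \<Omega> powr (2 + \<eta>)" using gap C[OF \<Omega>] by linarith
    also have "\<dots> \<le> \<bar>C\<bar> * b powr (2 + \<eta>)"
      using W \<eta> by (intro mult_mono powr_mono2) auto
    also have "b powr (2 + \<eta>) = b^2 * b powr \<eta>" using elim(2) by (simp add: powr_add)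
    finally have "b^2 * 1 \<le> b^2 * (\<bar>C\<bar> * b powr \<eta>)" by (simp add: mult_ac)
    then have "1 \<le> \<bar>C\<bar> * b powr \<eta>" using elim(2) by (simp only: mult_le_cancel_left_pos zero_less_power)
    then show False using elim(1) by simp
  qed
  then show False by simp
next
  assume "\<exists>\<omega>::real \<Rightarrow> real.
                (\<forall>W>0. \<omega> W \<ge> 0) \<and> \<omega> \<in> o[at_right 0](\<lambda>W. W\<^sup>2) \<and>
                (\<forall>\<Omega> A B.
                   unit_diameter_domain \<Omega> \<and> diameter_segment \<Omega> A B \<longrightarrow>
                     interval_eigenvalue k \<Omega> A B - neumann_eigenvalue k \<Omega>
                       \<le> \<omega> (min_width \<Omega>))"
  then obtain \<omega> :: "real \<Rightarrow> real" where o: "\<omega> \<in> o[at_right 0](\<lambda>W. W\<^sup>2)"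
    and \<omega>: "\<And>\<Omega> A B. unit_diameter_domain \<Omega> \<Longrightarrow> diameter_segment \<Omega> A B \<Longrightarrow>
      interval_eigenvalue k \<Omega> A B - neumann_eigenvalue k \<Omega> \<le> \<omega> (min_width \<Omega>)" by blast
  have "\<forall>\<^sub>F W in at_right 0. norm (\<omega> W) \<le> 1/2 * norm (W\<^sup>2)"
    by (rule landau_o.smallD[OF o]) simp
  then obtain \<delta> where \<delta>: "\<delta> > 0" "\<And>W. 0 < W \<Longrightarrow> W < \<delta> \<Longrightarrow> norm (\<omega> W) \<le> 1/2 * norm (W\<^sup>2)"
    unfolding eventually_at_right_field by auto
  have "\<forall>\<^sub>F b in at_right 0. b < \<delta>" using \<delta>(1) by (auto simp: eventually_at_right_field)
  then have "\<forall>\<^sub>F b::real in at_right 0. False"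
    using thin_domains_with_gap[OF assms]
  proof eventually_elim
    case (elim b)
    then obtain \<Omega> A B where \<Omega>: "unit_diameter_domain \<Omega>" "diameter_segment \<Omega> A B"
      and W: "0 < min_width \<Omega>" "min_width \<Omega> \<le> b"
      and gap: "b^2 \<le> interval_eigenvalue k \<Omega> A B - neumann_eigenvalue k \<Omega>" by blast
    let ?W = "min_width \<Omega>"
    have "?W\<^sup>2 \<le> b^2" using W by (intro power_mono) auto
    also have "\<dots> \<le> \<omega> ?W" using gap \<omega>[OF \<Omega>] by linarith
    also have "\<dots> \<le> norm (\<omega> ?W)" by simp
    also have "\<dots> \<le> 1/2 * norm (?W\<^sup>2)" using W elim by (intro \<delta>(2)) auto
    finally have "?W\<^sup>2 \<le> 0" by simp
    then show False using W by simp
  qed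
  then show False by simp
qed

end
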